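(* Let $S$ be a semitopological semigroup and let $(S,(K,\mathrm{weak}^* ))$ be a nonexpansive dynamical system, where $K$ is a nonempty weak$^*$ compact convex subset of the dual space $X^*$ of an $M$-embedded Banach space $X$. Suppose that one of the following conditions holds: (i) $AP(S)$ has a left invariant mean and the translations $\lambda_s:K\to K$, $s\in S$, are weak$^*$ equicontinuous; (ii) $WAP(S)$ has a left invariant mean and the enveloping semigroup $E(S,K)$ consists of weak$^*$ continuous functions; (iii) $LMC(S)$ has a left invariant mean; (iv) $WAP(S)\cap LUC(S)$ has a left invariant mean, the enveloping semigroup $E(S,K)$ consists of weak$^*$ continuous functions and the action $\pi:S\times K\to K$ is jointly continuous when $K$ is given the weak$^*$ topology; (v) $LUC(S)$ has a left invariant mean and the action $\pi:S\times K\to K$ is jointly continuous when $K$ is given the weak$^*$ topology. Then there is a fixed point of $S$ in $K$, and the set $F(S)=\{x\in K: sx=x\text{ for every }s\in S\}$ of fixed points is a nonexpansive retract of $K$, i.e. there is a mapping $r:K\to K$ with $r(K)=F(S)$, $r\circ r=r$ and $\|r(x)-r(y)\|\le\|x-y\|$ for all $x,y\in K$.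
   Context: A semitopological semigroup is a (nonempty) semigroup $S$ with a Hausdorff topology such that for each $t\in S$ the maps $s\mapsto ts$ and $s\mapsto st$ are continuous. $\ell^\infty(S)$ is the Banach space of bounded complex-valued functions on $S$ with the supremum norm; for $s\in S$, $L_sf(t)=f(st)$ and $R_sf(t)=f(ts)$. $C(S)$ is the closed subalgebra of bounded continuous functions. For $f\in C(S)$: $f\in LUC(S)$ if $s\mapsto L_sf$ is continuous from $S$ to $C(S)$ with the norm topology; $f\in LMC(S)$ if $s\mapsto L_sf$ is continuous from $S$ to $C(S)$ with the topology induced by the multiplicative means on $C(S)$ (functionals $\mu\in C(S)^*$ with $\|\mu\|=\mu(1)=1$ and $\mu(fg)=\mu(f)\mu(g)$); $f\in AP(S)$ (respectively $f\in WAP(S)$) if $\{L_sf:s\in S\}$ is relatively compact in the norm (respectively weak) topology of $C(S)$. If $Y$ is a closed linear subspace of $\ell^\infty(S)$ containing constants with $L_s(Y)\subset Y$, $R_s(Y)\subset Y$ for all $s$ (as are all these spaces), a left invariant mean on $Y$ is $\mu\in Y^*$ with $\|\mu\|=\mu(1)=1$ and $\mu(L_sf)=\mu(f)$ for all $s\in S$, $f\in Y$. A dynamical system $(S,K)$ consists of a semitopological semigroup $S$, a topological space $K$ and an action $\pi:S\times K\to K$, $(s,x)\mapsto sx$, with $s_1(s_2x)=(s_1s_2)x$, which is separately continuous (all maps $s\mapsto sx$ and all translations $\lambda_s:x\mapsto sx$ are continuous). $(S,(K,\mathrm{weak}^* ))$ means that $K\subset X^*$ carries the weak$^*$ topology.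 The enveloping semigroup $E(S,K)$ is the closure of $\{\lambda_s:s\in S\}$ in $K^K$ with the product topology, $K$ being given the weak$^*$ topology. Nonexpansive means $\|sx-sy\|\le\|x-y\|$ for all $s\in S$, $x,y\in K$. A fixed point is $x\in K$ with $sx=x$ for all $s\in S$. A Banach space $X$ is $M$-embedded if $X$ is an $M$-ideal in its bidual $X^{**}$, i.e. the annihilator $X^\perp\subset X^{***}$ is an $\ell^1$-summand: $X^{***}=X^\perp\oplus_1 V$ for some closed subspace $V$ of $X^{***}$. *)

theory Defs
  imports "HOL-Analysis.Analysis" "HOL-Library.Function_Algebras"
begin

section \<open>Banach spaces over the real or complex numbers\<close>

text \<open>
  A field in this class is isometrically isomorphic to the field of real or of complex numbers:
  the norm of a \<^class>\<open>real_normed_field\<close> is multiplicative and extends the absolute value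
  of the reals, which forces the norm of \<open>a + b i\<close> to be the usual modulus.
\<close>

class real_or_complex = real_normed_field +
  assumes real_or_complex:
    "(\<forall>z. \<exists>a. z = a *\<^sub>R 1) \<or>
     (\<exists>i. i * i = - 1 \<and> (\<forall>z. \<exists>a b. z = a *\<^sub>R 1 + b *\<^sub>R i))"

instance real :: real_or_complex
  by standard simp

instance complex :: real_or_complex
proof
  have "\<exists>a b. z = a *\<^sub>R 1 + b *\<^sub>R \<i>" for z
    by (intro exI[of _ "Re z"] exI[of _ "Im z"]) (simp add: complex_eq_iff)
  then show "(\<forall>z::complex. \<exists>a. z = a *\<^sub>R 1) \<or>
      (\<exists>i::complex. i * i = - 1 \<and> (\<forall>z. \<exists>a b. z = a *\<^sub>R 1 + b *\<^sub>R i))"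
    by (intro disjI2 exI[of _ "\<i>"]) simp
qed

locale banach_space_over = vector_space smul
  for smul :: "'k::real_or_complex \<Rightarrow> 'a::banach \<Rightarrow> 'a" +
  assumes scale_of_real: "smul (of_real r) x = r *\<^sub>R x"
    and norm_scale: "norm (smul c x) = norm c * norm x"

lemma banach_space_over_real: "banach_space_over ((*\<^sub>R) :: real \<Rightarrow> 'a::banach \<Rightarrow> 'a)"
  by unfold_locales (auto simp: algebra_simps)

lemma banach_space_over_complex: "banach_space_over ((*) :: complex \<Rightarrow> complex \<Rightarrow> complex)"
  by unfold_locales (auto simp: algebra_simps norm_mult scaleR_conv_of_real)


section \<open>Dual spaces\<close>

definition fscale :: "'k::times \<Rightarrow> ('v \<Rightarrow> 'k) \<Rightarrow> 'v \<Rightarrow> 'k" where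
  "fscale c f = (\<lambda>x. c * f x)"

interpretation fn: vector_space "fscale :: 'k::field \<Rightarrow> ('v \<Rightarrow> 'k) \<Rightarrow> 'v \<Rightarrow> 'k"
  by unfold_locales (auto simp: fscale_def fun_eq_iff algebra_simps)

text \<open>
  The bounded linear functionals on a normed space with carrier \<open>V\<close>, scalar multiplication \<open>sc\<close>
  and norm \<open>N\<close>.  A functional is a function on the whole type that vanishes off \<open>V\<close>, so that
  the dual is a linear subspace of the function space and the construction can be iterated.
\<close>

definition dual :: "'v::ab_group_add set \<Rightarrow> ('k::real_normed_field \<Rightarrow> 'v \<Rightarrow> 'v) \<Rightarrow> ('v \<Rightarrow> real)
    \<Rightarrow> ('v \<Rightarrow> 'k) set" where
  "dual V sc N = {\<phi>.
     (\<forall>x. x \<notin> V \<longrightarrow> \<phi> x = 0) \<and>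
     (\<forall>x\<in>V. \<forall>y\<in>V. \<phi> (x + y) = \<phi> x + \<phi> y) \<and>
     (\<forall>c. \<forall>x\<in>V. \<phi> (sc c x) = c * \<phi> x) \<and>
     (\<exists>C. \<forall>x\<in>V. norm (\<phi> x) \<le> C * N x)}"

definition dual_norm :: "'v set \<Rightarrow> ('v \<Rightarrow> real) \<Rightarrow> ('v \<Rightarrow> 'k::real_normed_field) \<Rightarrow> real" where
  "dual_norm V N \<phi> = (SUP x \<in> {x \<in> V. N x \<le> 1}. norm (\<phi> x))"

text \<open>The topology of the function type is the topology of pointwise convergence.\<close>

definition weak_star :: "'v::ab_group_add set \<Rightarrow> ('k::real_normed_field \<Rightarrow> 'v \<Rightarrow> 'v) \<Rightarrow> ('v \<Rightarrow> real)
    \<Rightarrow> ('v \<Rightarrow> 'k) topology" where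
  "weak_star V sc N = subtopology euclidean (dual V sc N)"

text \<open>The coarsest topology on the whole type for which all members of \<open>\<Phi>\<close> are continuous.\<close>

definition induced_topology :: "('v \<Rightarrow> 'k::topological_space) set \<Rightarrow> 'v topology" where
  "induced_topology \<Phi> =
     pullback_topology UNIV (\<lambda>x. \<lambda>\<phi>\<in>\<Phi>. \<phi> x) (product_topology (\<lambda>_. euclidean) \<Phi>)"


section \<open>M-embedded Banach spaces\<close>

definition closed_subspace :: "('v \<Rightarrow> 'k::real_normed_field) set \<Rightarrow> (('v \<Rightarrow> 'k) \<Rightarrow> real)
    \<Rightarrow> ('v \<Rightarrow> 'k) set \<Rightarrow> bool" where
  "closed_subspace E N V \<longleftrightarrow> V \<subseteq> E \<and> fn.subspace V \<and>
     (\<forall>x\<in>E. (\<forall>e>0. \<exists>v\<in>V. N (x - v) < e) \<longrightarrow> x \<in> V)"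

definition l1_sum :: "('v::ab_group_add) set \<Rightarrow> ('v \<Rightarrow> real) \<Rightarrow> 'v set \<Rightarrow> 'v set \<Rightarrow> bool" where
  "l1_sum E N U V \<longleftrightarrow> U \<inter> V = {0} \<and> E = {u + v | u v. u \<in> U \<and> v \<in> V} \<and>
     (\<forall>u\<in>U. \<forall>v\<in>V. N (u + v) = N u + N v)"

definition M_embedded :: "('k::real_or_complex \<Rightarrow> 'a::banach \<Rightarrow> 'a) \<Rightarrow> bool" where
  "M_embedded smul \<longleftrightarrow>
     (let X1 = dual UNIV smul norm; N1 = dual_norm UNIV norm;
          X2 = dual X1 fscale N1;    N2 = dual_norm X1 N1;
          X3 = dual X2 fscale N2;    N3 = dual_norm X2 N2;
          J = (\<lambda>x \<phi>. if \<phi> \<in> X1 then \<phi> x else 0);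
          annihilator = {\<Phi> \<in> X3. \<forall>x. \<Phi> (J x) = 0}
      in \<exists>V. closed_subspace X3 N3 V \<and> l1_sum X3 N3 annihilator V)"


section \<open>Function spaces on semitopological semigroups\<close>

class semitopological_semigroup = semigroup_mult + t2_space +
  assumes open_vimage_mult_left: "open U \<Longrightarrow> open ((\<lambda>s. t * s) -` U)"
    and open_vimage_mult_right: "open U \<Longrightarrow> open ((\<lambda>s. s * t) -` U)"

lemma semitopological_mult_left:
  fixes t :: "'s::semitopological_semigroup"
  shows "continuous_on UNIV (\<lambda>s. t * s)"
  by (simp add: continuous_on_open_vimage open_vimage_mult_left)

lemma semitopological_mult_right:
  fixes t :: "'s::semitopological_semigroup"
  shows "continuous_on UNIV (\<lambda>s. s * t)"
  by (simp add: continuous_on_open_vimage open_vimage_mult_right)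

unbundle bcontfun.lifting

text \<open>The space \<open>C(S)\<close> is the type \<open>'s \<Rightarrow>\<^sub>C complex\<close> with its supremum norm.\<close>

lift_definition left_translate ::
  "'s::semitopological_semigroup \<Rightarrow> ('s \<Rightarrow>\<^sub>C complex) \<Rightarrow> ('s \<Rightarrow>\<^sub>C complex)"
  is "\<lambda>s f t. f (s * t)"
proof -
  fix s :: 's and f :: "'s \<Rightarrow> complex"
  assume f: "f \<in> bcontfun"
  then have "continuous_on UNIV (\<lambda>t. f (s * t))"
    using continuous_on_compose2[of UNIV f UNIV "\<lambda>t. s * t"] semitopological_mult_left
    by (auto simp: bcontfun_def)
  moreover have "bounded (range (\<lambda>t. f (s * t)))"
    using f by (auto simp: bcontfun_def intro: bounded_subset)
  ultimately show "(\<lambda>t. f (s * t)) \<in> bcontfun"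
    by (simp add: bcontfun_def)
qed

lemma bcontfun_mult:
  fixes f g :: "'s::topological_space \<Rightarrow> complex"
  assumes "f \<in> bcontfun" "g \<in> bcontfun"
  shows "(\<lambda>t. f t * g t) \<in> bcontfun"
proof -
  obtain B C where "\<And>t. norm (f t) \<le> B" "\<And>t. norm (g t) \<le> C"
    using assms by (auto simp: bcontfun_def bounded_iff)
  then have "norm (f t * g t) \<le> B * C" for t
    unfolding norm_mult by (meson mult_mono norm_ge_zero order_trans)
  then have "bounded (range (\<lambda>t. f t * g t))"
    by (auto simp: bounded_iff)
  then show ?thesis
    using assms by (auto simp: bcontfun_def intro: continuous_on_mult)
qed

lift_definition bc_scale ::
  "complex \<Rightarrow> ('s::topological_space \<Rightarrow>\<^sub>C complex) \<Rightarrow> ('s \<Rightarrow>\<^sub>C complex)"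
  is "\<lambda>c f t. c * f t"
  by (intro bcontfun_mult const_bcontfun)

lift_definition bc_mult ::
  "('s::topological_space \<Rightarrow>\<^sub>C complex) \<Rightarrow> ('s \<Rightarrow>\<^sub>C complex) \<Rightarrow> ('s \<Rightarrow>\<^sub>C complex)"
  is "\<lambda>f g t. f t * g t"
  by (intro bcontfun_mult)

definition means :: "('s::topological_space \<Rightarrow>\<^sub>C complex) set \<Rightarrow> (('s \<Rightarrow>\<^sub>C complex) \<Rightarrow> complex) set"
  where "means Y =
    {\<mu> \<in> dual Y bc_scale norm. dual_norm Y norm \<mu> = 1 \<and> \<mu> (const_bcontfun 1) = 1}"

definition multiplicative_means :: "(('s::topological_space \<Rightarrow>\<^sub>C complex) \<Rightarrow> complex) set" where
  "multiplicative_means = {\<mu> \<in> means UNIV. \<forall>f g. \<mu> (bc_mult f g) = \<mu> f * \<mu> g}"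

definition has_left_invariant_mean ::
  "('s::semitopological_semigroup \<Rightarrow>\<^sub>C complex) set \<Rightarrow> bool" where
  "has_left_invariant_mean Y \<longleftrightarrow>
     (\<exists>\<mu> \<in> means Y. \<forall>s. \<forall>f\<in>Y. \<mu> (left_translate s f) = \<mu> f)"

definition LUC :: "('s::semitopological_semigroup \<Rightarrow>\<^sub>C complex) set" where
  "LUC = {f. continuous_on UNIV (\<lambda>s. left_translate s f)}"

definition LMC :: "('s::semitopological_semigroup \<Rightarrow>\<^sub>C complex) set" where
  "LMC = {f. continuous_map euclidean (induced_topology multiplicative_means)
               (\<lambda>s. left_translate s f)}"

definition AP :: "('s::semitopological_semigroup \<Rightarrow>\<^sub>C complex) set" where
  "AP = {f. compact (closure (range (\<lambda>s. left_translate s f)))}"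

definition WAP :: "('s::semitopological_semigroup \<Rightarrow>\<^sub>C complex) set" where
  "WAP = {f. let w = induced_topology (dual UNIV bc_scale norm)
             in compactin w (w closure_of range (\<lambda>s. left_translate s f))}"


section \<open>Dynamical systems\<close>

text \<open>The phase space is the topological space \<open>T\<close>; an action is relevant only on \<open>topspace T\<close>.\<close>

definition dynamical_system ::
  "'p topology \<Rightarrow> ('s::semitopological_semigroup \<Rightarrow> 'p \<Rightarrow> 'p) \<Rightarrow> bool" where
  "dynamical_system T act \<longleftrightarrow>
     (\<forall>s. \<forall>x\<in>topspace T. act s x \<in> topspace T) \<and>
     (\<forall>s t. \<forall>x\<in>topspace T. act s (act t x) = act (s * t) x) \<and>
     (\<forall>x\<in>topspace T. continuous_map euclidean T (\<lambda>s. act s x)) \<and>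
     (\<forall>s. continuous_map T T (act s))"

definition jointly_continuous ::
  "'p topology \<Rightarrow> ('s::topological_space \<Rightarrow> 'p \<Rightarrow> 'p) \<Rightarrow> bool" where
  "jointly_continuous T act \<longleftrightarrow>
     continuous_map (prod_topology euclidean T) T (\<lambda>(s, x). act s x)"

text \<open>Self-maps of the phase space are represented by functions that are \<open>undefined\<close> off it.\<close>

definition enveloping_semigroup :: "'p topology \<Rightarrow> ('s \<Rightarrow> 'p \<Rightarrow> 'p) \<Rightarrow> ('p \<Rightarrow> 'p) set" where
  "enveloping_semigroup T act =
     product_topology (\<lambda>_. T) (topspace T) closure_of
       range (\<lambda>s. restrict (act s) (topspace T))"

text \<open>Equicontinuity for the uniformity on \<open>K\<close> inherited from a group topology \<open>W\<close>.\<close>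

definition equicontinuous_on ::
  "'p::ab_group_add topology \<Rightarrow> 'p set \<Rightarrow> ('s \<Rightarrow> 'p \<Rightarrow> 'p) \<Rightarrow> bool" where
  "equicontinuous_on W K act \<longleftrightarrow>
     (\<forall>x\<in>K. \<forall>U. openin W U \<and> 0 \<in> U \<longrightarrow>
        (\<exists>G. openin (subtopology W K) G \<and> x \<in> G \<and>
             (\<forall>s. \<forall>y\<in>G. act s y - act s x \<in> U)))"

definition convex_functionals :: "('v \<Rightarrow> 'k::real_normed_field) set \<Rightarrow> bool" where
  "convex_functionals K \<longleftrightarrow>
     (\<forall>x\<in>K. \<forall>y\<in>K. \<forall>u::real. 0 \<le> u \<and> u \<le> 1 \<longrightarrow>
        fscale (of_real u) x + fscale (of_real (1 - u)) y \<in> K)"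

definition nonexpansive_on :: "('p::ab_group_add \<Rightarrow> real) \<Rightarrow> 'p set \<Rightarrow> ('p \<Rightarrow> 'p) \<Rightarrow> bool" where
  "nonexpansive_on N K f \<longleftrightarrow> (\<forall>x\<in>K. \<forall>y\<in>K. N (f x - f y) \<le> N (x - y))"

definition fixed_points :: "'p set \<Rightarrow> ('s \<Rightarrow> 'p \<Rightarrow> 'p) \<Rightarrow> 'p set" where
  "fixed_points K act = {x \<in> K. \<forall>s. act s x = x}"

end

theory Submission
  imports Defs
begin

text \<open>
  In each of the five cases the function \<open>s \<mapsto> f (s x)\<close> lies in the space carrying the left invariant
  mean, for every weak-star continuous \<open>f\<close> on \<open>K\<close>, so every orbit carries an invariant positive
  functional.  Let \<open>K\<^sub>0\<close> be a minimal weak-star compact convex invariant subset and \<open>F\<close> a minimal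
  closed invariant subset of \<open>K\<^sub>0\<close>.  The functional is strictly positive on \<open>F\<close>, hence \<open>s F = F\<close>, and
  the Chebyshev centre of \<open>F\<close> in \<open>K\<^sub>0\<close> is invariant, hence all of \<open>K\<^sub>0\<close>.  As the predual is M-embedded,
  the weak and the weak-star topology then agree on \<open>K\<^sub>0\<close>, which makes \<open>F\<close> norm-fragmented; an open
  piece of small diameter has positive mass and so have its translates, so \<open>F\<close> has a finite net of
  small mesh.  The average of such a net has radius less than the Chebyshev radius unless \<open>F\<close> is a
  single point.  The retraction is obtained from the fixed point theorem by Bruck's method.
\<close>

section \<open>Minimal systems with an invariant mean\<close>

text \<open>The five conditions serve only to carry a mean from functions on \<open>S\<close> to
  continuous functions on \<open>K\<close>. No representing measure is formed: the functional is
  tested on Urysohn functions and finite partitions instead. The obstacle is that weak-star limits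
  may lose norm, so weak-star density in \<open>F\<close> gives no norm information by itself.
  M-embeddedness supplies it through \<open>N3 (\<Psi> - a) = N3 (\<Psi> - p) + N1 (p - a)\<close>
  in the third dual, where \<open>p\<close> is the restriction of \<open>\<Psi>\<close> to the space
  and \<open>a\<close> is identified with its image. If the distances from \<open>p\<close> to
  \<open>F\<close> have supremum exactly \<rho>, a nonzero annihilator part of \<open>\<Psi>\<close>
  would push the radius above \<rho>; this is why all points of \<open>K0\<close> must have the same
  radius. As the space need not be separable, fragmentation is reached through a single countably
  generated subspace kept away from a cluster point. In the final average of \<open>n\<close>
  points, one term of size \<rho>/4 lowers the radius by (3/4) \<rho>/n uniformly over
  \<open>F\<close>. Bruck's method looks for fixed points in sets of values of nonexpansive maps at
  one point, so the fixed point theorem is proved for closed convex invariant subsets.\<close>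

lemma minimal_set_Zorn:
  assumes "\<A> \<noteq> {}"
    and lower: "\<And>\<C>. \<C> \<noteq> {} \<Longrightarrow> \<C> \<subseteq> \<A> \<Longrightarrow> \<forall>A\<in>\<C>. \<forall>B\<in>\<C>. A \<subseteq> B \<or> B \<subseteq> A \<Longrightarrow>
      \<exists>L\<in>\<A>. \<forall>A\<in>\<C>. L \<subseteq> A"
  obtains M where "M \<in> \<A>" "\<And>A. A \<in> \<A> \<Longrightarrow> A \<subseteq> M \<Longrightarrow> A = M"
proof -
  \<comment> \<open>Complements turn minimal members of \<open>\<A>\<close> into maximal ones, to
    which Zorn's lemma for inclusion applies.\<close>
  have "\<exists>M\<in>uminus ` \<A>. \<forall>X\<in>uminus ` \<A>. M \<subseteq> X \<longrightarrow> X = M"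
  proof (rule subset_Zorn)
    fix \<C> assume "subset.chain (uminus ` \<A>) \<C>"
    then have C: "\<C> \<subseteq> uminus ` \<A>" "\<forall>A\<in>\<C>. \<forall>B\<in>\<C>. A \<subseteq> B \<or> B \<subseteq> A"
      by (auto simp: subset.chain_def) blast
    show "\<exists>U\<in>uminus ` \<A>. \<forall>X\<in>\<C>. X \<subseteq> U"
    proof (cases "\<C> = {}")
      case True
      then show ?thesis using \<open>\<A> \<noteq> {}\<close> by auto
    next
      case False
      have "\<exists>L\<in>\<A>. \<forall>A\<in>uminus ` \<C>. L \<subseteq> A"
      proof (rule lower)
        show "uminus ` \<C> \<noteq> {}" using False by simp
        show "uminus ` \<C> \<subseteq> \<A>" using C(1) by auto
        show "\<forall>A\<in>uminus ` \<C>. \<forall>B\<in>uminus ` \<C>. A \<subseteq> B \<or> B \<subseteq> A" using C(2) by auto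
      qed
      then obtain L where "L \<in> \<A>" "\<forall>A\<in>uminus ` \<C>. L \<subseteq> A" by blast
      then show ?thesis by (intro bexI[of _ "- L"]) auto
    qed
  qed
  then obtain M where "M \<in> uminus ` \<A>" "\<forall>X\<in>uminus ` \<A>. M \<subseteq> X \<longrightarrow> X = M" by blast
  then have "- M \<in> \<A>" "\<And>A. A \<in> \<A> \<Longrightarrow> A \<subseteq> - M \<Longrightarrow> A = - M" by auto
  then show thesis by (rule that)
qed

lemma finite_chain_Inter_mem:
  assumes "finite \<F>" "\<F> \<noteq> {}" "\<forall>A\<in>\<F>. \<forall>B\<in>\<F>. A \<subseteq> B \<or> B \<subseteq> A"
  shows "\<Inter>\<F> \<in> \<F>"
  using assms
proof (induction rule: finite_ne_induct)
  case (insert A \<F>)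
  have "\<Inter>\<F> \<in> \<F>" by (rule insert.IH) (use insert.prems in blast)
  with insert.prems have "A \<subseteq> \<Inter>\<F> \<or> \<Inter>\<F> \<subseteq> A" by blast
  then show ?case
  proof
    assume "A \<subseteq> \<Inter>\<F>" then have "\<Inter>(insert A \<F>) = A" by auto
    then show ?thesis by simp
  next
    assume "\<Inter>\<F> \<subseteq> A" then have "\<Inter>(insert A \<F>) = \<Inter>\<F>" by auto
    then show ?thesis using \<open>\<Inter>\<F> \<in> \<F>\<close> by simp
  qed
qed simp

lemma compact_space_chain_Inter:
  assumes "compact_space T" "\<forall>A\<in>\<C>. closedin T A \<and> A \<noteq> {}"
    and "\<forall>A\<in>\<C>. \<forall>B\<in>\<C>. A \<subseteq> B \<or> B \<subseteq> A"
  shows "\<Inter>\<C> \<noteq> {}"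
proof -
  have "\<Inter>\<F> \<noteq> {}" if "finite \<F>" "\<F> \<subseteq> \<C>" for \<F>
  proof (cases "\<F> = {}")
    case False
    then have "\<Inter>\<F> \<in> \<F>"
      using assms(3) that by (intro finite_chain_Inter_mem) blast+
    then show ?thesis using assms(2) that by blast
  qed simp
  moreover have "\<forall>A\<in>\<C>. closedin T A" using assms(2) by blast
  ultimately show ?thesis
    using assms(1)[unfolded compact_space_fip, THEN spec[of _ \<C>]] by simp
qed

text \<open>The closures of the tails form a decreasing chain of nonempty closed sets. The compact
  spaces met below need not be sequentially compact, so cluster points stand in for limits of
  subsequences.\<close>

lemma compact_space_sequence_cluster:
  fixes a :: "nat \<Rightarrow> 'x"
  assumes "compact_space X" "\<And>n. a n \<in> topspace X"
  obtains c where "c \<in> topspace X" "\<And>m. c \<in> X closure_of (a ` {m..})"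
proof -
  define H where "H m = X closure_of (a ` {m..})" for m :: nat
  have "\<Inter>(range H) \<noteq> {}"
  proof (rule compact_space_chain_Inter[OF assms(1)])
    have "a m \<in> H m" for m
      unfolding H_def using closure_of_subset[of "a ` {m..}" X] assms(2) by auto
    then show "\<forall>A\<in>range H. closedin X A \<and> A \<noteq> {}" by (auto simp: H_def)
    have "H n \<subseteq> H m" if "m \<le> n" for m n
      unfolding H_def using that by (intro closure_of_mono) auto
    then have "H m \<subseteq> H n \<or> H n \<subseteq> H m" for m n using nat_le_linear by blast
    then show "\<forall>A\<in>range H. \<forall>B\<in>range H. A \<subseteq> B \<or> B \<subseteq> A" by blast
  qed
  then obtain c where c: "\<And>m. c \<in> H m" by blast
  moreover have "c \<in> topspace X" using c[of 0] closure_of_subset_topspace unfolding H_def by fast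
  ultimately show thesis using that by (auto simp: H_def)
qed

lemma compact_Hausdorff_Urysohn:
  assumes "compact_space T" "Hausdorff_space T" "closedin T A" "closedin T B" "A \<inter> B = {}"
  obtains f where "continuous_map T euclideanreal f" "\<And>x. x \<in> topspace T \<Longrightarrow> 0 \<le> f x \<and> f x \<le> 1"
    "\<And>x. x \<in> A \<Longrightarrow> f x = 0" "\<And>x. x \<in> B \<Longrightarrow> f x = 1"
proof -
  have "normal_space T"
    using assms(1,2) compact_Hausdorff_or_regular_imp_normal_space by blast
  then obtain f where f: "continuous_map T (top_of_set {0..1::real}) f" "f ` A \<subseteq> {0}" "f ` B \<subseteq> {1}"
    using Urysohn_lemma[of T A B 0 1] assms by (auto simp: disjnt_def)
  show thesis
  proof
    show "continuous_map T euclideanreal f"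
      using f(1) continuous_map_into_fulltopology by blast
    show "\<And>x. x \<in> topspace T \<Longrightarrow> 0 \<le> f x \<and> f x \<le> 1"
      using f(1) by (auto simp: continuous_map_def)
  qed (use f in auto)
qed

section \<open>Invariant functionals on minimal systems\<close>

text \<open>The substitute for an invariant probability measure. The point \<open>x\<close> enters
  through positivity alone, which is tested on the orbit of \<open>x\<close>; this concentrates the
  functional on the orbit closure.\<close>

definition invariant_mean ::
  "'p topology \<Rightarrow> ('s \<Rightarrow> 'p \<Rightarrow> 'p) \<Rightarrow> 'p \<Rightarrow> (('p \<Rightarrow> real) \<Rightarrow> real) \<Rightarrow> bool" where
  "invariant_mean T act x M \<longleftrightarrow>
     (\<forall>f g. continuous_map T euclideanreal f \<longrightarrow> continuous_map T euclideanreal g \<longrightarrow>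
        M (\<lambda>y. f y + g y) = M f + M g) \<and>
     (\<forall>c f. continuous_map T euclideanreal f \<longrightarrow> M (\<lambda>y. c * f y) = c * M f) \<and>
     (\<forall>f. continuous_map T euclideanreal f \<longrightarrow> (\<forall>s. 0 \<le> f (act s x)) \<longrightarrow> 0 \<le> M f) \<and>
     M (\<lambda>_. 1) = 1 \<and>
     (\<forall>f s. continuous_map T euclideanreal f \<longrightarrow> M (\<lambda>y. f (act s y)) = M f)"

locale minimal_system =
  fixes T :: "'p topology" and act :: "'s::semigroup_mult \<Rightarrow> 'p \<Rightarrow> 'p"
    and F :: "'p set" and x :: 'p and M :: "('p \<Rightarrow> real) \<Rightarrow> real"
  assumes compact: "compact_space T" and hausdorff: "Hausdorff_space T"
    and cont: "continuous_map T T (act s)"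
    and act_mult: "y \<in> topspace T \<Longrightarrow> act s (act t y) = act (s * t) y"
    and closed_F: "closedin T F" and invariant_F: "y \<in> F \<Longrightarrow> act s y \<in> F"
    and minimal_F: "closedin T G \<Longrightarrow> G \<noteq> {} \<Longrightarrow> G \<subseteq> F \<Longrightarrow> (\<And>s y. y \<in> G \<Longrightarrow> act s y \<in> G) \<Longrightarrow> G = F"
    and x_in_F: "x \<in> F"
    and mean: "invariant_mean T act x M"
begin

lemma F_subset: "F \<subseteq> topspace T"
  using closed_F closedin_subset by blast

lemma closedin_F_singleton: "y \<in> F \<Longrightarrow> closedin T {y}"
  by (rule closedin_Hausdorff_singleton[OF hausdorff]) (use F_subset in auto)

text \<open>The orbit closure is nonempty, closed and, by continuity of the translations, invariant,
  so minimality applies. The orbit need not contain \<open>y\<close>, as the semigroup may lack a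
  unit.\<close>

lemma orbit_dense:
  assumes "y \<in> F"
  shows "T closure_of range (\<lambda>s. act s y) = F"
proof (rule minimal_F)
  have orb: "range (\<lambda>s. act s y) \<subseteq> F" using assms invariant_F by auto
  then have sub: "range (\<lambda>s. act s y) \<subseteq> topspace T" using F_subset by blast
  show "closedin T (T closure_of range (\<lambda>s. act s y))" by simp
  show "T closure_of range (\<lambda>s. act s y) \<noteq> {}"
    using closure_of_subset[OF sub] by auto
  show "T closure_of range (\<lambda>s. act s y) \<subseteq> F"
    using orb closed_F by (rule closure_of_minimal)
  fix s z assume z: "z \<in> T closure_of range (\<lambda>s. act s y)"
  have "act s ` (T closure_of range (\<lambda>s. act s y)) \<subseteq> T closure_of (act s ` range (\<lambda>s. act s y))"
    using cont by (rule continuous_map_image_closure_subset)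
  moreover have "act s ` range (\<lambda>s. act s y) \<subseteq> range (\<lambda>s. act s y)"
    using act_mult F_subset assms by (auto simp: image_iff) blast
  ultimately show "act s z \<in> T closure_of range (\<lambda>s. act s y)"
    using z closure_of_mono by blast
qed

lemma orbit_meets:
  assumes "y \<in> F" "openin T U" "U \<inter> F \<noteq> {}"
  obtains s where "act s y \<in> U"
proof -
  obtain z where "z \<in> U" "z \<in> T closure_of range (\<lambda>s. act s y)"
    using assms orbit_dense[OF assms(1)] by blast
  then obtain w where "w \<in> range (\<lambda>s. act s y)" "w \<in> U"
    using assms(2) unfolding in_closure_of by blast
  then show thesis using that by blast
qed

lemmas mean_unfolded = mean[unfolded invariant_mean_def]
lemmas mean_add = mean_unfolded[THEN conjunct1, rule_format]
  and mean_scale = mean_unfolded[THEN conjunct2, THEN conjunct1, rule_format]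
  and mean_orbit_nonneg = mean_unfolded[THEN conjunct2, THEN conjunct2, THEN conjunct1, rule_format]
  and mean_one = mean_unfolded[THEN conjunct2, THEN conjunct2, THEN conjunct2, THEN conjunct1]
  and mean_invariant =
    mean_unfolded[THEN conjunct2, THEN conjunct2, THEN conjunct2, THEN conjunct2, rule_format]

lemma mean_nonneg:
  assumes "continuous_map T euclideanreal f" "\<And>y. y \<in> F \<Longrightarrow> 0 \<le> f y"
  shows "0 \<le> M f"
  by (rule mean_orbit_nonneg[OF assms(1)]) (rule assms(2)[OF invariant_F[OF x_in_F]])

lemma continuous_act: "continuous_map T euclideanreal f \<Longrightarrow> continuous_map T euclideanreal (\<lambda>y. f (act s y))"
  using continuous_map_compose[OF cont, of euclideanreal f] by (simp add: comp_def)

lemma mean_mono: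
  assumes "continuous_map T euclideanreal f" "continuous_map T euclideanreal g"
    and "\<And>y. y \<in> F \<Longrightarrow> f y \<le> g y"
  shows "M f \<le> M g"
proof -
  have "0 \<le> M (\<lambda>y. g y + (-1) * f y)"
    using assms by (intro mean_nonneg continuous_intros) auto
  also have "\<dots> = M g + M (\<lambda>y. (-1) * f y)"
    using assms by (intro mean_add continuous_intros) auto
  also have "\<dots> = M g - M f"
    using mean_scale[OF assms(1), of "-1"] by simp
  finally show ?thesis by simp
qed

lemma mean_sum:
  assumes "finite I" "\<And>i. i \<in> I \<Longrightarrow> continuous_map T euclideanreal (f i)"
  shows "M (\<lambda>y. \<Sum>i\<in>I. f i y) = (\<Sum>i\<in>I. M (f i))"
  using assms
proof (induction rule: finite_induct)
  case empty
  show ?case using mean_scale[of "\<lambda>_. 1" 0] by simp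
next
  case (insert i I)
  then show ?case by (simp add: mean_add continuous_map_sum)
qed

text \<open>By density of orbits and compactness, finitely many preimages of \<open>U\<close> under
  translations cover \<open>F\<close>. The corresponding translates of \<open>f\<close> add up to at
  least \<open>f z / 2\<close> on \<open>F\<close>, while invariance makes the mean of that sum a
  multiple of \<open>M f\<close>.\<close>

lemma mean_pos:
  assumes f: "continuous_map T euclideanreal f" and nonneg: "\<And>y. y \<in> F \<Longrightarrow> 0 \<le> f y"
    and z: "z \<in> F" "0 < f z"
  shows "0 < M f"
proof -
  define U where "U = {y \<in> topspace T. f z / 2 < f y}"
  have U: "openin T U"
    using openin_continuous_map_preimage[OF f, of "{f z / 2<..}"] by (simp add: U_def)
  have "z \<in> U" using z F_subset by (auto simp: U_def)
  define \<U> where "\<U> = range (\<lambda>s. {y \<in> topspace T. act s y \<in> U})"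
  have "compactin T F" using closedin_compact_space compact closed_F by blast
  moreover have "\<forall>V\<in>\<U>. openin T V"
    unfolding \<U>_def using openin_continuous_map_preimage[OF cont U] by auto
  moreover have "F \<subseteq> \<Union>\<U>"
  proof
    fix y assume "y \<in> F"
    then obtain s where "act s y \<in> U" using orbit_meets U \<open>z \<in> U\<close> z by blast
    then show "y \<in> \<Union>\<U>" using \<open>y \<in> F\<close> F_subset by (auto simp: \<U>_def)
  qed
  ultimately obtain \<F> where \<F>: "finite \<F>" "\<F> \<subseteq> \<U>" "F \<subseteq> \<Union>\<F>"
    unfolding compactin_def by meson
  then obtain I where I: "finite I" "\<F> = (\<lambda>s. {y \<in> topspace T. act s y \<in> U}) ` I"
    using finite_subset_image[of \<F> "\<lambda>s. {y \<in> topspace T. act s y \<in> U}" UNIV] \<F> by (auto simp: \<U>_def)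
  let ?c = "f z / 2"
  have "?c = M (\<lambda>y. ?c * 1)" using mean_scale[of "\<lambda>_. 1" ?c] mean_one by simp
  also have "\<dots> \<le> M (\<lambda>y. \<Sum>s\<in>I. f (act s y))"
  proof (rule mean_mono)
    show "continuous_map T euclideanreal (\<lambda>y. ?c * 1)" by simp
    show "continuous_map T euclideanreal (\<lambda>y. \<Sum>s\<in>I. f (act s y))"
      using I by (intro continuous_map_sum continuous_act[OF f])
    fix y assume y: "y \<in> F"
    then obtain s where "s \<in> I" "act s y \<in> U" using \<F>(3) I by blast
    then have "?c * 1 \<le> f (act s y)" by (simp add: U_def)
    also have "\<dots> \<le> (\<Sum>s\<in>I. f (act s y))"
      using \<open>s \<in> I\<close> I nonneg invariant_F y by (intro member_le_sum) auto
    finally show "?c * 1 \<le> (\<Sum>s\<in>I. f (act s y))" .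
  qed
  also have "\<dots> = (\<Sum>s\<in>I. M f)"
    using mean_sum[OF I(1) continuous_act[OF f], of "\<lambda>s. s"] mean_invariant[OF f] by simp
  finally have "?c \<le> card I * M f" by simp
  then have "0 < card I * M f" using z by linarith
  then show ?thesis by (simp add: zero_less_mult_iff)
qed

text \<open>If a point \<open>y\<close> of \<open>F\<close> were missed, a Urysohn function that is
  1 at \<open>y\<close> and 0 on the compact image would have positive mean. Its translate by
  \<open>s\<close> vanishes on \<open>F\<close> and yet has the same mean.\<close>

lemma act_image: "act s ` F = F"
proof
  show "act s ` F \<subseteq> F" using invariant_F by auto
  have cF: "compactin T F" using closedin_compact_space compact closed_F by blast
  have cl: "closedin T (act s ` F)"
    using image_compactin[OF cF cont] hausdorff compactin_imp_closedin by blast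
  show "F \<subseteq> act s ` F"
  proof (rule ccontr)
    assume "\<not> F \<subseteq> act s ` F"
    then obtain y where y: "y \<in> F" "y \<notin> act s ` F" by blast
    have "closedin T {y}"
      using y(1) by (rule closedin_F_singleton)
    moreover have "act s ` F \<inter> {y} = {}" using y by blast
    ultimately obtain f where f: "continuous_map T euclideanreal f"
      "\<And>x. x \<in> topspace T \<Longrightarrow> 0 \<le> f x \<and> f x \<le> 1"
      "\<And>x. x \<in> act s ` F \<Longrightarrow> f x = 0" "\<And>x. x \<in> {y} \<Longrightarrow> f x = 1"
      by (rule compact_Hausdorff_Urysohn[OF compact hausdorff cl]) (rule that)
    have "f y = 1" using f(4) by simp
    then have "0 < M f"
      using f(1,2) y(1) F_subset by (intro mean_pos[of f y]) auto
    also have "M f = M (\<lambda>z. f (act s z))" by (rule mean_invariant[OF f(1), symmetric])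
    also have "\<dots> \<le> M (\<lambda>z. 0 * 1)"
      by (rule mean_mono[OF continuous_act[OF f(1)]]) (simp_all add: f(3))
    also have "\<dots> = 0" using mean_scale[of "\<lambda>_. 1" 0] by simp
    finally show False by simp
  qed
qed

text \<open>The sets \<open>D s\<close> cover the translates of \<open>U\<close>, so each of them carries at least the mass
  of \<open>U\<close>.\<close>

lemma card_disjoint_translates_bounded:
  assumes U: "openin T U" "U \<inter> F \<noteq> {}"
    and D: "\<And>s. closedin T (D s)" "\<And>s y. y \<in> U \<inter> F \<Longrightarrow> act s y \<in> D s"
  obtains n :: nat where "\<And>I. finite I \<Longrightarrow> pairwise (\<lambda>s t. disjnt (D s) (D t)) I \<Longrightarrow> card I \<le> n"
proof -
  obtain u where u: "u \<in> U" "u \<in> F" using U by blast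
  have "closedin T {u}"
    using u(2) by (rule closedin_F_singleton)
  moreover have "(topspace T - U) \<inter> {u} = {}" using u by blast
  ultimately obtain f where f: "continuous_map T euclideanreal f"
    "\<And>x. x \<in> topspace T \<Longrightarrow> 0 \<le> f x \<and> f x \<le> 1"
    "\<And>x. x \<in> topspace T - U \<Longrightarrow> f x = 0" "\<And>x. x \<in> {u} \<Longrightarrow> f x = 1"
    by (rule compact_Hausdorff_Urysohn[OF compact hausdorff closedin_diff[OF closedin_topspace U(1)]]) (rule that)
  have "f u = 1" using f(4) by simp
  then have pos: "0 < M f" using f(1,2) u F_subset by (intro mean_pos[of f u]) auto
  have bound: "card I * M f \<le> 1" if I: "finite I" "pairwise (\<lambda>s t. disjnt (D s) (D t)) I" for I
  proof -
    have "\<exists>h. continuous_map T euclideanreal h \<and> (\<forall>y\<in>topspace T. 0 \<le> h y) \<and>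
        (\<forall>y\<in>D s. h y = 1) \<and> (\<forall>t\<in>I - {s}. \<forall>y\<in>D t. h y = 0)" if "s \<in> I" for s
    proof -
      have "closedin T (\<Union>t\<in>I - {s}. D t)" using I D by (intro closedin_Union) auto
      moreover have "(\<Union>t\<in>I - {s}. D t) \<inter> D s = {}"
        using I(2) that by (auto simp: pairwise_def disjnt_def)
      ultimately obtain h where "continuous_map T euclideanreal h"
        "\<And>x. x \<in> topspace T \<Longrightarrow> 0 \<le> h x \<and> h x \<le> 1"
        "\<And>x. x \<in> (\<Union>t\<in>I - {s}. D t) \<Longrightarrow> h x = 0" "\<And>x. x \<in> D s \<Longrightarrow> h x = 1"
        by (rule compact_Hausdorff_Urysohn[OF compact hausdorff _ D(1)]) (rule that)
      then show ?thesis by (intro exI[of _ h]) auto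
    qed
    then have "\<exists>h. \<forall>s\<in>I. continuous_map T euclideanreal (h s) \<and> (\<forall>y\<in>topspace T. 0 \<le> h s y) \<and>
        (\<forall>y\<in>D s. h s y = 1) \<and> (\<forall>t\<in>I - {s}. \<forall>y\<in>D t. h s y = 0)"
      by (intro bchoice ballI)
    then obtain h where h0: "\<forall>s\<in>I. continuous_map T euclideanreal (h s) \<and> (\<forall>y\<in>topspace T. 0 \<le> h s y) \<and>
        (\<forall>y\<in>D s. h s y = 1) \<and> (\<forall>t\<in>I - {s}. \<forall>y\<in>D t. h s y = 0)" ..
    have h: "\<And>s. s \<in> I \<Longrightarrow> continuous_map T euclideanreal (h s)"
      "\<And>s y. s \<in> I \<Longrightarrow> y \<in> topspace T \<Longrightarrow> 0 \<le> h s y"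
      "\<And>s y. s \<in> I \<Longrightarrow> y \<in> D s \<Longrightarrow> h s y = 1"
      "\<And>s t y. s \<in> I \<Longrightarrow> t \<in> I \<Longrightarrow> t \<noteq> s \<Longrightarrow> y \<in> D t \<Longrightarrow> h s y = 0"
      using h0 by auto
    \<comment> \<open>Dividing by the maximum with 1 gives continuous functions \<open>k s\<close>
      whose sum is at most 1. On \<open>D s\<close> the other \<open>h t\<close> vanish, so
      \<open>m\<close> equals 1 there and \<open>k s\<close> keeps the value 1.\<close>
    define m where "m y = max 1 (\<Sum>s\<in>I. h s y)" for y
    define k where "k s y = h s y / m y" for s y
    have cm: "continuous_map T euclideanreal m"
      unfolding m_def using h I by (intro continuous_map_real_max continuous_map_sum) auto
    have ck: "continuous_map T euclideanreal (k s)" if "s \<in> I" for s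
    proof -
      have "m y \<noteq> 0" for y unfolding m_def by (simp add: max_def)
      then show ?thesis
        unfolding k_def by (intro continuous_map_real_divide h(1)[OF that] cm)
    qed
    have "M f \<le> M (k s)" if s: "s \<in> I" for s
    proof -
      have "M f \<le> M (\<lambda>y. k s (act s y))"
      proof (rule mean_mono)
        fix y assume y: "y \<in> F"
        then have y': "act s y \<in> topspace T" "act s y \<in> F" using F_subset invariant_F by blast+
        have k0: "0 \<le> k s (act s y)" unfolding k_def m_def using h(2)[OF s y'(1)] by simp
        show "f y \<le> k s (act s y)"
        proof (cases "y \<in> U")
          case True
          then have Ds: "act s y \<in> D s" using D y by blast
          have "(\<Sum>t\<in>I. h t (act s y)) = (\<Sum>t\<in>I. if t = s then 1 else 0)"
            using h(3)[OF s Ds] h(4)[OF _ s _ Ds] by (intro sum.cong) auto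
          also have "\<dots> = 1" using I s by simp
          finally have "k s (act s y) = 1" using h(3)[OF s Ds] by (simp add: k_def m_def)
          then show ?thesis using f(2) y F_subset by force
        next
          case False
          then have "f y = 0" using f(3) y F_subset by auto
          then show ?thesis using k0 by simp
        qed
      qed (use f ck continuous_act s in auto)
      then show ?thesis using mean_invariant[OF ck[OF s]] by simp
    qed
    then have "card I * M f \<le> (\<Sum>s\<in>I. M (k s))" using sum_bounded_below[of I "M f" "\<lambda>s. M (k s)"] by simp
    also have "\<dots> = M (\<lambda>y. \<Sum>s\<in>I. k s y)" using mean_sum[of I k] ck I by simp
    also have "\<dots> \<le> M (\<lambda>y. 1)"
    proof (rule mean_mono)
      show "(\<Sum>s\<in>I. k s y) \<le> 1" for y
        unfolding k_def sum_divide_distrib[symmetric] m_def by (simp add: divide_le_eq max_def)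
    qed (use ck I in \<open>auto intro!: continuous_map_sum\<close>)
    finally show ?thesis using mean_one by simp
  qed
  show thesis
  proof
    fix I assume "finite I" "pairwise (\<lambda>s t. disjnt (D s) (D t)) I"
    from bound[OF this] have "real (card I) \<le> 1 / M f" using pos by (simp add: field_simps)
    then show "card I \<le> nat \<lceil>1 / M f\<rceil>" by linarith
  qed
qed

text \<open>A pairwise disjoint subfamily of largest cardinality exists by the preceding bound, and
  every further \<open>D t\<close> must meet one of its members.\<close>

lemma finitely_many_translates_meet_all:
  assumes "openin T U" "U \<inter> F \<noteq> {}"
    and "\<And>s. closedin T (D s)" "\<And>s y. y \<in> U \<inter> F \<Longrightarrow> act s y \<in> D s"
  obtains I where "finite I" "\<And>t. \<exists>s\<in>I. D t \<inter> D s \<noteq> {}"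
proof -
  obtain n :: nat where n: "\<And>I. finite I \<Longrightarrow> pairwise (\<lambda>s t. disjnt (D s) (D t)) I \<Longrightarrow> card I \<le> n"
    using card_disjoint_translates_bounded[OF assms] by metis
  define P where "P I \<longleftrightarrow> finite I \<and> pairwise (\<lambda>s t. disjnt (D s) (D t)) I" for I
  have "P {}" "\<forall>I. P I \<longrightarrow> card I \<le> n" using n by (auto simp: P_def)
  then obtain I where I: "P I" "\<And>J. P J \<Longrightarrow> card J \<le> card I"
    using ex_has_greatest_nat[of P "{}" card "Suc n"] by (metis le_imp_less_Suc)
  have "\<exists>s\<in>I. D t \<inter> D s \<noteq> {}" for t
  proof (rule ccontr)
    assume neg: "\<not> ?thesis"
    have "D t \<noteq> {}" using assms(2,4) by blast
    then have "t \<notin> I" using neg by auto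
    moreover have "P (insert t I)"
      using neg I(1) by (auto simp: P_def pairwise_insert disjnt_def Int_commute)
    ultimately show False using I(2)[of "insert t I"] I(1) by (auto simp: P_def)
  qed
  then show thesis using that I by (auto simp: P_def)
qed

end

section \<open>The Hahn-Banach theorem\<close>

text \<open>Only an inequality is asked for positive scalars: applied to the inverse scalar it
  becomes an equality, and the value 0 at the origin follows.\<close>

definition sublinear_on :: "'v::ab_group_add set \<Rightarrow> (real \<Rightarrow> 'v \<Rightarrow> 'v) \<Rightarrow> ('v \<Rightarrow> real) \<Rightarrow> bool" where
  "sublinear_on V sc f \<longleftrightarrow> (\<forall>x\<in>V. \<forall>y\<in>V. f (x + y) \<le> f x + f y) \<and>
     (\<forall>t>0. \<forall>x\<in>V. f (sc t x) \<le> t * f x)"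

text \<open>The intended carrier is \<open>X1\<close> inside all scalar-valued functions, viewed
  over the reals even when the scalars are complex.\<close>

locale real_subspace = vector_space sc for sc :: "real \<Rightarrow> 'v::ab_group_add \<Rightarrow> 'v" +
  fixes V :: "'v set"
  assumes V_zero: "0 \<in> V" and V_add: "x \<in> V \<Longrightarrow> y \<in> V \<Longrightarrow> x + y \<in> V"
    and V_scale: "x \<in> V \<Longrightarrow> sc t x \<in> V"
begin

lemma V_minus: "x \<in> V \<Longrightarrow> - x \<in> V"
  using V_scale[of x "-1"] by simp

lemma sublinear_add: "sublinear_on V sc f \<Longrightarrow> x \<in> V \<Longrightarrow> y \<in> V \<Longrightarrow> f (x + y) \<le> f x + f y"
  by (simp add: sublinear_on_def)

lemma sublinear_scale:
  assumes "sublinear_on V sc f" "x \<in> V" "0 < t"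
  shows "f (sc t x) = t * f x"
proof (rule antisym)
  show "f (sc t x) \<le> t * f x" using assms by (simp add: sublinear_on_def)
  have "f (sc (1 / t) (sc t x)) \<le> 1 / t * f (sc t x)"
    using assms V_scale[OF assms(2), of t] unfolding sublinear_on_def
    by (metis zero_less_divide_1_iff)
  then show "t * f x \<le> f (sc t x)" using assms by (simp add: field_simps)
qed

lemma sublinear_zero: "sublinear_on V sc f \<Longrightarrow> f 0 = 0"
  using sublinear_scale[of f 0 2] V_zero by simp

lemma sublinear_lower: "sublinear_on V sc f \<Longrightarrow> x \<in> V \<Longrightarrow> - f (- x) \<le> f x"
  using sublinear_add[of f x "- x"] sublinear_zero[of f] V_minus[of x] by simp

text \<open>The functional that enforces linearity along \<open>y\<close>: it stays sublinear, lies
  below \<open>f\<close>, and at \<open>- y\<close> it is at most \<open>- f y\<close>.\<close>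

definition shift :: "('v \<Rightarrow> real) \<Rightarrow> 'v \<Rightarrow> 'v \<Rightarrow> real" where
  "shift f y x = (INF t\<in>{0..}. f (x + sc t y) - t * f y)"

context
  fixes f y
  assumes f: "sublinear_on V sc f" and y: "y \<in> V"
begin

lemma shift_bdd_below:
  assumes "x \<in> V"
  shows "bdd_below ((\<lambda>t. f (x + sc t y) - t * f y) ` {0..})"
proof (rule bdd_belowI2)
  fix t :: real assume "t \<in> {0..}"
  then have t: "0 \<le> t" by simp
  have "f (sc t y) \<le> f (x + sc t y) + f (- x)"
    using sublinear_add[OF f, of "x + sc t y" "- x"] assms y V_add V_scale V_minus by simp
  moreover have "f (sc t y) = t * f y"
    using t sublinear_scale[OF f y, of t] sublinear_zero[OF f] by (cases "t = 0") auto
  ultimately show "- f (- x) \<le> f (x + sc t y) - t * f y" by simp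
qed

lemma shift_le:
  assumes "x \<in> V" "0 \<le> t"
  shows "shift f y x \<le> f (x + sc t y) - t * f y"
  unfolding shift_def by (rule cINF_lower[OF shift_bdd_below[OF assms(1)]]) (use assms in simp)

lemma shift_le_self: "x \<in> V \<Longrightarrow> shift f y x \<le> f x"
  using shift_le[of x 0] by simp

lemma shift_greatest:
  assumes "\<And>t. 0 \<le> t \<Longrightarrow> b \<le> f (x + sc t y) - t * f y"
  shows "b \<le> shift f y x"
  unfolding shift_def by (rule cINF_greatest) (use assms in auto)

lemma sublinear_shift: "sublinear_on V sc (shift f y)"
  unfolding sublinear_on_def
proof (intro conjI ballI allI impI)
  fix a b assume ab: "a \<in> V" "b \<in> V"
  have "shift f y (a + b) - (f (b + sc t y) - t * f y) \<le> shift f y a" if t: "0 \<le> t" for t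
  proof (rule shift_greatest)
    fix s :: real assume s: "0 \<le> s"
    have "shift f y (a + b) \<le> f (a + b + sc (s + t) y) - (s + t) * f y"
      using ab s t V_add by (intro shift_le) auto
    also have "a + b + sc (s + t) y = (a + sc s y) + (b + sc t y)"
      by (simp add: scale_left_distrib algebra_simps)
    also have "f \<dots> \<le> f (a + sc s y) + f (b + sc t y)"
      using ab y V_add V_scale by (intro sublinear_add[OF f]) auto
    finally show "shift f y (a + b) - (f (b + sc t y) - t * f y) \<le> f (a + sc s y) - s * f y"
      by (simp add: algebra_simps)
  qed
  then have "shift f y (a + b) - shift f y a \<le> shift f y b"
    by (intro shift_greatest) (simp add: algebra_simps)
  then show "shift f y (a + b) \<le> shift f y a + shift f y b" by simp
next
  fix c :: real and a assume c: "0 < c" and a: "a \<in> V"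
  have "shift f y (sc c a) / c \<le> shift f y a"
  proof (rule shift_greatest)
    fix t :: real assume t: "0 \<le> t"
    have "shift f y (sc c a) \<le> f (sc c a + sc (c * t) y) - (c * t) * f y"
      using a c t V_scale by (intro shift_le) auto
    also have "sc c a + sc (c * t) y = sc c (a + sc t y)"
      by (simp add: scale_right_distrib)
    also have "f \<dots> = c * f (a + sc t y)"
      using a y c V_add V_scale by (intro sublinear_scale[OF f]) auto
    finally show "shift f y (sc c a) / c \<le> f (a + sc t y) - t * f y"
      using c by (simp add: field_simps)
  qed
  then show "shift f y (sc c a) \<le> c * shift f y a" using c by (simp add: field_simps)
qed

end

text \<open>A minimal sublinear functional is linear: it coincides with each of its shifts.\<close>

lemma minimal_sublinear_add:
  assumes f: "sublinear_on V sc f"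
    and minimal: "\<forall>g. sublinear_on V sc g \<longrightarrow> (\<forall>x\<in>V. g x \<le> f x) \<longrightarrow> (\<forall>x\<in>V. g x = f x)"
    and "x \<in> V" "y \<in> V"
  shows "f (x + y) = f x + f y"
proof (rule antisym)
  show "f (x + y) \<le> f x + f y" by (rule sublinear_add[OF f assms(3,4)])
  have "shift f y x = f x"
    using minimal[rule_format, OF sublinear_shift[OF f assms(4)]] shift_le_self[OF f assms(4)] assms(3)
    by blast
  then show "f x + f y \<le> f (x + y)"
    using shift_le[OF f assms(4,3), of 1] by simp
qed

text \<open>The infimum is finite because every member is at least \<open>- q (- x)\<close> at
  \<open>x\<close>. It is subadditive because, of two members of the chain, the smaller one serves
  both summands.\<close>

lemma sublinear_chain_Inf:
  assumes "\<C> \<noteq> {}" and sub: "\<And>f. f \<in> \<C> \<Longrightarrow> sublinear_on V sc f"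
    and bound: "\<And>f x. f \<in> \<C> \<Longrightarrow> x \<in> V \<Longrightarrow> f x \<le> q x"
    and chain: "\<And>f g. f \<in> \<C> \<Longrightarrow> g \<in> \<C> \<Longrightarrow> (\<forall>x\<in>V. f x \<le> g x) \<or> (\<forall>x\<in>V. g x \<le> f x)"
  defines "h \<equiv> \<lambda>x. INF f\<in>\<C>. f x"
  shows "sublinear_on V sc h" "\<And>f x. f \<in> \<C> \<Longrightarrow> x \<in> V \<Longrightarrow> h x \<le> f x"
proof -
  have bdd: "bdd_below ((\<lambda>f. f x) ` \<C>)" if "x \<in> V" for x
  proof (rule bdd_belowI2)
    fix f assume "f \<in> \<C>"
    then show "- q (- x) \<le> f x"
      using sublinear_lower[OF sub that] bound[OF _ V_minus[OF that]] by force
  qed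
  show lower: "h x \<le> f x" if "f \<in> \<C>" "x \<in> V" for f x
    unfolding h_def by (rule cINF_lower[OF bdd]) (use that in auto)
  have greatest: "b \<le> h x" if "\<And>f. f \<in> \<C> \<Longrightarrow> b \<le> f x" for b x
    unfolding h_def by (rule cINF_greatest) (use that assms(1) in auto)
  show "sublinear_on V sc h"
    unfolding sublinear_on_def
  proof (intro conjI ballI allI impI)
    fix x y assume xy: "x \<in> V" "y \<in> V"
    have *: "h (x + y) \<le> f x + g y" if fg: "f \<in> \<C>" "g \<in> \<C>" for f g
      using chain[OF fg]
    proof
      assume "\<forall>x\<in>V. f x \<le> g x"
      then have "f y \<le> g y" using xy by blast
      then show ?thesis
        using lower[OF fg(1) V_add[OF xy]] sublinear_add[OF sub[OF fg(1)] xy] by linarith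
    next
      assume "\<forall>x\<in>V. g x \<le> f x"
      then have "g x \<le> f x" using xy by blast
      then show ?thesis
        using lower[OF fg(2) V_add[OF xy]] sublinear_add[OF sub[OF fg(2)] xy] by linarith
    qed
    have "h (x + y) - g y \<le> h x" if "g \<in> \<C>" for g
      by (rule greatest) (use *[OF _ that] in force)
    then have "h (x + y) - h x \<le> h y"
      by (intro greatest) force
    then show "h (x + y) \<le> h x + h y" by simp
  next
    fix t :: real and x assume t: "0 < t" and x: "x \<in> V"
    have "h (sc t x) / t \<le> h x"
    proof (rule greatest)
      fix f assume f: "f \<in> \<C>"
      have "h (sc t x) \<le> f (sc t x)" using lower f x V_scale by blast
      also have "\<dots> = t * f x" using sublinear_scale[OF sub[OF f] x t] .
      finally show "h (sc t x) / t \<le> f x" using t by (simp add: field_simps)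
    qed
    then show "h (sc t x) \<le> t * h x" using t by (simp add: field_simps)
  qed
qed

lemma minimal_sublinear_exists:
  assumes q: "sublinear_on V sc q"
  obtains f where "sublinear_on V sc f" "\<And>x. x \<in> V \<Longrightarrow> f x \<le> q x"
    "\<forall>g. sublinear_on V sc g \<longrightarrow> (\<forall>x\<in>V. g x \<le> f x) \<longrightarrow> (\<forall>x\<in>V. g x = f x)"
proof -
  \<comment> \<open>Values off \<open>V\<close> are pinned to 0, so that comparing members on
    \<open>V\<close> is the same as comparing them everywhere and minimality concerns
    \<open>V\<close> only. The relation \<open>P\<close> below is the reversed order, which turns
    maximal elements into minimal ones.\<close>
  define \<S> where "\<S> = {f. sublinear_on V sc f \<and> (\<forall>x\<in>V. f x \<le> q x) \<and> (\<forall>x. x \<notin> V \<longrightarrow> f x = 0)}"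
  define off where "off f x = (if x \<in> V then f x else 0 :: real)" for f :: "'v \<Rightarrow> real" and x
  have off: "sublinear_on V sc (off f)" if "sublinear_on V sc f" for f
    using that V_add V_scale by (auto simp: sublinear_on_def off_def)
  define P where "P f g \<longleftrightarrow> (\<forall>x. g x \<le> f x)" for f g :: "'v \<Rightarrow> real"
  have "\<exists>m\<in>\<S>. \<forall>a\<in>\<S>. P m a \<longrightarrow> a = m"
  proof (rule predicate_Zorn)
    show "partial_order_on \<S> (relation_of P \<S>)"
      by (rule partial_order_on_relation_ofI) (auto simp: P_def intro: order_trans intro!: ext antisym)
    fix \<C> assume C: "\<C> \<in> Chains (relation_of P \<S>)"
    show "\<exists>u\<in>\<S>. \<forall>a\<in>\<C>. P a u"
    proof (cases "\<C> = {}")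
      case True
      have "off q \<in> \<S>" using off[OF q] by (auto simp: \<S>_def off_def)
      then show ?thesis using True by blast
    next
      case False
      have CS: "\<C> \<subseteq> \<S>" using C by (auto simp: Chains_def relation_of_def)
      have chain: "(\<forall>x\<in>V. f x \<le> g x) \<or> (\<forall>x\<in>V. g x \<le> f x)" if "f \<in> \<C>" "g \<in> \<C>" for f g
        using C that by (auto simp: Chains_def relation_of_def P_def)
      let ?h = "\<lambda>x. INF f\<in>\<C>. f x"
      have h: "sublinear_on V sc ?h" "\<And>f x. f \<in> \<C> \<Longrightarrow> x \<in> V \<Longrightarrow> ?h x \<le> f x"
        using CS chain sublinear_chain_Inf[OF False, of q] by (auto simp: \<S>_def subset_iff)
      obtain f0 where f0: "f0 \<in> \<C>" using False by blast
      have "?h x \<le> q x" if "x \<in> V" for x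
        using h(2)[OF f0 that] f0 CS that by (force simp: \<S>_def)
      then have "off ?h \<in> \<S>" using off[OF h(1)] by (auto simp: \<S>_def off_def)
      moreover have "P a (off ?h)" if "a \<in> \<C>" for a
        using h(2)[OF that] that CS by (auto simp: P_def off_def \<S>_def)
      ultimately show ?thesis by blast
    qed
  qed
  then obtain m where m: "m \<in> \<S>" "\<And>a. a \<in> \<S> \<Longrightarrow> P m a \<Longrightarrow> a = m" by blast
  show thesis
  proof (rule that)
    show "sublinear_on V sc m" "\<And>x. x \<in> V \<Longrightarrow> m x \<le> q x" using m(1) by (auto simp: \<S>_def)
    show "\<forall>g. sublinear_on V sc g \<longrightarrow> (\<forall>x\<in>V. g x \<le> m x) \<longrightarrow> (\<forall>x\<in>V. g x = m x)"
    proof (intro allI impI ballI)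
      fix g x assume g: "sublinear_on V sc g" "\<forall>x\<in>V. g x \<le> m x" and x: "x \<in> V"
      have "off g \<in> \<S>"
        using off[OF g(1)] g(2) m(1) by (auto simp: \<S>_def off_def intro: order_trans)
      moreover have "P m (off g)"
        using g(2) m(1) by (auto simp: P_def off_def \<S>_def)
      ultimately have "off g = m" by (rule m(2))
      then show "g x = m x" using x by (auto simp: off_def)
    qed
  qed
qed

text \<open>Minimizing below \<open>shift q z\<close> instead of \<open>q\<close> is what yields
  \<open>f z = q z\<close>: the shift bounds \<open>f (- z)\<close> by \<open>- q z\<close>.\<close>

theorem Hahn_Banach_sublinear:
  assumes q: "sublinear_on V sc q" and z: "z \<in> V"
  obtains f where "\<And>x y. x \<in> V \<Longrightarrow> y \<in> V \<Longrightarrow> f (x + y) = f x + f y"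
    "\<And>t x. x \<in> V \<Longrightarrow> f (sc t x) = t * f x" "\<And>x. x \<in> V \<Longrightarrow> f x \<le> q x" "f z = q z"
proof -
  obtain f where f: "sublinear_on V sc f" "\<And>x. x \<in> V \<Longrightarrow> f x \<le> shift q z x"
    and min: "\<forall>g. sublinear_on V sc g \<longrightarrow> (\<forall>x\<in>V. g x \<le> f x) \<longrightarrow> (\<forall>x\<in>V. g x = f x)"
    by (rule minimal_sublinear_exists[OF sublinear_shift[OF q z]]) (rule that)
  have add: "f (x + y) = f x + f y" if "x \<in> V" "y \<in> V" for x y
    using minimal_sublinear_add[OF f(1) min that] .
  have minus: "f (- x) = - f x" if "x \<in> V" for x
    using add[OF that V_minus[OF that]] sublinear_zero[OF f(1)] by simp
  show thesis
  proof (rule that)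
    show "\<And>x y. x \<in> V \<Longrightarrow> y \<in> V \<Longrightarrow> f (x + y) = f x + f y" by (rule add)
    show le: "f x \<le> q x" if "x \<in> V" for x
      using f(2)[OF that] shift_le_self[OF q z that] by linarith
    show "f (sc t x) = t * f x" if x: "x \<in> V" for t x
    proof (cases t "0 :: real" rule: linorder_cases)
      case less
      have "f (sc t x) = f (- sc (- t) x)" by simp
      also have "\<dots> = - f (sc (- t) x)" by (rule minus[OF V_scale[OF x]])
      also have "\<dots> = t * f x" using sublinear_scale[OF f(1) x, of "- t"] less by simp
      finally show ?thesis .
    qed (use sublinear_scale[OF f(1) x] sublinear_zero[OF f(1)] in auto)
    have "f (- z) \<le> shift q z (- z)" using f(2) V_minus[OF z] by blast
    also have "\<dots> \<le> q (- z + sc 1 z) - 1 * q z" using q z V_minus by (intro shift_le) auto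
    finally have "q z \<le> f z" using sublinear_zero[OF q] minus[OF z] by simp
    then show "f z = q z" using le[OF z] by simp
  qed
qed

end

section \<open>Duals of normed spaces\<close>

lemma compact_closed_subset: "compact S \<Longrightarrow> closed T \<Longrightarrow> T \<subseteq> S \<Longrightarrow> compact T"
  by (metis compact_Int_closed inf.absorb_iff2)

text \<open>With \<open>w\<close> the conjugate of \<open>z\<close>, multiplicativity of the norm
  makes \<open>norm z * norm w\<close> the sum of the squares of the coordinates, and
  \<open>norm w\<close> is at most twice the larger coordinate. The crude factor 2 is enough for
  compactness of balls and for independence of \<open>1\<close> and \<open>i\<close> over the
  reals.\<close>

lemma real_or_complex_bounded_coordinates:
  fixes i :: "'k::real_normed_field"
  assumes i: "i * i = - 1"
  shows "\<bar>a\<bar> \<le> 2 * norm (a *\<^sub>R 1 + b *\<^sub>R i)" "\<bar>b\<bar> \<le> 2 * norm (a *\<^sub>R 1 + b *\<^sub>R i)"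
proof -
  define z where "z = a *\<^sub>R 1 + b *\<^sub>R i"
  define w where "w = a *\<^sub>R 1 - b *\<^sub>R i"
  have "norm i * norm i = 1" using i by (metis norm_mult norm_minus_cancel norm_one)
  then have ni: "norm i = 1" by (metis norm_ge_zero square_eq_1_iff neg_0_le_iff_le not_one_le_zero power2_eq_square)
  have "z * w = (a * a + b * b) *\<^sub>R 1"
    using i by (simp add: z_def w_def algebra_simps)
  then have zw: "norm z * norm w = a\<^sup>2 + b\<^sup>2"
    by (metis norm_mult norm_scaleR norm_one mult.right_neutral abs_of_nonneg
        power2_eq_square sum_power2_ge_zero)
  define m where "m = max \<bar>a\<bar> \<bar>b\<bar>"
  have "norm w \<le> \<bar>a\<bar> + \<bar>b\<bar>"
    unfolding w_def using norm_triangle_ineq4[of "a *\<^sub>R 1" "b *\<^sub>R i"] ni by simp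
  also have "\<dots> \<le> 2 * m" by (simp add: m_def)
  finally have w: "norm w \<le> 2 * m" .
  have "m\<^sup>2 \<le> a\<^sup>2 + b\<^sup>2" by (simp add: m_def max_def)
  also have "\<dots> \<le> norm z * (2 * m)" unfolding zw[symmetric] using w by (intro mult_left_mono) auto
  finally have "m * m \<le> (2 * norm z) * m" by (simp add: power2_eq_square)
  moreover have "0 \<le> m" by (simp add: m_def)
  ultimately have "m \<le> 2 * norm z"
    by (metis mult_le_cancel_right norm_ge_zero mult_nonneg_nonneg zero_le_numeral order_less_le)
  then show "\<bar>a\<bar> \<le> 2 * norm (a *\<^sub>R 1 + b *\<^sub>R i)" "\<bar>b\<bar> \<le> 2 * norm (a *\<^sub>R 1 + b *\<^sub>R i)"
    by (simp_all add: m_def z_def)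
qed

lemma compact_cball_real_or_complex: "compact (cball (0::'k::real_or_complex) r)"
  using real_or_complex
proof
  assume all: "\<forall>z::'k. \<exists>a. z = a *\<^sub>R 1"
  have "compact ((\<lambda>a. a *\<^sub>R (1::'k)) ` {-r..r})"
    by (intro compact_continuous_image continuous_intros) simp
  moreover have "cball (0::'k) r \<subseteq> (\<lambda>a. a *\<^sub>R (1::'k)) ` {-r..r}"
  proof
    fix z :: 'k assume z: "z \<in> cball 0 r"
    obtain a where "z = a *\<^sub>R 1" using all by blast
    then show "z \<in> (\<lambda>a. a *\<^sub>R (1::'k)) ` {-r..r}" using z by (auto intro!: image_eqI[of _ _ a])
  qed
  ultimately show ?thesis by (rule compact_closed_subset[OF _ closed_cball])
next
  assume "\<exists>i::'k. i * i = - 1 \<and> (\<forall>z. \<exists>a b. z = a *\<^sub>R 1 + b *\<^sub>R i)"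
  then obtain i :: 'k where i: "i * i = - 1" and all: "\<And>z. \<exists>a b. z = a *\<^sub>R 1 + b *\<^sub>R i" by blast
  let ?f = "\<lambda>p. fst p *\<^sub>R 1 + snd p *\<^sub>R i"
  have "compact (?f ` ({-2*r..2*r} \<times> {-2*r..2*r}))"
    by (intro compact_continuous_image continuous_intros compact_Times) simp_all
  moreover have "cball (0::'k) r \<subseteq> ?f ` ({-2*r..2*r} \<times> {-2*r..2*r})"
  proof
    fix z :: 'k assume z: "z \<in> cball 0 r"
    obtain a b where ab: "z = a *\<^sub>R 1 + b *\<^sub>R i" using all by blast
    have "\<bar>a\<bar> \<le> 2 * r" "\<bar>b\<bar> \<le> 2 * r"
      using real_or_complex_bounded_coordinates[OF i, where a=a and b=b] z ab by auto
    then show "z \<in> ?f ` ({-2*r..2*r} \<times> {-2*r..2*r})"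
      using ab by (intro image_eqI[of _ _ "(a, b)"]) auto
  qed
  ultimately show ?thesis by (rule compact_closed_subset[OF _ closed_cball])
qed

text \<open>Separability of the scalars lets a dense part of a countably generated subspace be
  exhausted by finite sets, each step adding finitely many scalar multiples.\<close>

lemma real_or_complex_dense_sequence:
  obtains d :: "nat \<Rightarrow> 'k::real_or_complex" where "\<And>c e. 0 < e \<Longrightarrow> \<exists>n. norm (c - d n) < e"
proof -
  have rat: "\<exists>q::rat. \<bar>a - of_rat q\<bar> < e" if "0 < e" for a e :: real
  proof -
    have "a - e < a" using that by simp
    then obtain q :: rat where "a - e < of_rat q" "of_rat q < a"
      using of_rat_dense by blast
    then show ?thesis by (intro exI[of _ q]) auto
  qed
  from real_or_complex show thesis
  proof
    assume all: "\<forall>z::'k. \<exists>a. z = a *\<^sub>R 1"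
    show thesis
    proof (rule that)
      fix c :: 'k and e :: real assume e: "0 < e"
      obtain a where a: "c = a *\<^sub>R 1" using all by blast
      obtain q :: rat where q: "\<bar>a - of_rat q\<bar> < e" using rat[OF e] by blast
      have "c - of_rat q *\<^sub>R 1 = (a - of_rat q) *\<^sub>R 1" by (simp add: a scaleR_left_diff_distrib)
      then have "norm (c - of_rat q *\<^sub>R 1) < e" using q by simp
      then show "\<exists>n. norm (c - of_rat (from_nat n) *\<^sub>R 1) < e"
        by (intro exI[of _ "to_nat q"]) simp
    qed
  next
    assume "\<exists>i::'k. i * i = - 1 \<and> (\<forall>z. \<exists>a b. z = a *\<^sub>R 1 + b *\<^sub>R i)"
    then obtain i :: 'k where all: "\<And>z. \<exists>a b. z = a *\<^sub>R 1 + b *\<^sub>R i" by blast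
    show thesis
    proof (rule that)
      fix c :: 'k and e :: real assume e: "0 < e"
      obtain a b where ab: "c = a *\<^sub>R 1 + b *\<^sub>R i" using all by blast
      define e' where "e' = e / (1 + norm i)"
      have p: "0 < 1 + norm i" by (simp add: add_pos_nonneg)
      then have e': "0 < e'" using e by (simp add: e'_def)
      obtain q r :: rat where q: "\<bar>a - of_rat q\<bar> < e'" and r: "\<bar>b - of_rat r\<bar> < e'"
        using rat[OF e'] by metis
      have "c - (of_rat q *\<^sub>R 1 + of_rat r *\<^sub>R i) = (a - of_rat q) *\<^sub>R 1 + (b - of_rat r) *\<^sub>R i"
        by (simp add: ab scaleR_left_diff_distrib)
      then have "norm (c - (of_rat q *\<^sub>R 1 + of_rat r *\<^sub>R i)) \<le> \<bar>a - of_rat q\<bar> + \<bar>b - of_rat r\<bar> * norm i"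
        using norm_triangle_ineq[of "(a - of_rat q) *\<^sub>R 1" "(b - of_rat r) *\<^sub>R i"] by simp
      also have "\<dots> < e' + e' * norm i"
        using q r by (intro add_less_le_mono mult_right_mono) auto
      also have "\<dots> = e' * (1 + norm i)" by (simp add: algebra_simps)
      also have "\<dots> = e" using p by (simp add: e'_def)
      finally show "\<exists>n. norm (c - (case from_nat n of (q, r) \<Rightarrow> of_rat q *\<^sub>R 1 + of_rat r *\<^sub>R i)) < e"
        by (intro exI[of _ "to_nat (q, r)"]) simp
    qed
  qed
qed

section \<open>Norms on dual spaces\<close>

text \<open>The axioms are properties that pass to the dual with its operator norm, so that the
  construction can be iterated up to the third dual.\<close>

locale normed_carrier =
  fixes V :: "'v::ab_group_add set" and sc :: "'k::real_normed_field \<Rightarrow> 'v \<Rightarrow> 'v"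
    and N :: "'v \<Rightarrow> real"
  assumes zero_mem: "0 \<in> V" and add_mem: "x \<in> V \<Longrightarrow> y \<in> V \<Longrightarrow> x + y \<in> V"
    and scale_mem: "x \<in> V \<Longrightarrow> sc c x \<in> V" and scale_minus_one: "x \<in> V \<Longrightarrow> sc (- 1) x = - x"
    and N_zero: "N 0 = 0" and N_nonneg: "x \<in> V \<Longrightarrow> 0 \<le> N x"
    and N_add: "x \<in> V \<Longrightarrow> y \<in> V \<Longrightarrow> N (x + y) \<le> N x + N y"
    and N_scale: "x \<in> V \<Longrightarrow> N (sc c x) = norm c * N x"
begin

abbreviation "V' \<equiv> dual V sc N"
abbreviation "N' \<equiv> dual_norm V N :: ('v \<Rightarrow> 'k) \<Rightarrow> real"

lemma minus_mem: "x \<in> V \<Longrightarrow> - x \<in> V"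
  using scale_mem[of x "-1"] scale_minus_one by simp

lemma diff_mem: "x \<in> V \<Longrightarrow> y \<in> V \<Longrightarrow> x - y \<in> V"
  using add_mem[of x "- y"] minus_mem by simp

lemma N_minus: "x \<in> V \<Longrightarrow> N (- x) = N x"
  using N_scale[of x "-1"] scale_minus_one by simp

lemma N_minus_commute: "x \<in> V \<Longrightarrow> y \<in> V \<Longrightarrow> N (x - y) = N (y - x)"
  using N_minus[of "x - y"] diff_mem by simp

lemma N_triangle: "x \<in> V \<Longrightarrow> y \<in> V \<Longrightarrow> z \<in> V \<Longrightarrow> N (x - z) \<le> N (x - y) + N (y - z)"
  using N_add[of "x - y" "y - z"] diff_mem by simp

lemma dual_add: "\<phi> \<in> V' \<Longrightarrow> x \<in> V \<Longrightarrow> y \<in> V \<Longrightarrow> \<phi> (x + y) = \<phi> x + \<phi> y"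
  and dual_scale: "\<phi> \<in> V' \<Longrightarrow> x \<in> V \<Longrightarrow> \<phi> (sc c x) = c * \<phi> x"
  and dual_off: "\<phi> \<in> V' \<Longrightarrow> x \<notin> V \<Longrightarrow> \<phi> x = 0"
  by (auto simp: dual_def)

lemma dual_minus: "\<phi> \<in> V' \<Longrightarrow> x \<in> V \<Longrightarrow> \<phi> (- x) = - \<phi> x"
  using dual_scale[of \<phi> x "-1"] scale_minus_one by simp

lemma dual_diff: "\<phi> \<in> V' \<Longrightarrow> x \<in> V \<Longrightarrow> y \<in> V \<Longrightarrow> \<phi> (x - y) = \<phi> x - \<phi> y"
  using dual_add[of \<phi> x "- y"] dual_minus minus_mem by simp

lemma dualI:
  assumes "\<And>x. x \<notin> V \<Longrightarrow> \<phi> x = 0" "\<And>x y. x \<in> V \<Longrightarrow> y \<in> V \<Longrightarrow> \<phi> (x + y) = \<phi> x + \<phi> y"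
    "\<And>c x. x \<in> V \<Longrightarrow> \<phi> (sc c x) = c * \<phi> x" "\<And>x. x \<in> V \<Longrightarrow> norm (\<phi> x) \<le> C * N x"
  shows "\<phi> \<in> V'"
  using assms unfolding dual_def by blast

lemma dual_norm_bdd_above:
  assumes "\<phi> \<in> V'"
  shows "bdd_above ((\<lambda>x. norm (\<phi> x)) ` {x \<in> V. N x \<le> 1})"
proof -
  obtain C where C: "\<And>x. x \<in> V \<Longrightarrow> norm (\<phi> x) \<le> C * N x" using assms unfolding dual_def by blast
  show ?thesis
  proof (rule bdd_aboveI2)
    fix x assume x: "x \<in> {x \<in> V. N x \<le> 1}"
    have "norm (\<phi> x) \<le> C * N x" using C x by blast
    also have "\<dots> \<le> \<bar>C\<bar> * N x" using x N_nonneg by (intro mult_right_mono) auto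
    also have "\<dots> \<le> \<bar>C\<bar>" using x N_nonneg by (simp add: mult_left_le)
    finally show "norm (\<phi> x) \<le> \<bar>C\<bar>" .
  qed
qed

lemma dual_norm_upper:
  assumes "\<phi> \<in> V'" "x \<in> V" "N x \<le> 1"
  shows "norm (\<phi> x) \<le> N' \<phi>"
  unfolding dual_norm_def by (rule cSUP_upper[OF _ dual_norm_bdd_above]) (use assms in auto)

lemma dual_norm_nonneg: "\<phi> \<in> V' \<Longrightarrow> 0 \<le> N' \<phi>"
  using dual_norm_upper[of \<phi> 0] zero_mem N_zero order_trans[OF norm_ge_zero[of "\<phi> 0"]] by simp

lemma dual_norm_bound:
  assumes \<phi>: "\<phi> \<in> V'" and x: "x \<in> V"
  shows "norm (\<phi> x) \<le> N' \<phi> * N x"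
proof (cases "N x = 0")
  case True
  obtain C where "norm (\<phi> x) \<le> C * N x" using \<phi> x by (auto simp: dual_def)
  then show ?thesis using True by simp
next
  case False
  then have p: "0 < N x" using N_nonneg[OF x] by simp
  have "norm (\<phi> (sc (of_real (1 / N x)) x)) \<le> N' \<phi>"
    using p x by (intro dual_norm_upper[OF \<phi>] scale_mem) (auto simp: N_scale norm_divide)
  then show ?thesis
    using p dual_scale[OF \<phi> x] by (simp add: norm_mult norm_divide field_simps)
qed

lemma dual_norm_least:
  assumes "\<And>x. x \<in> V \<Longrightarrow> N x \<le> 1 \<Longrightarrow> norm (\<phi> x) \<le> B"
  shows "N' \<phi> \<le> B"
  unfolding dual_norm_def
proof (rule cSUP_least)
  show "{x \<in> V. N x \<le> 1} \<noteq> {}" using zero_mem N_zero by auto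
qed (use assms in auto)

lemma dual_norm_least_mult:
  assumes "\<And>x. x \<in> V \<Longrightarrow> norm (\<phi> x) \<le> B * N x" "0 \<le> B"
  shows "N' \<phi> \<le> B"
proof (rule dual_norm_least)
  fix x assume "x \<in> V" "N x \<le> 1"
  then have "B * N x \<le> B" using assms(2) by (simp add: mult_left_le)
  then show "norm (\<phi> x) \<le> B" using assms(1) \<open>x \<in> V\<close> by force
qed

lemma dual_norm_le_iff:
  assumes "\<phi> \<in> V'" "0 \<le> B"
  shows "N' \<phi> \<le> B \<longleftrightarrow> (\<forall>x\<in>V. norm (\<phi> x) \<le> B * N x)"
proof
  assume "N' \<phi> \<le> B"
  then have "N' \<phi> * N x \<le> B * N x" if "x \<in> V" for x
    using N_nonneg[OF that] by (rule mult_right_mono)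
  then show "\<forall>x\<in>V. norm (\<phi> x) \<le> B * N x" using dual_norm_bound[OF assms(1)] order_trans by blast
qed (use assms dual_norm_least_mult in blast)

lemma dual_eq_zero: "\<phi> \<in> V' \<Longrightarrow> N' \<phi> \<le> 0 \<Longrightarrow> \<phi> = 0"
  using dual_norm_le_iff[of \<phi> 0] dual_off[of \<phi>] by (auto simp: fun_eq_iff)

lemma zero_in_dual: "0 \<in> V'"
  by (rule dualI[of _ 0]) auto

lemma add_in_dual: 
  assumes "\<phi> \<in> V'" "\<psi> \<in> V'"
  shows "\<phi> + \<psi> \<in> V'" and "N' (\<phi> + \<psi>) \<le> N' \<phi> + N' \<psi>"
proof -
  have *: "norm ((\<phi> + \<psi>) x) \<le> (N' \<phi> + N' \<psi>) * N x" if "x \<in> V" for x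
    using norm_triangle_ineq[of "\<phi> x" "\<psi> x"] dual_norm_bound[OF assms(1) that]
      dual_norm_bound[OF assms(2) that] by (simp add: distrib_right)
  show "\<phi> + \<psi> \<in> V'"
    by (rule dualI[of _ "N' \<phi> + N' \<psi>", OF _ _ _ *])
      (use assms in \<open>auto simp: dual_off dual_add dual_scale algebra_simps\<close>)
  show "N' (\<phi> + \<psi>) \<le> N' \<phi> + N' \<psi>"
    using assms * by (intro dual_norm_least_mult add_nonneg_nonneg dual_norm_nonneg) auto
qed

lemma scale_in_dual: 
  assumes "\<phi> \<in> V'"
  shows "fscale c \<phi> \<in> V'" and "N' (fscale c \<phi>) = norm c * N' \<phi>"
proof -
  have mem: "fscale c \<phi> \<in> V'" and le: "N' (fscale c \<phi>) \<le> norm c * N' \<phi>" if \<phi>: "\<phi> \<in> V'" for c \<phi>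
  proof -
    have *: "norm (fscale c \<phi> x) \<le> (norm c * N' \<phi>) * N x" if "x \<in> V" for x
      using mult_left_mono[OF dual_norm_bound[OF \<phi> that] norm_ge_zero[of c]]
      by (simp add: fscale_def norm_mult mult.assoc)
    show "fscale c \<phi> \<in> V'"
      by (rule dualI[of _ "norm c * N' \<phi>", OF _ _ _ *])
        (use \<phi> in \<open>auto simp: fscale_def dual_off dual_add dual_scale algebra_simps\<close>)
    show "N' (fscale c \<phi>) \<le> norm c * N' \<phi>"
      using \<phi> * by (intro dual_norm_least_mult mult_nonneg_nonneg dual_norm_nonneg) auto
  qed
  show "fscale c \<phi> \<in> V'" using mem assms by blast
  show "N' (fscale c \<phi>) = norm c * N' \<phi>"
  proof (cases "c = 0")
    case True
    have "fscale 0 \<phi> = 0" by (simp add: fscale_def fun_eq_iff)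
    moreover have "N' 0 = 0"
      using dual_norm_least[of 0 0] dual_norm_nonneg[OF zero_in_dual] by simp
    ultimately show ?thesis using True by simp
  next
    case False
    have "fscale (1 / c) (fscale c \<phi>) = \<phi>" using False by (simp add: fscale_def)
    then have "N' \<phi> \<le> norm (1 / c) * N' (fscale c \<phi>)"
      using le[OF mem[OF assms], of "1 / c" c] by simp
    then have "norm c * N' \<phi> \<le> N' (fscale c \<phi>)"
      using False by (simp add: norm_divide field_simps)
    then show ?thesis using le[OF assms, of c] by simp
  qed
qed

lemma dual_normed_carrier: "normed_carrier V' fscale N'"
proof
  show "N' 0 = 0"
    using dual_norm_least[of 0 0] dual_norm_nonneg[OF zero_in_dual] by simp
  show "fscale (- 1) \<phi> = - \<phi>" for \<phi> :: "'v \<Rightarrow> 'k" by (simp add: fscale_def fun_eq_iff)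
qed (auto simp: zero_in_dual add_in_dual scale_in_dual dual_norm_nonneg)

end

lemma (in banach_space_over) normed_carrier: "normed_carrier UNIV smul norm"
  by unfold_locales (auto simp: norm_triangle_ineq norm_scale)

section \<open>M-embedded spaces\<close>

lemma Hausdorff_space_euclidean_fun:
  "Hausdorff_space (euclidean :: ('a \<Rightarrow> 'b::t2_space) topology)"
  unfolding euclidean_product_topology[symmetric] Hausdorff_space_product_topology
  by (simp add: Hausdorff_space_def disjnt_def) (metis hausdorff)

lemma fscale_apply: "fscale c f x = c * f x"
  by (simp add: fscale_def)

lemma compact_imp_closed_fun:
  fixes S :: "('a \<Rightarrow> 'b::t2_space) set"
  shows "compact S \<Longrightarrow> closed S"
  using compactin_imp_closedin[OF Hausdorff_space_euclidean_fun, of S] by simp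

text \<open>Tychonoff's theorem for a product of scalar balls. With radii proportional to a norm it
  is the compactness behind Banach-Alaoglu.\<close>

lemma compact_fun_norm_bounded:
  fixes r :: "'a \<Rightarrow> real"
  shows "compact {f :: 'a \<Rightarrow> 'k::real_or_complex. \<forall>x. norm (f x) \<le> r x}"
proof -
  have "compactin (product_topology (\<lambda>i. euclidean) UNIV) (PiE UNIV (\<lambda>x. cball (0::'k) (r x)))"
    unfolding compactin_PiE by (simp add: compact_cball_real_or_complex)
  then show ?thesis
    unfolding euclidean_product_topology by (simp add: PiE_def Pi_def)
qed

locale M_embedded_space = banach_space_over smul
  for smul :: "'k::real_or_complex \<Rightarrow> 'a::banach \<Rightarrow> 'a" +
  assumes M_embedded: "M_embedded smul"
begin

abbreviation "X1 \<equiv> dual UNIV smul norm"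
abbreviation "N1 \<equiv> dual_norm UNIV norm :: ('a \<Rightarrow> 'k) \<Rightarrow> real"
abbreviation "X2 \<equiv> dual X1 fscale N1"
abbreviation "N2 \<equiv> dual_norm X1 N1 :: (('a \<Rightarrow> 'k) \<Rightarrow> 'k) \<Rightarrow> real"
abbreviation "X3 \<equiv> dual X2 fscale N2"
abbreviation "N3 \<equiv> dual_norm X2 N2 :: ((('a \<Rightarrow> 'k) \<Rightarrow> 'k) \<Rightarrow> 'k) \<Rightarrow> real"

sublocale X0: normed_carrier UNIV smul norm by (rule normed_carrier)
sublocale X1: normed_carrier X1 fscale N1 by (rule X0.dual_normed_carrier)
sublocale X2: normed_carrier X2 fscale N2 by (rule X1.dual_normed_carrier)
sublocale X3: normed_carrier X3 fscale N3 by (rule X2.dual_normed_carrier)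

definition embed :: "'a \<Rightarrow> ('a \<Rightarrow> 'k) \<Rightarrow> 'k" where
  "embed x = (\<lambda>\<phi>. if \<phi> \<in> X1 then \<phi> x else 0)"

definition embed_dual :: "('a \<Rightarrow> 'k) \<Rightarrow> (('a \<Rightarrow> 'k) \<Rightarrow> 'k) \<Rightarrow> 'k" where
  "embed_dual p = (\<lambda>\<Phi>. if \<Phi> \<in> X2 then \<Phi> p else 0)"

lemma embed_in_bidual: "embed x \<in> X2" and norm_embed_le: "N2 (embed x) \<le> norm x"
proof -
  have *: "norm (embed x \<phi>) \<le> norm x * N1 \<phi>" if "\<phi> \<in> X1" for \<phi>
    using X0.dual_norm_bound[OF that, of x] that by (simp add: embed_def mult.commute)
  show "embed x \<in> X2"
    by (rule X1.dualI[of _ "norm x"]) (use * in \<open>auto simp: embed_def X1.add_mem X1.scale_mem fscale_apply\<close>)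
  show "N2 (embed x) \<le> norm x" by (rule X1.dual_norm_least_mult[OF *]) auto
qed

text \<open>The lower bound for the norm is seen on the images \<open>embed x\<close> of the unit
  ball, which have norm at most 1. No Hahn-Banach argument is involved, since only this upper bound
  for \<open>embed\<close> enters.\<close>

lemma embed_dual_in_tridual: "p \<in> X1 \<Longrightarrow> embed_dual p \<in> X3"
  and norm_embed_dual: "p \<in> X1 \<Longrightarrow> N3 (embed_dual p) = N1 p"
proof -
  assume p: "p \<in> X1"
  have *: "norm (embed_dual p \<Phi>) \<le> N1 p * N2 \<Phi>" if "\<Phi> \<in> X2" for \<Phi>
    using X1.dual_norm_bound[OF that p] that by (simp add: embed_dual_def mult.commute)
  show mem: "embed_dual p \<in> X3"
    by (rule X2.dualI[of _ "N1 p"]) (use * in \<open>auto simp: embed_dual_def X2.add_mem X2.scale_mem fscale_apply\<close>)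
  show "N3 (embed_dual p) = N1 p"
  proof (rule antisym)
    show "N3 (embed_dual p) \<le> N1 p"
      by (rule X2.dual_norm_least_mult[OF *]) (use p X0.dual_norm_nonneg in auto)
    show "N1 p \<le> N3 (embed_dual p)"
    proof (rule X0.dual_norm_least)
      fix x :: 'a assume "norm x \<le> 1"
      then have "norm (embed_dual p (embed x)) \<le> N3 (embed_dual p)"
        using norm_embed_le[of x] by (intro X2.dual_norm_upper[OF mem embed_in_bidual]) auto
      then show "norm (p x) \<le> N3 (embed_dual p)"
        using p by (simp add: embed_dual_def embed_in_bidual) (simp add: embed_def)
    qed
  qed
qed

lemma embed_dual_diff: "p \<in> X1 \<Longrightarrow> q \<in> X1 \<Longrightarrow> embed_dual (p - q) = embed_dual p - embed_dual q"
  by (auto simp: embed_dual_def fun_eq_iff X1.dual_diff)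

lemma embed_add: "embed (x + y) = embed x + embed y"
  by (auto simp: embed_def fun_eq_iff X0.dual_add)

lemma embed_scale: "embed (smul c x) = fscale c (embed x)"
  by (auto simp: embed_def fun_eq_iff fscale_def X0.dual_scale)

text \<open>Restriction to the space is the adjoint of the canonical embedding, a contraction whose
  kernel is the annihilator in \<open>M_embedded\<close>.\<close>

lemma restrict_tridual:
  assumes "\<Psi> \<in> X3"
  shows "(\<lambda>x. \<Psi> (embed x)) \<in> X1" and "N1 (\<lambda>x. \<Psi> (embed x)) \<le> N3 \<Psi>"
proof -
  have *: "norm (\<Psi> (embed x)) \<le> N3 \<Psi> * norm x" for x
    using X2.dual_norm_bound[OF assms embed_in_bidual]
      mult_left_mono[OF norm_embed_le X2.dual_norm_nonneg[OF assms]] order_trans by blast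
  show "(\<lambda>x. \<Psi> (embed x)) \<in> X1"
    by (rule X0.dualI[of _ "N3 \<Psi>"])
      (use * in \<open>auto simp: embed_add embed_scale X2.dual_add[OF assms] X2.dual_scale[OF assms] embed_in_bidual\<close>)
  show "N1 (\<lambda>x. \<Psi> (embed x)) \<le> N3 \<Psi>"
    by (rule X0.dual_norm_least_mult) (use * X2.dual_norm_nonneg[OF assms] in auto)
qed

text \<open>The complement of the annihilator must be the canonical image of \<open>X1\<close>: restriction to the
  space is a contraction with the annihilator as kernel, which forces the component of
  \<open>embed_dual p\<close> in the annihilator to have norm zero.\<close>

lemma tridual_norm_split:
  assumes \<Psi>: "\<Psi> \<in> X3" and a: "a \<in> X1"
  defines "p \<equiv> \<lambda>x. \<Psi> (embed x)"
  shows "N3 (\<Psi> - embed_dual a) = N3 (\<Psi> - embed_dual p) + N1 (p - a)"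
proof -
  define U where "U = {\<Phi> \<in> X3. \<forall>x. \<Phi> (embed x) = 0}"
  obtain V where V: "closed_subspace X3 N3 V" "l1_sum X3 N3 U V"
    using M_embedded unfolding M_embedded_def Let_def U_def embed_def by blast
  have subU: "U \<subseteq> X3" by (auto simp: U_def)
  have subV: "V \<subseteq> X3" and linV: "fn.subspace V" using V(1) by (auto simp: closed_subspace_def)
  have inter: "U \<inter> V = {0}" and sum: "X3 = {u + v | u v. u \<in> U \<and> v \<in> V}"
    and norm_sum: "\<And>u v. u \<in> U \<Longrightarrow> v \<in> V \<Longrightarrow> N3 (u + v) = N3 u + N3 v"
    using V(2) by (auto simp: l1_sum_def)
  have image: "embed_dual b \<in> V" if b: "b \<in> X1" for b
  proof -
    obtain u v where uv: "embed_dual b = u + v" "u \<in> U" "v \<in> V"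
      using embed_dual_in_tridual[OF b] sum by blast
    have "v (embed x) = b x" for x
    proof -
      have "embed_dual b (embed x) = u (embed x) + v (embed x)" using uv(1) by simp
      then show ?thesis using uv(2) b by (simp add: U_def embed_dual_def embed_in_bidual) (simp add: embed_def)
    qed
    then have "(\<lambda>x. v (embed x)) = b" by auto
    then have "N1 b \<le> N3 v" using restrict_tridual(2)[of v] uv(3) subV by auto
    moreover have "N1 b = N3 u + N3 v"
      using norm_sum[OF uv(2,3)] uv(1) norm_embed_dual[OF b] by simp
    ultimately have "N3 u \<le> 0" by simp
    then have "u = 0" using X2.dual_eq_zero uv(2) subU by blast
    then show ?thesis using uv by simp
  qed
  have p: "p \<in> X1" unfolding p_def by (rule restrict_tridual(1)[OF \<Psi>])
  obtain u v where uv: "\<Psi> = u + v" "u \<in> U" "v \<in> V" using \<Psi> sum by blast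
  \<comment> \<open>Both \<open>v\<close> and \<open>embed_dual p\<close> restrict to
    \<open>p\<close> on the space, so their difference lies in both summands and vanishes.\<close>
  have "v - embed_dual p \<in> V" using linV uv(3) image[OF p] by (rule fn.subspace_diff)
  moreover have "v - embed_dual p \<in> U"
  proof -
    have "v (embed x) = p x" for x using uv(1,2) by (simp add: p_def U_def)
    moreover have "v - embed_dual p \<in> X3"
      using X3.diff_mem uv(3) subV embed_dual_in_tridual[OF p] by blast
    ultimately show ?thesis using p by (simp add: U_def embed_dual_def embed_in_bidual) (simp add: embed_def)
  qed
  ultimately have "v - embed_dual p \<in> {0}" using inter by blast
  then have "v = embed_dual p" by simp
  then have u: "\<Psi> - embed_dual p = u" using uv by simp
  have "\<Psi> - embed_dual a = u + embed_dual (p - a)"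
    using u by (simp add: embed_dual_diff[OF p a] algebra_simps)
  moreover have pa: "p - a \<in> X1" using p a by (rule X1.diff_mem)
  ultimately show ?thesis
    using norm_sum[OF uv(2) image[OF pa]] norm_embed_dual[OF pa] u by simp
qed

text \<open>Membership in the ball amounts to linear equations and norm inequalities at single
  points. Hence the ball is closed in the whole function space and not merely relative to
  \<open>X1\<close>.\<close>

lemma closed_dual_ball: "closed {\<phi>. \<phi> \<in> X1 \<and> N1 (\<phi> - q) \<le> r}" if q: "q \<in> X1" and r: "0 \<le> r"
proof -
  have eq: "{\<phi>. \<phi> \<in> X1 \<and> N1 (\<phi> - q) \<le> r} =
      (\<Inter>x y. {\<phi>. \<phi> (x + y) = \<phi> x + \<phi> y}) \<inter> (\<Inter>c x. {\<phi>. \<phi> (smul c x) = c * \<phi> x}) \<inter>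
      (\<Inter>x. {\<phi>. norm (\<phi> x - q x) \<le> r * norm x})" (is "?L = ?R")
  proof
    show "?L \<subseteq> ?R"
      using X0.dual_norm_le_iff[OF X1.diff_mem[OF _ q] r]
      by (auto simp: X0.dual_add X0.dual_scale)
    show "?R \<subseteq> ?L"
    proof
      fix \<phi> assume R: "\<phi> \<in> ?R"
      have "\<phi> \<in> X1"
      proof (rule X0.dualI[of _ "r + N1 q"])
        fix x
        have "norm (\<phi> x) \<le> norm (\<phi> x - q x) + norm (q x)" using norm_triangle_sub[of "\<phi> x" "q x"] by simp
        also have "\<dots> \<le> r * norm x + N1 q * norm x"
          using R X0.dual_norm_bound[OF q] by (intro add_mono) auto
        finally show "norm (\<phi> x) \<le> (r + N1 q) * norm x" by (simp add: distrib_right)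
      qed (use R in auto)
      then show "\<phi> \<in> ?L" using X0.dual_norm_le_iff[OF X1.diff_mem[OF _ q] r] R by auto
    qed
  qed
  show ?thesis unfolding eq
    by (intro closed_Int closed_INT ballI closed_Collect_eq closed_Collect_le continuous_intros
        continuous_on_product_coordinates)
qed

text \<open>On a set of points that all have the same Chebyshev radius with respect to \<open>B\<close>, the weak-star
  topology is as fine as the weak topology: by the norm splitting, a limit in the third dual of such
  points has no component in the annihilator.\<close>

lemma weak_closure:
  assumes A: "A \<subseteq> X1" and bound: "\<And>a. a \<in> A \<Longrightarrow> N1 a \<le> C" and B: "B \<subseteq> X1"
    and radius: "\<And>a y. a \<in> A \<Longrightarrow> y \<in> B \<Longrightarrow> N1 (a - y) \<le> \<rho>"
    and p: "p \<in> closure A" and p_radius: "\<And>e. 0 < e \<Longrightarrow> \<exists>y\<in>B. \<rho> - e < N1 (p - y)"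
    and \<Phi>: "\<Phi> \<in> X2" "\<And>a. a \<in> A \<Longrightarrow> \<Phi> a = 0"
  shows "\<Phi> p = 0"
proof -
  have "A \<noteq> {}" using p by auto
  then obtain a0 where a0: "a0 \<in> A" by blast
  then have C: "0 \<le> C" using bound[OF a0] X0.dual_norm_nonneg A by force
  obtain y0 where y0: "y0 \<in> B" using p_radius[of 1] by auto
  then have \<rho>: "0 \<le> \<rho>" using radius[OF a0 y0] X0.dual_norm_nonneg[OF X1.diff_mem] a0 y0 A B by force
  \<comment> \<open>A pointwise compact set of elements of the third dual obeying the estimates that
    hold on \<open>A\<close>: norm at most \<open>C\<close>, distance at most \<rho> from every
    \<open>y\<close>, and value 0 at \<open>\<Phi>\<close>. Its restriction to the space is
    therefore closed and contains \<open>A\<close>, so \<open>p\<close> lifts to some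
    \<open>\<Psi>\<close> in \<open>Z\<close>.\<close>
  define Z where "Z = {\<Psi>. \<forall>\<Theta>. norm (\<Psi> \<Theta>) \<le> (if \<Theta> \<in> X2 then C * N2 \<Theta> else 0) \<and> True} \<inter>
      (\<Inter>\<Theta>\<in>X2. \<Inter>\<Xi>\<in>X2. {\<Psi>. \<Psi> (\<Theta> + \<Xi>) = \<Psi> \<Theta> + \<Psi> \<Xi>}) \<inter>
      (\<Inter>c. \<Inter>\<Theta>\<in>X2. {\<Psi>. \<Psi> (fscale c \<Theta>) = c * \<Psi> \<Theta>}) \<inter>
      (\<Inter>y\<in>B. \<Inter>\<Theta>\<in>X2. {\<Psi>. norm (\<Psi> \<Theta> - \<Theta> y) \<le> \<rho> * N2 \<Theta>}) \<inter> {\<Psi>. \<Psi> \<Phi> = 0}"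
  have "compact Z"
    unfolding Z_def simp_thms
    by (intro compact_Int_closed compact_fun_norm_bounded closed_INT ballI closed_Collect_eq
        closed_Collect_le continuous_intros continuous_on_product_coordinates)
  moreover have cont: "continuous_on UNIV (\<lambda>(\<Psi> :: (('a \<Rightarrow> 'k) \<Rightarrow> 'k) \<Rightarrow> 'k) x. \<Psi> (embed x))"
    by (intro continuous_on_coordinatewise_then_product continuous_on_product_coordinates)
  ultimately have "compact ((\<lambda>\<Psi> x. \<Psi> (embed x)) ` Z)"
    by (intro compact_continuous_image continuous_on_subset[OF cont]) auto
  then have "closed ((\<lambda>\<Psi> x. \<Psi> (embed x)) ` Z)" by (rule compact_imp_closed_fun)
  moreover have "A \<subseteq> (\<lambda>\<Psi> x. \<Psi> (embed x)) ` Z"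
  proof
    fix a assume a: "a \<in> A"
    then have a1: "a \<in> X1" using A by blast
    have "norm (\<Theta> a) \<le> C * N2 \<Theta>" if "\<Theta> \<in> X2" for \<Theta>
      using X1.dual_norm_bound[OF that a1] mult_left_mono[OF bound[OF a] X1.dual_norm_nonneg[OF that]]
      by (simp add: mult.commute)
    moreover have "norm (\<Theta> a - \<Theta> y) \<le> \<rho> * N2 \<Theta>" if "\<Theta> \<in> X2" "y \<in> B" for \<Theta> y
    proof -
      have y: "y \<in> X1" using that B by blast
      have "norm (\<Theta> (a - y)) \<le> N2 \<Theta> * N1 (a - y)"
        by (rule X1.dual_norm_bound[OF that(1) X1.diff_mem[OF a1 y]])
      also have "\<dots> \<le> N2 \<Theta> * \<rho>"
        by (rule mult_left_mono[OF radius[OF a that(2)] X1.dual_norm_nonneg[OF that(1)]])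
      finally show ?thesis using X1.dual_diff[OF that(1) a1 y] by (simp add: mult.commute)
    qed
    ultimately have "embed_dual a \<in> Z"
      using \<Phi> a by (auto simp: Z_def embed_dual_def X2.add_mem X2.scale_mem fscale_apply)
    moreover have "a = (\<lambda>x. embed_dual a (embed x))"
      using a1 by (simp add: embed_dual_def embed_in_bidual) (simp add: embed_def)
    ultimately show "a \<in> (\<lambda>\<Psi> x. \<Psi> (embed x)) ` Z" by blast
  qed
  ultimately have "p \<in> (\<lambda>\<Psi> x. \<Psi> (embed x)) ` Z" using p closure_minimal by blast
  then obtain \<Psi> where \<Psi>: "\<Psi> \<in> Z" and p_eq: "p = (\<lambda>x. \<Psi> (embed x))" by blast
  have \<Psi>3: "\<Psi> \<in> X3"
  proof (rule X2.dualI[of _ C])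
    fix \<Theta>
    have *: "norm (\<Psi> \<Theta>) \<le> (if \<Theta> \<in> X2 then C * N2 \<Theta> else 0)" using \<Psi> by (simp add: Z_def)
    show "\<Psi> \<Theta> = 0" if "\<Theta> \<notin> X2" using * that by simp
    show "norm (\<Psi> \<Theta>) \<le> C * N2 \<Theta>" if "\<Theta> \<in> X2" using * that by simp
  qed (use \<Psi> in \<open>auto simp: Z_def\<close>)
  have p1: "p \<in> X1" unfolding p_eq by (rule restrict_tridual(1)[OF \<Psi>3])
  define u where "u = N3 (\<Psi> - embed_dual p)"
  \<comment> \<open>The splitting with \<open>a = y\<close> is applied to the radius bound for
    \<open>\<Psi>\<close>. Since the distances \<open>N1 (p - y)\<close> come arbitrarily close to
    \<rho>, no room is left for a positive \<open>u\<close>.\<close>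
  have le: "u + N1 (p - y) \<le> \<rho>" if "y \<in> B" for y
  proof -
    have y: "y \<in> X1" using that B by blast
    have "norm ((\<Psi> - embed_dual y) \<Theta>) \<le> \<rho> * N2 \<Theta>" if "\<Theta> \<in> X2" for \<Theta>
      using \<Psi> that \<open>y \<in> B\<close> by (simp add: Z_def embed_dual_def)
    then have "N3 (\<Psi> - embed_dual y) \<le> \<rho>" using \<rho> by (rule X2.dual_norm_least_mult)
    then show ?thesis using tridual_norm_split[OF \<Psi>3 y] by (simp add: u_def p_eq)
  qed
  have "u \<le> 0"
  proof (rule ccontr)
    assume "\<not> u \<le> 0"
    then obtain y where "y \<in> B" "\<rho> - u < N1 (p - y)" using p_radius[of u] by auto
    then show False using le[of y] by simp
  qed
  then have "\<Psi> - embed_dual p = 0"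
    unfolding u_def by (intro X2.dual_eq_zero X3.diff_mem \<Psi>3 embed_dual_in_tridual p1)
  then have "\<Psi> = embed_dual p" by simp
  then have "\<Psi> \<Phi> = \<Phi> p" using \<Phi>(1) by (simp add: embed_dual_def)
  then show ?thesis using \<Psi> by (simp add: Z_def)
qed

text \<open>A complex functional is recovered from its real part \<open>f\<close> as \<open>f x - \<i> f (\<i> x)\<close>.\<close>

lemma separating_functional:
  assumes G: "fn.subspace G" "G \<subseteq> X1" and p: "p \<in> X1" and e: "0 < e" "\<And>g. g \<in> G \<Longrightarrow> e \<le> N1 (p - g)"
  obtains \<Phi> where "\<Phi> \<in> X2" "\<And>g. g \<in> G \<Longrightarrow> \<Phi> g = 0" "\<Phi> p \<noteq> 0"
proof -
  define rs where "rs t x = fscale (of_real t) x" for t and x :: "'a \<Rightarrow> 'k"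
  interpret R: real_subspace rs X1
    by unfold_locales
      (simp_all add: rs_def fn.scale_right_distrib fn.scale_left_distrib X1.zero_mem X1.add_mem X1.scale_mem)
  \<comment> \<open>The distance to \<open>G\<close> is the quotient seminorm. A real functional
    below it vanishes on \<open>G\<close>, and Hahn-Banach makes it attain the value
    \<open>q p\<close>, which is at least \<open>e\<close>.\<close>
  define q where "q x = (INF g\<in>G. N1 (x - g))" for x
  have G0: "0 \<in> G" using G(1) by (rule fn.subspace_0)
  have bdd: "bdd_below ((\<lambda>g. N1 (x - g)) ` G)" if "x \<in> X1" for x
    by (rule bdd_belowI2[of _ 0]) (use that G(2) X1.N_nonneg X1.diff_mem in blast)
  have q_le: "q x \<le> N1 (x - g)" if "x \<in> X1" "g \<in> G" for x g
    unfolding q_def by (rule cINF_lower[OF bdd]) (use that in auto)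
  have q_ge: "b \<le> q x" if "\<And>g. g \<in> G \<Longrightarrow> b \<le> N1 (x - g)" for b x
    unfolding q_def by (rule cINF_greatest) (use G0 that in auto)
  have sub: "sublinear_on X1 rs q"
    unfolding sublinear_on_def
  proof (intro conjI ballI allI impI)
    fix x y assume xy: "x \<in> X1" "y \<in> X1"
    have *: "q (x + y) \<le> N1 (x - g) + N1 (y - h)" if gh: "g \<in> G" "h \<in> G" for g h
    proof -
      have "q (x + y) \<le> N1 ((x + y) - (g + h))"
        using xy gh G by (intro q_le X1.add_mem fn.subspace_add) auto
      also have "(x + y) - (g + h) = (x - g) + (y - h)" by simp
      also have "N1 \<dots> \<le> N1 (x - g) + N1 (y - h)"
        using xy gh G(2) by (intro X1.N_add X1.diff_mem) auto
      finally show ?thesis .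
    qed
    have "q (x + y) - N1 (y - h) \<le> q x" if "h \<in> G" for h
      by (rule q_ge) (use *[OF _ that] in force)
    then have "q (x + y) - q x \<le> q y" by (intro q_ge) force
    then show "q (x + y) \<le> q x + q y" by simp
  next
    fix t :: real and x assume t: "0 < t" and x: "x \<in> X1"
    have "q (rs t x) / t \<le> q x"
    proof (rule q_ge)
      fix g assume g: "g \<in> G"
      have "q (rs t x) \<le> N1 (rs t x - fscale (of_real t) g)"
        using x g G(1) R.V_scale by (intro q_le fn.subspace_scale) auto
      also have "rs t x - fscale (of_real t) g = fscale (of_real t) (x - g)"
        by (simp add: rs_def fn.scale_right_diff_distrib)
      also have "N1 \<dots> = t * N1 (x - g)"
        using x g G(2) t by (subst X1.N_scale) (auto intro: X1.diff_mem)
      finally show "q (rs t x) / t \<le> N1 (x - g)" using t by (simp add: field_simps)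
    qed
    then show "q (rs t x) \<le> t * q x" using t by (simp add: field_simps)
  qed
  obtain f where f_add: "\<And>x y. x \<in> X1 \<Longrightarrow> y \<in> X1 \<Longrightarrow> f (x + y) = f x + f y"
    and f_scale: "\<And>t x. x \<in> X1 \<Longrightarrow> f (rs t x) = t * f x" and f_le: "\<And>x. x \<in> X1 \<Longrightarrow> f x \<le> q x"
    and fp: "f p = q p"
    by (rule R.Hahn_Banach_sublinear[OF sub p]) (rule that)
  have f_minus: "f (- x) = - f x" if "x \<in> X1" for x
    using f_scale[OF that, of "-1"] by (simp add: rs_def)
  have fp_pos: "f p \<noteq> 0" using fp q_ge[of e p] e by force
  have f_abs: "\<bar>f x\<bar> \<le> N1 x" if x: "x \<in> X1" for x
  proof -
    have mx: "- x \<in> X1" using x by (rule R.V_minus)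
    have "f x \<le> N1 x" using f_le[OF x] q_le[OF x G0] by simp
    moreover have "- f x \<le> N1 x"
      using f_le[OF mx] q_le[OF mx G0] f_minus[OF x] X1.N_minus[OF x] by simp
    ultimately show ?thesis by simp
  qed
  have f_G: "f g = 0" if g: "g \<in> G" for g
  proof -
    have g1: "g \<in> X1" "- g \<in> X1" "- g \<in> G"
      using g G R.V_minus fn.subspace_neg by blast+
    have "f g \<le> 0" using f_le[OF g1(1)] q_le[OF g1(1) g] X1.N_zero by simp
    moreover have "f (- g) \<le> 0" using f_le[OF g1(2)] q_le[OF g1(2,3)] X1.N_zero by simp
    ultimately show ?thesis using f_minus[OF g1(1)] by simp
  qed
  from real_or_complex[where 'a='k] show thesis
  proof
    assume all: "\<forall>z::'k. \<exists>a. z = a *\<^sub>R 1"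
    define \<Phi> where "\<Phi> x = (if x \<in> X1 then of_real (f x) else 0 :: 'k)" for x
    show thesis
    proof (rule that)
      show "\<Phi> \<in> X2"
      proof (rule X1.dualI[of _ 1])
        fix c :: 'k and x assume x: "x \<in> X1"
        obtain a where "c = a *\<^sub>R 1" using all by blast
        then have a: "c = of_real a" by (simp add: of_real_def)
        show "\<Phi> (fscale c x) = c * \<Phi> x"
          using f_scale[OF x, of a] x X1.scale_mem[OF x, of c] by (simp add: \<Phi>_def a rs_def)
      qed (use f_abs in \<open>auto simp: \<Phi>_def f_add X1.add_mem\<close>)
      show "\<Phi> g = 0" if "g \<in> G" for g using f_G[OF that] by (simp add: \<Phi>_def)
      show "\<Phi> p \<noteq> 0" using fp_pos p by (simp add: \<Phi>_def)
    qed
  next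
    assume "\<exists>i::'k. i * i = - 1 \<and> (\<forall>z. \<exists>a b. z = a *\<^sub>R 1 + b *\<^sub>R i)"
    then obtain i :: 'k where i: "i * i = - 1" and all: "\<And>z. \<exists>a b. z = a *\<^sub>R 1 + b *\<^sub>R i" by blast
    define \<Phi> where "\<Phi> x = (if x \<in> X1 then of_real (f x) - of_real (f (fscale i x)) * i else 0 :: 'k)" for x
    show thesis
    proof (rule that)
      show "\<Phi> \<in> X2"
      \<comment> \<open>One factor \<open>norm i\<close> comes from the norm of
        \<open>fscale i x\<close>, the other from multiplying the second summand by
        \<open>i\<close>.\<close>
      proof (rule X1.dualI[of _ "1 + norm i * norm i"])
        fix c :: 'k and x assume x: "x \<in> X1"
        obtain a b where "c = a *\<^sub>R 1 + b *\<^sub>R i" using all by blast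
        then have ab: "c = of_real a + of_real b * i" by (simp add: scaleR_conv_of_real)
        have ix: "fscale i x \<in> X1" using X1.scale_mem x by blast
        have cx: "fscale c x = rs a x + rs b (fscale i x)"
          by (simp add: ab rs_def fscale_def fun_eq_iff algebra_simps)
        have icx: "fscale i (fscale c x) = rs a (fscale i x) + rs (- b) x"
        proof
          fix t
          have "i * (c * x t) = of_real a * (i * x t) + of_real b * (i * i) * x t"
            by (simp add: ab algebra_simps)
          then show "fscale i (fscale c x) t = (rs a (fscale i x) + rs (- b) x) t"
            by (simp add: i rs_def fscale_def)
        qed
        have f1: "f (fscale c x) = a * f x + b * f (fscale i x)"
          unfolding cx using f_add[OF R.V_scale[OF x] R.V_scale[OF ix]] f_scale[OF x] f_scale[OF ix] by simp
        have f2: "f (fscale i (fscale c x)) = a * f (fscale i x) - b * f x"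
          unfolding icx f_add[OF R.V_scale[OF ix] R.V_scale[OF x]] f_scale[OF x] f_scale[OF ix] by simp
        have "c * (of_real (f x) - of_real (f (fscale i x)) * i) =
            of_real a * of_real (f x) + of_real b * of_real (f x) * i
            - of_real a * of_real (f (fscale i x)) * i - of_real b * of_real (f (fscale i x)) * (i * i)"
          by (simp add: ab algebra_simps)
        moreover have "\<Phi> (fscale c x) = of_real (a * f x + b * f (fscale i x))
            - of_real (a * f (fscale i x) - b * f x) * i"
          unfolding f1[symmetric] f2[symmetric] using X1.scale_mem[OF x, of c] by (simp only: \<Phi>_def if_True)
        ultimately show "\<Phi> (fscale c x) = c * \<Phi> x"
          using x by (simp add: \<Phi>_def i) (simp add: algebra_simps)
      next
        fix x assume x: "x \<in> X1"
        have ix: "fscale i x \<in> X1" using X1.scale_mem x by blast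
        have "norm (\<Phi> x) \<le> \<bar>f x\<bar> + \<bar>f (fscale i x)\<bar> * norm i"
          using norm_triangle_ineq4[of "of_real (f x)" "of_real (f (fscale i x)) * i"] x
          by (simp add: \<Phi>_def norm_mult)
        also have "\<dots> \<le> N1 x + N1 (fscale i x) * norm i"
          using f_abs[OF x] f_abs[OF ix] by (intro add_mono mult_right_mono) auto
        also have "\<dots> = (1 + norm i * norm i) * N1 x" using X1.N_scale[OF x] by (simp add: algebra_simps)
        finally show "norm (\<Phi> x) \<le> (1 + norm i * norm i) * N1 x" .
      next
        fix x y assume xy: "x \<in> X1" "y \<in> X1"
        have "fscale i (x + y) = fscale i x + fscale i y" by (rule fn.scale_right_distrib)
        then show "\<Phi> (x + y) = \<Phi> x + \<Phi> y"
          using xy by (simp add: \<Phi>_def f_add X1.add_mem X1.scale_mem algebra_simps)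
      qed (auto simp: \<Phi>_def)
      show "\<Phi> g = 0" if "g \<in> G" for g
        using f_G[OF that] f_G[OF fn.subspace_scale[OF G(1) that, of i]] by (simp add: \<Phi>_def)
      show "\<Phi> p \<noteq> 0"
      proof
        assume "\<Phi> p = 0"
        then have "f p *\<^sub>R 1 + (- f (fscale i p)) *\<^sub>R i = 0"
          using p by (simp add: \<Phi>_def scaleR_conv_of_real)
        then show False
          using real_or_complex_bounded_coordinates(1)[OF i, of "f p" "- f (fscale i p)"] fp_pos by simp
      qed
    qed
  qed
qed

end

section \<open>Norm boundedness and norm fragmentation\<close>

context M_embedded_space
begin

text \<open>The uniform boundedness principle: evaluations are weak-star continuous, so
  \<open>K\<close> is pointwise bounded. Baire's theorem gives one of the closed sets
  \<open>E n\<close> an interior point, and linearity spreads the bound.\<close>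

lemma weak_star_compact_norm_bounded:
  assumes K: "compact K" "K \<subseteq> X1"
  obtains C where "\<And>\<phi>. \<phi> \<in> K \<Longrightarrow> N1 \<phi> \<le> C"
proof (cases "K = {}")
  case False
  define E where "E n = (\<Inter>\<phi>\<in>K. {x. norm (\<phi> x) \<le> real n})" for n
  have cont: "continuous_on UNIV \<phi>" if "\<phi> \<in> K" for \<phi>
  proof -
    have \<phi>: "\<phi> \<in> X1" using that K by blast
    have "norm (\<phi> x - \<phi> y) \<le> N1 \<phi> * norm (x - y)" for x y
      using X0.dual_norm_bound[OF \<phi>, of "x - y"] X0.dual_diff[OF \<phi>, of x y] by simp
    then show ?thesis
      by (intro lipschitz_on_continuous_on[of "N1 \<phi>"] lipschitz_onI)
        (auto simp: dist_norm X0.dual_norm_nonneg[OF \<phi>])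
  qed
  have closed: "closed (E n)" for n
    unfolding E_def by (intro closed_INT ballI closed_Collect_le continuous_on_norm cont continuous_intros)
  have cover: "(\<Union>n. E n) = UNIV"
  proof -
    have "\<exists>n. x \<in> E n" for x
    proof -
      have "compact ((\<lambda>\<phi>. \<phi> x) ` K)"
        using K(1) by (intro compact_continuous_image continuous_on_subset[OF continuous_on_product_coordinates]) auto
      then have "bounded ((\<lambda>\<phi>. \<phi> x) ` K)" by (rule compact_imp_bounded)
      then obtain B where B: "\<And>\<phi>. \<phi> \<in> K \<Longrightarrow> norm (\<phi> x) \<le> B" by (auto simp: bounded_iff)
      obtain n :: nat where "B \<le> real n" using real_arch_simple by blast
      then show ?thesis using B by (intro exI[of _ n]) (force simp: E_def)
    qed
    then show ?thesis by blast
  qed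
  have "\<exists>n. interior (E n) \<noteq> {}"
  proof (rule ccontr)
    assume "\<not> ?thesis"
    then have "euclidean interior_of \<Union>(range E) = {}"
      using closed completely_metrizable_space_euclidean
      by (intro Baire_category_alt) auto
    then show False unfolding cover by simp
  qed
  then obtain n z e where ball: "0 < e" "ball z e \<subseteq> E n"
    by (metis ex_in_conv mem_interior)
  have "norm (\<phi> x) \<le> (4 * real n / e) * norm x" if \<phi>: "\<phi> \<in> K" for \<phi> x
  proof (cases "x = 0")
    case True
    then show ?thesis using X0.dual_norm_bound[of \<phi> 0] \<phi> K by auto
  next
    case False
    \<comment> \<open>With this \<open>t\<close> the point \<open>z + t x\<close> stays in the ball.
      Subtracting the bound \<open>n\<close> at \<open>z\<close> gives \<open>2 n / t\<close>, which
      is the source of \<open>4 n / e\<close>.\<close>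
    define t where "t = e / (2 * norm x)"
    have t: "0 < t" using False ball by (simp add: t_def)
    have \<phi>1: "\<phi> \<in> X1" using \<phi> K by blast
    have "z \<in> E n" "z + t *\<^sub>R x \<in> E n"
      using ball t False by (auto intro!: subsetD[OF ball(2)] simp: dist_norm t_def)
    then have "norm (\<phi> z) \<le> n" "norm (\<phi> (z + t *\<^sub>R x)) \<le> n" using \<phi> by (auto simp: E_def)
    moreover have "\<phi> (z + t *\<^sub>R x) = \<phi> z + of_real t * \<phi> x"
      using X0.dual_add[OF \<phi>1, of z "t *\<^sub>R x"] X0.dual_scale[OF \<phi>1, of x "of_real t"]
      by (simp add: scale_of_real)
    ultimately have "norm (of_real t * \<phi> x) \<le> 2 * n"
      using norm_triangle_ineq4[of "\<phi> (z + t *\<^sub>R x)" "\<phi> z"] by simp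
    then have "t * norm (\<phi> x) \<le> 2 * n" using t by (simp add: norm_mult)
    then show ?thesis using ball(1) False by (simp add: t_def field_simps)
  qed
  then have "N1 \<phi> \<le> 4 * real n / e" if "\<phi> \<in> K" for \<phi>
    using that ball(1) by (intro X0.dual_norm_least_mult) auto
  then show thesis by (rule that)
qed (rule that[of 0], simp)

text \<open>A point sequence that avoids the balls around all rational combinations of its predecessors
  would have a cluster point outside the norm-closed span of the sequence.\<close>

lemma small_open_subset:
  assumes F: "compact F" "F \<subseteq> X1" "F \<noteq> {}"
    and radius: "\<And>x y. x \<in> F \<Longrightarrow> y \<in> F \<Longrightarrow> N1 (x - y) \<le> \<rho>"
    and radius_attained: "\<And>x e. x \<in> F \<Longrightarrow> 0 < e \<Longrightarrow> \<exists>y\<in>F. \<rho> - e < N1 (x - y)"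
    and \<epsilon>: "0 < \<epsilon>"
  obtains q U where "q \<in> X1" "openin (top_of_set F) U" "U \<noteq> {}" "\<And>x. x \<in> U \<Longrightarrow> N1 (x - q) \<le> \<epsilon>"
proof (rule ccontr)
  assume "\<not> thesis"
  then have large: "\<exists>x\<in>U. \<epsilon> < N1 (x - q)" if "q \<in> X1" "openin (top_of_set F) U" "U \<noteq> {}" for q U
    using \<open>\<And>q U. q \<in> X1 \<Longrightarrow> openin (top_of_set F) U \<Longrightarrow> U \<noteq> {} \<Longrightarrow> (\<And>x. x \<in> U \<Longrightarrow> N1 (x - q) \<le> \<epsilon>) \<Longrightarrow> thesis\<close> that
    by (meson not_le)
  define T where "T = top_of_set F"
  have topT: "topspace T = F" by (simp add: T_def)
  have compactT: "compact_space T" using F(1) by (simp add: T_def compact_space_subtopology)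
  have hausT: "Hausdorff_space T"
    unfolding T_def by (rule Hausdorff_space_subtopology[OF Hausdorff_space_euclidean_fun])
  have regT: "regular_space T" using compactT hausT by (rule compact_Hausdorff_imp_regular_space)
  have open_far: "openin T {x \<in> F. \<epsilon> < N1 (x - q)}" if q: "q \<in> X1" for q
  proof -
    have cl: "closedin T (F \<inter> {\<phi>. \<phi> \<in> X1 \<and> N1 (\<phi> - q) \<le> \<epsilon>})"
      unfolding T_def using closed_dual_ball[OF q less_imp_le[OF \<epsilon>]] by (rule closedin_closed_Int)
    have eq: "F - (F \<inter> {\<phi>. \<phi> \<in> X1 \<and> N1 (\<phi> - q) \<le> \<epsilon>}) = {x \<in> F. \<epsilon> < N1 (x - q)}"
      using F(2) by auto
    show ?thesis using openin_diff[OF openin_topspace cl] unfolding topT eq .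
  qed
  \<comment> \<open>By \<open>large\<close> every nonempty open set has a point far from a given
    centre, and far points form an open set because dual balls are closed. Finitely many centres can
    thus be avoided one after another.\<close>
  have avoid: "openin T {x \<in> U. \<forall>q\<in>Q. \<epsilon> < N1 (x - q)} \<and> {x \<in> U. \<forall>q\<in>Q. \<epsilon> < N1 (x - q)} \<noteq> {}"
    if "finite Q" "Q \<subseteq> X1" "openin T U" "U \<noteq> {}" for Q U
    using that
  proof (induction Q rule: finite_induct)
    case (insert q Q)
    let ?W = "{x \<in> U. \<forall>q\<in>Q. \<epsilon> < N1 (x - q)}"
    have W: "openin T ?W" "?W \<noteq> {}" using insert.IH insert.prems by blast+
    have "?W \<subseteq> F" using openin_subset[OF W(1)] topT by simp
    then have eq: "{x \<in> U. \<forall>q\<in>insert q Q. \<epsilon> < N1 (x - q)} = ?W \<inter> {x \<in> F. \<epsilon> < N1 (x - q)}" by auto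
    have "\<exists>x\<in>?W. \<epsilon> < N1 (x - q)"
      using W insert.prems by (intro large) (simp_all add: T_def)
    then show ?case
      unfolding eq using W open_far[of q] insert.prems \<open>?W \<subseteq> F\<close> by blast
  qed simp
  obtain d :: "nat \<Rightarrow> 'k" where d: "\<And>c e. 0 < e \<Longrightarrow> \<exists>n. norm (c - d n) < e"
    by (rule real_or_complex_dense_sequence) (rule that)
  \<comment> \<open>A state consists of an open set \<open>U\<close>, a finite set \<open>Q\<close>
    of centres and a point \<open>y\<close> of \<open>U\<close>. The next state shrinks
    \<open>U\<close> away from \<open>Q\<close>, while \<open>Q\<close> absorbs the point
    \<open>y\<close>, sums, and multiples by the first members of the dense scalar sequence.\<close>
  define P where "P n st \<longleftrightarrow> (case st of (U, Q, y) \<Rightarrow> openin T U \<and> y \<in> U \<and> finite Q \<and> Q \<subseteq> X1 \<and> 0 \<in> Q)"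
    for n :: nat and st :: "('a \<Rightarrow> 'k) set \<times> ('a \<Rightarrow> 'k) set \<times> ('a \<Rightarrow> 'k)"
  define R where "R n st st' \<longleftrightarrow> (case (st, st') of ((U, Q, y), (U', Q', y')) \<Rightarrow>
      T closure_of U' \<subseteq> U \<and> (\<forall>x\<in>T closure_of U'. \<forall>q\<in>Q. \<epsilon> < N1 (x - q)) \<and> Q \<subseteq> Q' \<and> y \<in> Q' \<and>
      (\<forall>a\<in>Q. \<forall>b\<in>Q. a + b \<in> Q') \<and> (\<forall>j\<le>n. \<forall>a\<in>Q. fscale (d j) a \<in> Q'))"
    for n :: nat and st st' :: "('a \<Rightarrow> 'k) set \<times> ('a \<Rightarrow> 'k) set \<times> ('a \<Rightarrow> 'k)"
  have "\<exists>f. \<forall>n. P n (f n) \<and> R n (f n) (f (Suc n))"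
  proof (rule dependent_nat_choice)
    obtain y where "y \<in> F" using F(3) by blast
    then have "P 0 (F, {0}, y)"
      using openin_topspace[of T] topT X1.zero_mem by (simp add: P_def)
    then show "\<exists>st. P 0 st" by blast
    fix st n assume "P n st"
    then obtain U Q y where st: "st = (U, Q, y)" and U: "openin T U" "y \<in> U"
      and Q: "finite Q" "Q \<subseteq> X1" "0 \<in> Q" by (cases st) (auto simp: P_def)
    let ?W = "{x \<in> U. \<forall>q\<in>Q. \<epsilon> < N1 (x - q)}"
    have W: "openin T ?W" "?W \<noteq> {}" using avoid[OF Q(1,2) U(1)] U(2) by blast+
    then obtain y' where y': "y' \<in> ?W" by blast
    obtain U' V' where UV: "openin T U'" "closedin T V'" "y' \<in> U'" "U' \<subseteq> V'" "V' \<subseteq> ?W"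
      using regT W(1) y' unfolding neighbourhood_base_of_closedin[symmetric] neighbourhood_base_of by meson
    have cl: "T closure_of U' \<subseteq> ?W" using closure_of_minimal[OF UV(4,2)] UV(5) by blast
    let ?Q = "Q \<union> {y} \<union> (\<lambda>(a, b). a + b) ` (Q \<times> Q) \<union> (\<lambda>(j, a). fscale (d j) a) ` ({..n} \<times> Q)"
    have "y \<in> X1" using openin_subset[OF U(1)] topT F(2) U(2) by blast
    then have "?Q \<subseteq> X1" using Q(2) by (auto intro!: X1.add_mem X1.scale_mem)
    then have "P (Suc n) (U', ?Q, y')" using UV(1,3) Q by (simp add: P_def)
    moreover have "R n st (U', ?Q, y')" using cl by (auto simp: R_def st)
    ultimately show "\<exists>st'. P (Suc n) st' \<and> R n st st'" by blast
  qed
  then obtain f where f: "\<And>n. P n (f n)" "\<And>n. R n (f n) (f (Suc n))" by blast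
  define U where "U n = fst (f n)" for n
  define Q where "Q n = fst (snd (f n))" for n
  define y where "y n = snd (snd (f n))" for n
  have fn: "f n = (U n, Q n, y n)" for n by (simp add: U_def Q_def y_def)
  have y_U: "y n \<in> U n" and U_F: "U n \<subseteq> F" and Q_X1: "Q n \<subseteq> X1" and Q0: "0 \<in> Q n" for n
    using f(1)[of n] openin_subset[of T "U n"] topT by (auto simp: P_def fn)
  have U_Suc: "T closure_of U (Suc n) \<subseteq> U n"
    and far: "x \<in> T closure_of U (Suc n) \<Longrightarrow> q \<in> Q n \<Longrightarrow> \<epsilon> < N1 (x - q)"
    and Q_Suc: "Q n \<subseteq> Q (Suc n)" and y_Q: "y n \<in> Q (Suc n)"
    and Q_add: "a \<in> Q n \<Longrightarrow> b \<in> Q n \<Longrightarrow> a + b \<in> Q (Suc n)"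
    and Q_scale: "j \<le> n \<Longrightarrow> a \<in> Q n \<Longrightarrow> fscale (d j) a \<in> Q (Suc n)" for n x q a b j
    using f(2)[of n] by (auto simp: R_def fn)
  have Q_mono: "Q m \<subseteq> Q n" if "m \<le> n" for m n
    using lift_Suc_mono_le[of Q, OF Q_Suc that] .
  have U_sub: "U n \<subseteq> T closure_of U n" for n using U_F topT by (intro closure_of_subset) simp
  have U_mono: "U n \<subseteq> U m" if "m \<le> n" for m n
    by (rule lift_Suc_antimono_le[of U, OF _ that]) (use U_sub U_Suc in blast)
  have y_F: "y n \<in> F" for n using y_U U_F by blast
  obtain p where "p \<in> topspace T" and p: "\<And>n. p \<in> T closure_of (y ` {n..})"
    by (rule compact_space_sequence_cluster[OF compactT, of y]) (use y_F topT in \<open>auto intro: that\<close>)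
  have p_far: "\<epsilon> < N1 (p - q)" if "q \<in> Q n" for n q
  proof (rule far[OF _ that])
    have "y ` {Suc n..} \<subseteq> U (Suc n)" using y_U U_mono by force
    then show "p \<in> T closure_of U (Suc n)"
      using p[of "Suc n"] closure_of_mono by blast
  qed
  have p_F: "p \<in> F" using \<open>p \<in> topspace T\<close> topT by simp
  then have p1: "p \<in> X1" using F(2) by blast
  have p_closure: "p \<in> closure (range y)"
    using p[of 0] closure_of_subtopology_subset[of euclidean F "range y"]
    unfolding T_def atLeast_0 by auto
  \<comment> \<open>The norm closure of the union of the \<open>Q n\<close>. It is a subspace
    because the \<open>Q n\<close> absorb sums and dense scalar multiples. It contains all
    \<open>y n\<close> but stays at distance at least \<open>\<epsilon> / 2\<close> from their
    cluster point \<open>p\<close>.\<close>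
  define G where "G = {x \<in> X1. \<forall>e>0. \<exists>n. \<exists>q\<in>Q n. N1 (x - q) < e}"
  have Q_G: "Q n \<subseteq> G" for n
  proof
    fix q assume q: "q \<in> Q n"
    have "N1 (q - q) < e" if "0 < e" for e using that by (simp add: X1.N_zero)
    then show "q \<in> G" using q Q_X1 unfolding G_def by blast
  qed
  have subG: "fn.subspace G"
  proof (rule fn.subspaceI)
    show "0 \<in> G" using Q0 Q_G by blast
    fix a b assume ab: "a \<in> G" "b \<in> G"
    then have ab1: "a \<in> X1" "b \<in> X1" by (auto simp: G_def)
    show "a + b \<in> G"
      unfolding G_def
    proof (intro CollectI conjI allI impI)
      show "a + b \<in> X1" using ab1 by (rule X1.add_mem)
      fix e :: real assume e: "0 < e"
      then have "0 < e / 2" by simp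
      then obtain m k q r where q: "q \<in> Q m" "N1 (a - q) < e / 2" and r: "r \<in> Q k" "N1 (b - r) < e / 2"
        using ab unfolding G_def by blast
      have qr: "q \<in> Q (max m k)" "r \<in> Q (max m k)"
        using Q_mono[of m "max m k"] Q_mono[of k "max m k"] q(1) r(1) by auto
      have "N1 ((a + b) - (q + r)) = N1 ((a - q) + (b - r))" by (simp add: algebra_simps)
      also have "\<dots> \<le> N1 (a - q) + N1 (b - r)"
        using ab1 qr Q_X1 by (intro X1.N_add X1.diff_mem) auto
      also have "\<dots> < e" using q r by simp
      finally show "\<exists>n. \<exists>q\<in>Q n. N1 (a + b - q) < e" using Q_add[OF qr] by blast
    qed
  next
    fix c a assume a: "a \<in> G"
    then have a1: "a \<in> X1" by (auto simp: G_def)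
    show "fscale c a \<in> G"
      unfolding G_def
    proof (intro CollectI conjI allI impI)
      show "fscale c a \<in> X1" using a1 by (rule X1.scale_mem)
      fix e :: real assume e: "0 < e"
      \<comment> \<open>The scalar \<open>d j\<close> is chosen first, with tolerance governed by
        \<open>h\<close>. Only then is \<open>q\<close> chosen, with a tolerance depending on
        \<open>d j\<close> through \<open>k\<close>. Each error costs at most \<open>e / 2\<close>,
        and the added 1 avoids division by 0.\<close>
      define h where "h = N1 a + 1"
      have h: "0 < h" "N1 a \<le> h" using X1.N_nonneg[OF a1] by (auto simp: h_def)
      obtain j where j: "norm (c - d j) < e / (2 * h)" using d[of "e / (2 * h)" c] e h by auto
      define k where "k = norm (d j) + 1"
      have dj: "0 < k" by (simp add: k_def add_nonneg_pos)
      have "0 < e / (2 * k)" using e dj by simp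
      then obtain m q where q: "q \<in> Q m" "N1 (a - q) < e / (2 * k)"
        using a unfolding G_def by blast
      have q1: "q \<in> X1" using q Q_X1 by blast
      have aq: "a - q \<in> X1" using a1 q1 by (rule X1.diff_mem)
      have "fscale c a - fscale (d j) q = fscale (c - d j) a + fscale (d j) (a - q)"
        by (simp add: fscale_def fun_eq_iff algebra_simps)
      then have "N1 (fscale c a - fscale (d j) q) \<le> N1 (fscale (c - d j) a) + N1 (fscale (d j) (a - q))"
        using X1.N_add[OF X1.scale_mem[OF a1] X1.scale_mem[OF aq]] by simp
      also have "\<dots> = norm (c - d j) * N1 a + norm (d j) * N1 (a - q)"
        using X1.N_scale[OF a1] X1.N_scale[OF aq] by simp
      finally have le: "N1 (fscale c a - fscale (d j) q) \<le> norm (c - d j) * N1 a + norm (d j) * N1 (a - q)" .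
      have "norm (c - d j) * N1 a \<le> e / (2 * h) * h"
        using j h X1.N_nonneg[OF a1] e by (intro mult_mono) auto
      also have "\<dots> = e / 2" using h by simp
      finally have le1: "norm (c - d j) * N1 a \<le> e / 2" .
      have "norm (d j) * N1 (a - q) \<le> norm (d j) * (e / (2 * k))"
        using q by (intro mult_left_mono) auto
      also have "\<dots> < k * (e / (2 * k))"
        using e dj by (intro mult_strict_right_mono) (auto simp: k_def)
      also have "\<dots> = e / 2" using dj by simp
      finally have "N1 (fscale c a - fscale (d j) q) < e" using le le1 by linarith
      moreover have "fscale (d j) q \<in> Q (Suc (max m j))"
        using Q_mono[of m "max m j"] q(1) by (intro Q_scale) auto
      ultimately show "\<exists>n. \<exists>q\<in>Q n. N1 (fscale c a - q) < e" by blast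
    qed
  qed
  have far_G: "\<epsilon> / 2 \<le> N1 (p - g)" if g: "g \<in> G" for g
  proof -
    have "0 < \<epsilon> / 2" using \<epsilon> by simp
    then obtain n q where q: "q \<in> Q n" "N1 (g - q) < \<epsilon> / 2" using g unfolding G_def by blast
    have "\<epsilon> < N1 (p - q)" by (rule p_far[OF q(1)])
    also have "\<dots> \<le> N1 (p - g) + N1 (g - q)"
      using p1 g q Q_X1 by (intro X1.N_triangle) (auto simp: G_def)
    finally show ?thesis using q by simp
  qed
  have "G \<subseteq> X1" by (auto simp: G_def)
  moreover have "0 < \<epsilon> / 2" using \<epsilon> by simp
  ultimately obtain \<Phi> where \<Phi>: "\<Phi> \<in> X2" "\<And>g. g \<in> G \<Longrightarrow> \<Phi> g = 0" "\<Phi> p \<noteq> 0"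
    by (rule separating_functional[OF subG _ p1 _ far_G]) (assumption, rule that)
  obtain C where C: "\<And>\<phi>. \<phi> \<in> F \<Longrightarrow> N1 \<phi> \<le> C"
    by (rule weak_star_compact_norm_bounded[OF F(1,2)]) (rule that)
  have yF: "range y \<subseteq> F" using y_F by blast
  \<comment> \<open>\<open>p\<close> is only a weak-star cluster point of the sequence, but
    \<open>weak_closure\<close> lets it inherit the zeros of the bidual functional
    \<open>\<Phi>\<close>, which separates \<open>p\<close> from \<open>G\<close>.\<close>
  have "\<Phi> p = 0"
  proof (rule weak_closure[OF _ _ F(2) _ p_closure radius_attained[OF p_F] \<Phi>(1)])
    show "range y \<subseteq> X1" using yF F(2) by blast
    show "N1 a \<le> C" if "a \<in> range y" for a using that yF C by blast
    show "N1 (a - z) \<le> \<rho>" if "a \<in> range y" "z \<in> F" for a z using that yF radius by blast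
    show "\<Phi> a = 0" if "a \<in> range y" for a using that y_Q Q_G \<Phi>(2) by blast
  qed
  then show False using \<Phi>(3) by simp
qed

end

section \<open>Fixed points of nonexpansive systems\<close>

lemma (in normed_carrier)
  assumes "finite J" "\<And>j. j \<in> J \<Longrightarrow> g j \<in> V"
  shows sum_mem: "(\<Sum>j\<in>J. g j) \<in> V" and N_sum: "N (\<Sum>j\<in>J. g j) \<le> (\<Sum>j\<in>J. N (g j))"
proof -
  have "(\<Sum>j\<in>J. g j) \<in> V \<and> N (\<Sum>j\<in>J. g j) \<le> (\<Sum>j\<in>J. N (g j))"
    using assms
  proof (induction rule: finite_induct)
    case (insert j J)
    then show ?case using N_add[of "g j" "\<Sum>j\<in>J. g j"] by (simp add: add_mem)
  qed (simp add: N_zero zero_mem)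
  then show "(\<Sum>j\<in>J. g j) \<in> V" "N (\<Sum>j\<in>J. g j) \<le> (\<Sum>j\<in>J. N (g j))" by blast+
qed

lemma convex_functionals_average:
  fixes K :: "('v \<Rightarrow> 'k::real_normed_field) set"
  assumes K: "convex_functionals K" and "finite I" "I \<noteq> {}" "\<And>s. s \<in> I \<Longrightarrow> f s \<in> K"
  shows "fscale (of_real (1 / real (card I))) (\<Sum>s\<in>I. f s) \<in> K"
  using assms(2-)
proof (induction rule: finite_ne_induct)
  case (singleton s)
  then show ?case by (simp add: fscale_def)
next
  case (insert s I)
  let ?n = "real (card I)"
  have n: "0 < ?n" using insert by (simp add: card_gt_0_iff)
  let ?u = "?n / (?n + 1)"
  have u: "0 \<le> ?u" "?u \<le> 1" "1 - ?u = 1 / (?n + 1)" using n by (auto simp: field_simps)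
  have "fscale (of_real ?u) (fscale (of_real (1 / ?n)) (\<Sum>t\<in>I. f t)) + fscale (of_real (1 - ?u)) (f s) \<in> K"
    using K insert u(1,2) unfolding convex_functionals_def by blast
  also have "fscale (of_real ?u) (fscale (of_real (1 / ?n)) (\<Sum>t\<in>I. f t)) =
      fscale (of_real (1 / (?n + 1))) (\<Sum>t\<in>I. f t)"
    using n by (simp add: fn.scale_scale flip: of_real_mult)
  also have "fscale (of_real (1 / (?n + 1))) (\<Sum>t\<in>I. f t) + fscale (of_real (1 - ?u)) (f s) =
      fscale (of_real (1 / (?n + 1))) (\<Sum>t\<in>insert s I. f t)"
    unfolding u(3) using insert by (simp add: fn.scale_right_distrib add.commute)
  also have "?n + 1 = real (card (insert s I))" using insert by simp
  finally show ?case .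
qed

text \<open>The five alternatives of the theorem have all been absorbed into the last assumption, an
  invariant functional along every orbit.\<close>

locale nonexpansive_system = M_embedded_space smul
  for smul :: "'k::real_or_complex \<Rightarrow> 'a::banach \<Rightarrow> 'a" +
  fixes K :: "('a \<Rightarrow> 'k) set" and act :: "'s::semigroup_mult \<Rightarrow> ('a \<Rightarrow> 'k) \<Rightarrow> ('a \<Rightarrow> 'k)"
  assumes compact_K: "compact K" and K_dual: "K \<subseteq> X1"
    and act_in_K: "x \<in> K \<Longrightarrow> act s x \<in> K"
    and continuous_act: "continuous_map (top_of_set K) (top_of_set K) (act s)"
    and act_mult: "x \<in> K \<Longrightarrow> act s (act t x) = act (s * t) x"
    and nonexpansive: "x \<in> K \<Longrightarrow> y \<in> K \<Longrightarrow> N1 (act s x - act s y) \<le> N1 (x - y)"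
    and invariant_mean_exists: "x \<in> K \<Longrightarrow> \<exists>M. invariant_mean (top_of_set K) act x M"
begin

abbreviation "T \<equiv> top_of_set K"

lemma compact_space_T: "compact_space T"
  using compact_K by (simp add: compact_space_subtopology)

lemma Hausdorff_space_T: "Hausdorff_space T"
  by (rule Hausdorff_space_subtopology[OF Hausdorff_space_euclidean_fun])

lemma closedin_ball: "q \<in> X1 \<Longrightarrow> 0 \<le> r \<Longrightarrow> closedin T {x \<in> K. N1 (x - q) \<le> r}"
proof -
  assume "q \<in> X1" "0 \<le> r"
  then have "closedin T (K \<inter> {\<phi>. \<phi> \<in> X1 \<and> N1 (\<phi> - q) \<le> r})"
    by (intro closedin_closed_Int closed_dual_ball)
  moreover have "K \<inter> {\<phi>. \<phi> \<in> X1 \<and> N1 (\<phi> - q) \<le> r} = {x \<in> K. N1 (x - q) \<le> r}" using K_dual by blast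
  ultimately show ?thesis by simp
qed

text \<open>One Zorn argument for both minimal sets: \<open>P\<close> is convexity for
  \<open>K0\<close> and the trivial property for \<open>F\<close>.\<close>

lemma minimal_closed_invariant:
  assumes L: "closedin T L" "L \<noteq> {}" "\<And>s x. x \<in> L \<Longrightarrow> act s x \<in> L" "P L"
    and P: "\<And>\<C>. \<C> \<noteq> {} \<Longrightarrow> \<forall>A\<in>\<C>. P A \<Longrightarrow> P (\<Inter>\<C>)"
  obtains F where "closedin T F" "F \<noteq> {}" "\<And>s x. x \<in> F \<Longrightarrow> act s x \<in> F" "P F" "F \<subseteq> L"
    "\<And>G. closedin T G \<Longrightarrow> G \<noteq> {} \<Longrightarrow> G \<subseteq> F \<Longrightarrow> (\<And>s x. x \<in> G \<Longrightarrow> act s x \<in> G) \<Longrightarrow> P G \<Longrightarrow> G = F"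
proof -
  define \<A> where "\<A> = {A. closedin T A \<and> A \<noteq> {} \<and> (\<forall>s. \<forall>x\<in>A. act s x \<in> A) \<and> P A \<and> A \<subseteq> L}"
  have "\<A> \<noteq> {}" using L by (auto simp: \<A>_def)
  then obtain F where F: "F \<in> \<A>" "\<And>A. A \<in> \<A> \<Longrightarrow> A \<subseteq> F \<Longrightarrow> A = F"
  proof (rule minimal_set_Zorn)
    fix \<C> assume C: "\<C> \<noteq> {}" "\<C> \<subseteq> \<A>" "\<forall>A\<in>\<C>. \<forall>B\<in>\<C>. A \<subseteq> B \<or> B \<subseteq> A"
    have mem: "closedin T A" "A \<noteq> {}" "P A" "A \<subseteq> L" if "A \<in> \<C>" for A
      using that C(2) by (auto simp: \<A>_def)
    have inv: "act s x \<in> A" if "A \<in> \<C>" "x \<in> A" for A s x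
      using that C(2) by (auto simp: \<A>_def)
    have "\<Inter>\<C> \<noteq> {}"
      using mem by (intro compact_space_chain_Inter[OF compact_space_T _ C(3)]) blast
    moreover have "closedin T (\<Inter>\<C>)" using mem C(1) by (intro closedin_Inter) auto
    moreover have "P (\<Inter>\<C>)" using mem C(1) by (intro P) auto
    moreover have "\<Inter>\<C> \<subseteq> L" using mem C(1) by blast
    moreover have "act s x \<in> \<Inter>\<C>" if "x \<in> \<Inter>\<C>" for s x using that inv by blast
    ultimately have "\<Inter>\<C> \<in> \<A>" by (simp add: \<A>_def)
    then show "\<exists>L\<in>\<A>. \<forall>A\<in>\<C>. L \<subseteq> A" by blast
  qed (rule that)
  show thesis
  proof (rule that)
    show "closedin T F" "F \<noteq> {}" "P F" "F \<subseteq> L" and "\<And>s x. x \<in> F \<Longrightarrow> act s x \<in> F"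
      using F(1) by (auto simp: \<A>_def)
    then show "G = F" if "closedin T G" "G \<noteq> {}" "G \<subseteq> F" "\<And>s x. x \<in> G \<Longrightarrow> act s x \<in> G" "P G" for G
      using that by (intro F(2)) (auto simp: \<A>_def)
  qed
qed

lemma convex_Inter: "\<forall>A\<in>\<C>. convex_functionals A \<Longrightarrow> convex_functionals (\<Inter>\<C>)"
  unfolding convex_functionals_def by blast

lemma convex_ball:
  assumes "convex_functionals L" "L \<subseteq> K" "B \<subseteq> K"
  shows "convex_functionals {x \<in> L. \<forall>y\<in>B. N1 (x - y) \<le> r}"
  unfolding convex_functionals_def
proof (intro ballI allI impI CollectI conjI)
  fix x z and u :: real
  assume x: "x \<in> {x \<in> L. \<forall>y\<in>B. N1 (x - y) \<le> r}" and z: "z \<in> {x \<in> L. \<forall>y\<in>B. N1 (x - y) \<le> r}"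
    and u: "0 \<le> u \<and> u \<le> 1"
  show "fscale (of_real u) x + fscale (of_real (1 - u)) z \<in> L"
    using assms(1) x z u unfolding convex_functionals_def by blast
  fix y assume y: "y \<in> B"
  have mem: "x - y \<in> X1" "z - y \<in> X1" using x y z assms K_dual by (auto intro!: X1.diff_mem)
  have "fscale (of_real u) x + fscale (of_real (1 - u)) z - y =
      fscale (of_real u) (x - y) + fscale (of_real (1 - u)) (z - y)"
    by (simp add: fscale_def fun_eq_iff algebra_simps)
  then have "N1 (fscale (of_real u) x + fscale (of_real (1 - u)) z - y) \<le>
      N1 (fscale (of_real u) (x - y)) + N1 (fscale (of_real (1 - u)) (z - y))"
    using X1.N_add[OF X1.scale_mem[OF mem(1)] X1.scale_mem[OF mem(2)]] by simp
  also have "\<dots> = u * N1 (x - y) + (1 - u) * N1 (z - y)"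
    using u unfolding X1.N_scale[OF mem(1)] X1.N_scale[OF mem(2)] norm_of_real by simp
  also have "\<dots> \<le> u * r + (1 - u) * r"
    using u x y z by (intro add_mono mult_left_mono) auto
  finally show "N1 (fscale (of_real u) x + fscale (of_real (1 - u)) z - y) \<le> r"
    by (simp add: algebra_simps)
qed

theorem fixed_point_in_invariant_subset:
  assumes L: "closedin T L" "L \<noteq> {}" "\<And>s x. x \<in> L \<Longrightarrow> act s x \<in> L" "convex_functionals L"
  obtains x where "x \<in> L" "\<And>s. act s x = x"
proof -
  obtain K0 where K0: "closedin T K0" "K0 \<noteq> {}" "\<And>s x. x \<in> K0 \<Longrightarrow> act s x \<in> K0"
      "convex_functionals K0" "K0 \<subseteq> L"
    and K0_min: "\<And>G. closedin T G \<Longrightarrow> G \<noteq> {} \<Longrightarrow> G \<subseteq> K0 \<Longrightarrow>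
      (\<And>s x. x \<in> G \<Longrightarrow> act s x \<in> G) \<Longrightarrow> convex_functionals G \<Longrightarrow> G = K0"
    by (rule minimal_closed_invariant[of L convex_functionals, OF L convex_Inter]) (auto intro: that)
  obtain F where F: "closedin T F" "F \<noteq> {}" "\<And>s x. x \<in> F \<Longrightarrow> act s x \<in> F" "F \<subseteq> K0"
    and F_min: "\<And>G. closedin T G \<Longrightarrow> G \<noteq> {} \<Longrightarrow> G \<subseteq> F \<Longrightarrow>
      (\<And>s x. x \<in> G \<Longrightarrow> act s x \<in> G) \<Longrightarrow> G = F"
    by (rule minimal_closed_invariant[of K0 "\<lambda>_. True", OF K0(1-3)]) (auto intro: that)
  have K0_K: "K0 \<subseteq> K" using closedin_subset[OF K0(1)] by simp
  have F_K: "F \<subseteq> K" using F(4) K0_K by blast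
  have F_X1: "F \<subseteq> X1" and K0_X1: "K0 \<subseteq> X1" using F_K K0_K K_dual by auto
  obtain x0 where x0: "x0 \<in> F" using F(2) by blast
  obtain M where M: "invariant_mean T act x0 M" using invariant_mean_exists x0 F_K by blast
  interpret minimal_system T act F x0 M
    by unfold_locales
      (use compact_space_T Hausdorff_space_T continuous_act act_mult F F_min x0 M in auto)
  obtain C where C: "\<And>\<phi>. \<phi> \<in> K \<Longrightarrow> N1 \<phi> \<le> C"
    by (rule weak_star_compact_norm_bounded[OF compact_K K_dual]) (rule that)
  have diff_bound: "N1 (x - y) \<le> 2 * C" and diff_nonneg: "0 \<le> N1 (x - y)" if "x \<in> K" "y \<in> K" for x y
    using X1.N_add[of x "- y"] X1.N_minus[of y] X1.minus_mem[of y] C[OF that(1)] C[OF that(2)]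
      X1.N_nonneg[OF X1.diff_mem, of x y] that K_dual by (auto simp: subset_iff)
  define r where "r x = (SUP y\<in>F. N1 (x - y))" for x
  have r_bdd: "bdd_above ((\<lambda>y. N1 (x - y)) ` F)" if "x \<in> K0" for x
    using diff_bound that K0_K F_K by (intro bdd_aboveI2[of _ _ "2 * C"]) blast
  have r_upper: "N1 (x - y) \<le> r x" if "x \<in> K0" "y \<in> F" for x y
    unfolding r_def by (rule cSUP_upper[OF that(2) r_bdd[OF that(1)]])
  have r_least: "r x \<le> b" if "\<And>y. y \<in> F \<Longrightarrow> N1 (x - y) \<le> b" for x b
    unfolding r_def by (rule cSUP_least[OF F(2) that])
  have r_nonneg: "0 \<le> r x" if "x \<in> K0" for x
    using r_upper[OF that x0] diff_nonneg[of x x0] that K0_K F_K x0 by force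
  define \<rho> where "\<rho> = (INF x\<in>K0. r x)"
  have \<rho>_lower: "\<rho> \<le> r x" if "x \<in> K0" for x
    unfolding \<rho>_def by (rule cINF_lower[OF bdd_belowI2[of _ 0] that]) (rule r_nonneg)
  have \<rho>_nonneg: "0 \<le> \<rho>"
    unfolding \<rho>_def by (rule cINF_greatest[OF K0(2)]) (rule r_nonneg)
  \<comment> \<open>\<open>D 0\<close> is the Chebyshev centre. As the infimum \<rho> is not known
    to be attained, \<open>D 0\<close> is shown nonempty as the intersection of the nested closed
    sets \<open>D e\<close> with \<open>e > 0\<close>.\<close>
  define D where "D e = {x \<in> K0. \<forall>y\<in>F. N1 (x - y) \<le> \<rho> + e}" for e
  have D_closed: "closedin T (D e)" if "0 \<le> e" for e
  proof -
    have "D e = K0 \<inter> (\<Inter>y\<in>F. {x \<in> K. N1 (x - y) \<le> \<rho> + e})"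
      using K0_K F(2) by (auto simp: D_def)
    then show ?thesis
      using F F_X1 \<rho>_nonneg that K0(1) by (auto intro!: closedin_Int closedin_INT closedin_ball)
  qed
  have D_nonempty: "D e \<noteq> {}" if "0 < e" for e
  proof -
    have "\<exists>x\<in>K0. r x < \<rho> + e"
      using cInf_lessD[of "r ` K0" "\<rho> + e"] K0(2) that by (auto simp: \<rho>_def)
    then obtain x where "x \<in> K0" "r x < \<rho> + e" by blast
    then have "x \<in> D e" using r_upper by (fastforce simp: D_def)
    then show ?thesis by blast
  qed
  have "\<Inter>(D ` {0<..}) \<noteq> {}"
  proof (rule compact_space_chain_Inter[OF compact_space_T])
    show "\<forall>A\<in>D ` {0<..}. closedin T A \<and> A \<noteq> {}" using D_closed D_nonempty by auto
    have "D a \<subseteq> D b" if "a \<le> b" for a b using that by (fastforce simp: D_def)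
    then have "D a \<subseteq> D b \<or> D b \<subseteq> D a" for a b using linear[of a b] by blast
    then show "\<forall>A\<in>D ` {0<..}. \<forall>B\<in>D ` {0<..}. A \<subseteq> B \<or> B \<subseteq> A" by blast
  qed
  moreover have "\<Inter>(D ` {0<..}) \<subseteq> D 0"
  proof
    fix x assume x: "x \<in> \<Inter>(D ` {0<..})"
    have "x \<in> K0" using INT_D[OF x, of 1] by (simp add: D_def)
    moreover have "N1 (x - y) \<le> \<rho>" if y: "y \<in> F" for y
    proof (rule field_le_epsilon)
      fix e :: real assume "0 < e"
      then show "N1 (x - y) \<le> \<rho> + e" using INT_D[OF x, of e] y by (simp add: D_def)
    qed
    ultimately show "x \<in> D 0" by (simp add: D_def)
  qed
  ultimately have "D 0 \<noteq> {}" by blast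
  moreover have "act s x \<in> D 0" if x: "x \<in> D 0" for s x
  proof -
    have "N1 (act s x - y) \<le> \<rho>" if y: "y \<in> F" for y
    proof -
      \<comment> \<open>Surjectivity of \<open>act s\<close> on \<open>F\<close> is what makes the
        centre invariant: every distance to \<open>y\<close> becomes a distance between two images
        under \<open>act s\<close>.\<close>
      obtain z where z: "z \<in> F" "y = act s z" using act_image[of s] y by blast
      have "N1 (act s x - act s z) \<le> N1 (x - z)"
        using x z(1) K0_K F_K by (intro nonexpansive) (auto simp: D_def)
      also have "\<dots> \<le> \<rho>" using x z(1) by (simp add: D_def)
      finally show ?thesis using z by simp
    qed
    then show ?thesis using x K0(3) by (simp add: D_def)
  qed
  moreover have "convex_functionals (D 0)"
    unfolding D_def using K0(4) K0_K F_K by (rule convex_ball)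
  moreover have "D 0 \<subseteq> K0" by (auto simp: D_def)
  ultimately have D_eq: "D 0 = K0" using D_closed[of 0] by (intro K0_min) auto
  have radius: "N1 (x - y) \<le> \<rho>" if "x \<in> K0" "y \<in> F" for x y
  proof -
    have "x \<in> D 0" using that D_eq by simp
    then show ?thesis using that by (simp add: D_def)
  qed
  have radius_attained: "\<exists>y\<in>F. \<rho> - e < N1 (x - y)" if "x \<in> K0" "0 < e" for x e
  proof (rule ccontr)
    assume "\<not> ?thesis"
    then have "r x \<le> \<rho> - e" by (intro r_least) force
    then show False using \<rho>_lower[OF that(1)] that(2) by simp
  qed
  have "\<rho> = 0"
  proof (rule ccontr)
    assume "\<rho> \<noteq> 0"
    then have \<rho>: "0 < \<rho>" using \<rho>_nonneg by simp
    have "compact F"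
      using closedin_compact[OF compact_K] F(1) by blast
    \<comment> \<open>With \<open>\<rho> / 16\<close> around \<open>q\<close>, the set
      \<open>U\<close> has diameter at most \<open>\<rho> / 8\<close>. Its translates then lie in
      closed balls of radius \<open>\<rho> / 8\<close>, and centres of intersecting balls are at
      most \<open>\<rho> / 4\<close> apart.\<close>
    then obtain q U where q: "q \<in> X1" and U: "openin (top_of_set F) U" "U \<noteq> {}"
      and Uq: "\<And>x. x \<in> U \<Longrightarrow> N1 (x - q) \<le> \<rho> / 16"
    proof (rule small_open_subset[of F \<rho> "\<rho> / 16"])
      show "N1 (x - y) \<le> \<rho>" if "x \<in> F" "y \<in> F" for x y using radius that F(4) by blast
      show "\<exists>y\<in>F. \<rho> - e < N1 (x - y)" if "x \<in> F" "0 < e" for x e using radius_attained that F(4) by blast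
    qed (use F_X1 F(2) \<rho> in \<open>auto intro: that\<close>)
    obtain W where W: "openin T W" "U = W \<inter> F"
      using U(1) F_K by (auto simp: openin_open)
    obtain u where u: "u \<in> W" "u \<in> F" using U(2) W(2) by blast
    have uX: "u \<in> X1" using u F_X1 by blast
    have actX: "act s u \<in> X1" for s using F(3) u F_X1 by blast
    define B where "B s = {x \<in> K. N1 (x - act s u) \<le> \<rho> / 8}" for s
    obtain I where I: "finite I" "\<And>t. \<exists>s\<in>I. B t \<inter> B s \<noteq> {}"
    proof (rule finitely_many_translates_meet_all[OF W(1)])
      show "W \<inter> F \<noteq> {}" using u by blast
      show "closedin T (B s)" for s unfolding B_def using actX \<rho> by (intro closedin_ball) auto
      fix s y assume y: "y \<in> W \<inter> F"
      have yX: "y \<in> X1" using y F_X1 by blast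
      have "N1 (y - u) \<le> N1 (y - q) + N1 (q - u)" using X1.N_triangle[OF yX q uX] .
      also have "\<dots> \<le> \<rho> / 16 + \<rho> / 16"
        using Uq[of y] Uq[of u] y u W(2) X1.N_minus_commute[OF q uX] by (intro add_mono) auto
      finally have "N1 (act s y - act s u) \<le> \<rho> / 8"
        using nonexpansive[of y u s] y u F_K by force
      then show "act s y \<in> B s" using y F(3) F_K by (auto simp: B_def)
    qed (rule that)
    have I_ne: "I \<noteq> {}" using I(2) by blast
    \<comment> \<open>The centres indexed by \<open>I\<close> are a \<open>\<rho> / 4\<close> net
      for the orbit of \<open>u\<close>. Closedness of the balls carries this over to the orbit
      closure, which is \<open>F\<close>.\<close>
    have cover: "\<exists>s\<in>I. N1 (y - act s u) \<le> \<rho> / 4" if y: "y \<in> F" for y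
    proof -
      let ?E = "\<Union>s\<in>I. {x \<in> K. N1 (x - act s u) \<le> \<rho> / 4}"
      have "closedin T {x \<in> K. N1 (x - act s u) \<le> \<rho> / 4}" for s
        by (rule closedin_ball[OF actX]) (use \<rho> in simp)
      then have "closedin T ?E" using I(1) by (intro closedin_Union) auto
      moreover have "range (\<lambda>s. act s u) \<subseteq> ?E"
      proof
        fix x assume "x \<in> range (\<lambda>s. act s u)"
        then obtain t where t: "x = act t u" by blast
        obtain s z where s: "s \<in> I" "z \<in> B t" "z \<in> B s" using I(2)[of t] by blast
        have zX: "z \<in> X1" using s(2) K_dual by (auto simp: B_def)
        have "N1 (act t u - act s u) \<le> N1 (act t u - z) + N1 (z - act s u)"
          using X1.N_triangle[OF actX zX actX] .
        also have "\<dots> \<le> \<rho> / 8 + \<rho> / 8"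
          using s(2,3) X1.N_minus_commute[OF actX zX] by (intro add_mono) (simp_all add: B_def)
        finally have "N1 (act t u - act s u) \<le> \<rho> / 4" by simp
        moreover have "act t u \<in> K" using F(3) u(2) F_K by blast
        ultimately show "x \<in> ?E" using s(1) t by blast
      qed
      ultimately have "T closure_of range (\<lambda>s. act s u) \<subseteq> ?E" by (intro closure_of_minimal)
      then have "y \<in> ?E" using orbit_dense[OF u(2)] y by auto
      then show ?thesis by blast
    qed
    let ?n = "real (card I)"
    have n: "0 < ?n" using I(1) I_ne by (simp add: card_gt_0_iff)
    define c where "c = fscale (of_real (1 / ?n)) (\<Sum>s\<in>I. act s u)"
    have c: "c \<in> K0"
      unfolding c_def by (rule convex_functionals_average[OF K0(4) I(1) I_ne]) (use F u in blast)
    \<comment> \<open>Among the \<open>n\<close> distances averaged, one is at most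
      \<open>\<rho> / 4\<close> and the others at most \<rho>. The gain does not depend on
      \<open>y\<close>, so the radius at \<open>c\<close> falls strictly below \<rho>.\<close>
    have "N1 (c - y) \<le> \<rho> - 3 / 4 * \<rho> / ?n" if y: "y \<in> F" for y
    proof -
      have yX: "y \<in> X1" using y F_X1 by blast
      obtain s where s: "s \<in> I" "N1 (y - act s u) \<le> \<rho> / 4" using cover[OF y] by blast
      have dX: "act t u - y \<in> X1" for t by (rule X1.diff_mem[OF actX yX])
      define w where "w = (\<Sum>t\<in>I. act t u - y)"
      have w: "w \<in> X1" unfolding w_def by (rule X1.sum_mem[OF I(1) dX])
      have "w = (\<Sum>t\<in>I. act t u) - fscale (of_real ?n) y"
        unfolding w_def sum_subtractf by (simp only: fn.sum_constant_scale of_real_of_nat_eq)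
      then have "c - y = fscale (of_real (1 / ?n)) w"
        unfolding c_def using n by (simp add: fn.scale_right_diff_distrib flip: of_real_mult)
      then have "N1 (c - y) = N1 w / ?n"
        using X1.N_scale[OF w, of "of_real (1 / ?n)"] by (simp add: norm_divide)
      moreover have "N1 w \<le> \<rho> / 4 + (?n - 1) * \<rho>"
      proof -
        have "N1 w \<le> (\<Sum>t\<in>I. N1 (act t u - y))"
          unfolding w_def by (rule X1.N_sum[OF I(1) dX])
        also have "\<dots> = N1 (act s u - y) + (\<Sum>t\<in>I - {s}. N1 (act t u - y))"
          using I(1) s(1) by (rule sum.remove)
        also have "\<dots> \<le> \<rho> / 4 + (\<Sum>t\<in>I - {s}. \<rho>)"
        proof (intro add_mono sum_mono)
          show "N1 (act s u - y) \<le> \<rho> / 4" using s(2) X1.N_minus_commute[OF actX yX] by simp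
          show "N1 (act t u - y) \<le> \<rho>" for t using u F(3,4) y by (intro radius) auto
        qed
        also have "\<dots> = \<rho> / 4 + (?n - 1) * \<rho>"
          using I(1) s(1) n by (simp add: of_nat_diff card_Diff_singleton)
        finally show ?thesis .
      qed
      ultimately have "N1 (c - y) \<le> (\<rho> / 4 + (?n - 1) * \<rho>) / ?n" using n by (simp add: divide_right_mono)
      also have "\<dots> = \<rho> - 3 / 4 * \<rho> / ?n" using n by (simp add: field_simps)
      finally show ?thesis .
    qed
    moreover have "0 < 3 / 4 * \<rho> / ?n" using \<rho> n by simp
    ultimately show False using radius_attained[OF c] by force
  qed
  have "act s x0 = x0" for s
  proof -
    have "N1 (act s x0 - x0) \<le> 0" using radius[of "act s x0" x0] x0 F(3,4) \<open>\<rho> = 0\<close> by auto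
    then have "act s x0 - x0 = 0"
      using x0 F(3) F_X1 by (intro X0.dual_eq_zero X1.diff_mem) auto
    then show ?thesis by simp
  qed
  then show thesis using that[of x0] x0 F(4) K0(5) by blast
qed

end

section \<open>Bruck's retraction onto the fixed points\<close>

context nonexpansive_system
begin

text \<open>Bruck's argument: a map \<open>r\<close> that is minimal, with respect to the distances between its values,
  among the nonexpansive self-maps fixing all fixed points must take values in the fixed point set.\<close>

theorem fixed_points_nonexpansive_retract:
  assumes convex: "convex_functionals K" and "K \<noteq> {}"
  shows "fixed_points K act \<noteq> {} \<and>
    (\<exists>r. r ` K = fixed_points K act \<and> (\<forall>x\<in>K. r (r x) = r x) \<and> nonexpansive_on N1 K r)"
proof
  define F where "F = fixed_points K act"
  have F_iff: "x \<in> F \<longleftrightarrow> x \<in> K \<and> (\<forall>s. act s x = x)" for x by (simp add: F_def fixed_points_def)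
  have "closedin T K" using closedin_topspace[of T] by simp
  then show "fixed_points K act \<noteq> {}"
    by (rule fixed_point_in_invariant_subset[OF _ \<open>K \<noteq> {}\<close> act_in_K convex]) (auto simp: fixed_points_def)
  define PT where "PT = product_topology (\<lambda>_. T) K"
  have top_PT: "topspace PT = (K \<rightarrow>\<^sub>E K)" by (simp add: PT_def)
  have compact_PT: "compact_space PT"
    using compact_space_T by (simp add: PT_def compact_space_product_topology)
  have proj: "continuous_map PT T (\<lambda>g. g x)" if "x \<in> K" for x
    unfolding PT_def using that by (rule continuous_map_product_projection)
  have proj_eval: "continuous_map PT euclidean (\<lambda>g. g x v)" if "x \<in> K" for x v
  proof -
    have "continuous_map T euclidean (\<lambda>\<phi> :: 'a \<Rightarrow> 'k. \<phi> v)"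
      by (simp add: continuous_on_subset[OF continuous_on_product_coordinates])
    from continuous_map_compose[OF proj[OF that] this] show ?thesis by (simp add: comp_def)
  qed
  \<comment> \<open>The dual norm is only lower semicontinuous in this topology, which is what
    closedness of a sublevel set requires: the norm bound is a family of conditions on
    evaluations.\<close>
  have closed_le: "closedin PT {g \<in> topspace PT. N1 (g x - g y) \<le> b}"
    if xy: "x \<in> K" "y \<in> K" and b: "0 \<le> b" for x y b
  proof -
    have "{g \<in> topspace PT. N1 (g x - g y) \<le> b} =
        (\<Inter>v. {g \<in> topspace PT. g x v - g y v \<in> cball 0 (b * norm v)})"
    proof -
      have "N1 (g x - g y) \<le> b \<longleftrightarrow> (\<forall>v. norm (g x v - g y v) \<le> b * norm v)" if "g \<in> topspace PT" for g
        using X0.dual_norm_le_iff[OF X1.diff_mem b, of "g x" "g y"] that xy K_dual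
        by (auto simp: top_PT PiE_iff subset_iff)
      then show ?thesis by auto
    qed
    moreover have "closedin PT {g \<in> topspace PT. g x v - g y v \<in> cball 0 (b * norm v)}" for v
      by (intro closedin_continuous_map_preimage[of _ euclidean] continuous_map_diff proj_eval xy) simp
    ultimately show ?thesis by (auto intro!: closedin_INT)
  qed
  \<comment> \<open>The maps that fix \<open>F\<close> pointwise and separate points no more than
    \<open>f\<close> does. For the identity these are all nonexpansive self-maps fixing
    \<open>F\<close>.\<close>
  define down where "down f = {g \<in> topspace PT. (\<forall>x\<in>F. g x = x) \<and>
      (\<forall>x\<in>K. \<forall>y\<in>K. N1 (g x - g y) \<le> N1 (f x - f y))}" for f
  define \<F> where "\<F> = down (\<lambda>x\<in>K. x)"
  have \<F>_iff: "g \<in> \<F> \<longleftrightarrow> g \<in> topspace PT \<and> (\<forall>x\<in>F. g x = x) \<and>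
      (\<forall>x\<in>K. \<forall>y\<in>K. N1 (g x - g y) \<le> N1 (x - y))" for g
    by (simp add: \<F>_def down_def)
  have FK: "F \<subseteq> K" by (auto simp: F_iff)
  have \<F>_K: "f x \<in> K" if "f \<in> \<F>" "x \<in> K" for f x
    using that by (auto simp: \<F>_iff top_PT)
  have \<F>_ne: "N1 (f x - f y) \<le> N1 (x - y)" if "f \<in> \<F>" "x \<in> K" "y \<in> K" for f x y
    using that by (simp add: \<F>_iff)
  have \<F>_fix: "f x = x" if "f \<in> \<F>" "x \<in> F" for f x
    using that by (simp add: \<F>_iff)
  have down_closed: "closedin PT (down f)" if f: "\<And>x. x \<in> K \<Longrightarrow> f x \<in> K" for f
  proof -
    have nonneg: "0 \<le> N1 (f x - f y)" if "x \<in> K" "y \<in> K" for x y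
      using f that K_dual by (intro X1.N_nonneg X1.diff_mem) auto
    have cl_fix: "closedin PT {g \<in> topspace PT. g x \<in> {x}}" if "x \<in> F" for x
      using that FK
      by (intro closedin_continuous_map_preimage[of _ T] proj closedin_Hausdorff_singleton[OF Hausdorff_space_T]) auto
    have "down f = topspace PT \<inter> (\<Inter>x\<in>F. {g \<in> topspace PT. g x \<in> {x}}) \<inter>
        (\<Inter>x\<in>K. \<Inter>y\<in>K. {g \<in> topspace PT. N1 (g x - g y) \<le> N1 (f x - f y)})"
      using \<open>K \<noteq> {}\<close> by (auto simp: down_def)
    also have "closedin PT \<dots>"
    proof (rule closedin_Int)
      show "closedin PT (topspace PT \<inter> (\<Inter>x\<in>F. {g \<in> topspace PT. g x \<in> {x}}))"
        using cl_fix by (cases "F = {}") (auto intro!: closedin_Int closedin_INT)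
      show "closedin PT (\<Inter>x\<in>K. \<Inter>y\<in>K. {g \<in> topspace PT. N1 (g x - g y) \<le> N1 (f x - f y)})"
        using \<open>K \<noteq> {}\<close> closed_le nonneg by (intro closedin_INT) auto
    qed
    finally show ?thesis .
  qed
  have down_trans: "down g \<subseteq> down f" if "g \<in> down f" for f g
    using that unfolding down_def by (blast intro: order_trans)
  have down_self: "f \<in> down f" if "f \<in> \<F>" for f
    using that by (simp add: down_def \<F>_iff)
  have down_sub: "down f \<subseteq> \<F>" if "f \<in> \<F>" for f
    using that unfolding \<F>_def by (rule down_trans)
  have id_mem: "(\<lambda>x\<in>K. x) \<in> \<F>" using FK by (auto simp: \<F>_iff top_PT)
  \<comment> \<open>Comparison of distances is only a preorder on maps, so a minimal map is found as
    a generator of an inclusion-minimal set \<open>down r\<close>.\<close>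
  have "down ` \<F> \<noteq> {}" using id_mem by blast
  then obtain D where D: "D \<in> down ` \<F>" and D_min: "\<And>A. A \<in> down ` \<F> \<Longrightarrow> A \<subseteq> D \<Longrightarrow> A = D"
  proof (rule minimal_set_Zorn)
    fix \<C> assume C: "\<C> \<noteq> {}" "\<C> \<subseteq> down ` \<F>" "\<forall>A\<in>\<C>. \<forall>B\<in>\<C>. A \<subseteq> B \<or> B \<subseteq> A"
    have "\<forall>A\<in>\<C>. closedin PT A \<and> A \<noteq> {}"
    proof
      fix A assume "A \<in> \<C>"
      then obtain f where f: "f \<in> \<F>" "A = down f" using C(2) by blast
      then show "closedin PT A \<and> A \<noteq> {}"
        using down_closed[of f] down_self[of f] \<F>_K[of f] by blast
    qed
    then have "\<Inter>\<C> \<noteq> {}" using C(3) by (rule compact_space_chain_Inter[OF compact_PT])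
    then obtain g where g: "\<And>A. A \<in> \<C> \<Longrightarrow> g \<in> A" by blast
    have "g \<in> \<F>" using g C(1,2) down_sub by blast
    moreover have "down g \<subseteq> A" if "A \<in> \<C>" for A
      using g[OF that] that C(2) down_trans by blast
    ultimately show "\<exists>L\<in>down ` \<F>. \<forall>A\<in>\<C>. L \<subseteq> A" by blast
  qed (rule that)
  then obtain r where r: "r \<in> \<F>" and r_min: "\<And>g. g \<in> down r \<Longrightarrow> r \<in> down g"
  proof -
    obtain r where r: "r \<in> \<F>" "D = down r" using D by blast
    have "r \<in> down g" if "g \<in> down r" for g
    proof -
      have "down g = D" using that r down_sub down_trans by (intro D_min) auto
      then show ?thesis using down_self[OF r(1)] r(2) by simp
    qed
    then show ?thesis using that[of r] r(1) by blast
  qed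
  have r_F: "r x \<in> F" if x: "x \<in> K" for x
  proof -
    define a where "a = r x"
    have a: "a \<in> K" unfolding a_def using r x by (rule \<F>_K)
    \<comment> \<open>The possible images of \<open>a = r x\<close> form a closed convex set that is
      invariant because \<open>\<F>\<close> is closed under composition with the action. It
      therefore contains a fixed point \<open>z = f a\<close>.\<close>
    define L where "L = (\<lambda>f. f a) ` \<F>"
    have LK: "L \<subseteq> K" using \<F>_K a by (auto simp: L_def)
    have "closedin PT \<F>" unfolding \<F>_def by (rule down_closed) simp
    then have "compactin PT \<F>" by (rule closedin_compact_space[OF compact_PT])
    then have "compactin T L" unfolding L_def by (rule image_compactin[OF _ proj[OF a]])
    then have "closedin T L" by (rule compactin_imp_closedin[OF Hausdorff_space_T])
    moreover have "L \<noteq> {}" using id_mem by (auto simp: L_def)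
    moreover have "act s z \<in> L" if "z \<in> L" for s z
    proof -
      obtain f where f: "f \<in> \<F>" "z = f a" using \<open>z \<in> L\<close> by (auto simp: L_def)
      have "N1 (act s (f y) - act s (f z)) \<le> N1 (y - z)" if "y \<in> K" "z \<in> K" for y z
        using nonexpansive[OF \<F>_K[OF f(1) that(1)] \<F>_K[OF f(1) that(2)]] \<F>_ne[OF f(1) that] by (rule order_trans)
      then have "(\<lambda>y\<in>K. act s (f y)) \<in> \<F>"
        using f(1) FK act_in_K \<F>_K[OF f(1)] \<F>_fix[OF f(1)] by (auto simp: \<F>_iff top_PT F_iff)
      then show ?thesis using f(2) a by (auto simp: L_def intro!: image_eqI[of _ _ "\<lambda>y\<in>K. act s (f y)"])
    qed
    moreover have "convex_functionals L"
      unfolding convex_functionals_def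
    proof (intro ballI allI impI)
      fix y z and u :: real assume "y \<in> L" "z \<in> L" and u: "0 \<le> u \<and> u \<le> 1"
      then obtain f g where f: "f \<in> \<F>" "y = f a" and g: "g \<in> \<F>" "z = g a" by (auto simp: L_def)
      define h where "h x = fscale (of_real u) (f x) + fscale (of_real (1 - u)) (g x)" for x
      have hK: "h x \<in> K" if "x \<in> K" for x
        using convex \<F>_K[OF f(1) that] \<F>_K[OF g(1) that] u unfolding convex_functionals_def h_def by blast
      have h_fix: "h x = x" if "x \<in> F" for x
        using \<F>_fix[OF f(1) that] \<F>_fix[OF g(1) that]
        by (simp add: h_def fscale_def fun_eq_iff algebra_simps)
      have h_ne: "N1 (h v - h w) \<le> N1 (v - w)" if vw: "v \<in> K" "w \<in> K" for v w
      proof -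
        have fm: "f v - f w \<in> X1" and gm: "g v - g w \<in> X1"
          using \<F>_K[OF f(1)] \<F>_K[OF g(1)] vw K_dual by (auto intro!: X1.diff_mem)
        have "h v - h w = fscale (of_real u) (f v - f w) + fscale (of_real (1 - u)) (g v - g w)"
          by (simp add: h_def fscale_def fun_eq_iff algebra_simps)
        then have "N1 (h v - h w) \<le> N1 (fscale (of_real u) (f v - f w)) + N1 (fscale (of_real (1 - u)) (g v - g w))"
          using X1.N_add[OF X1.scale_mem[OF fm] X1.scale_mem[OF gm]] by simp
        also have "\<dots> = u * N1 (f v - f w) + (1 - u) * N1 (g v - g w)"
          using u unfolding X1.N_scale[OF fm] X1.N_scale[OF gm] norm_of_real by simp
        also have "\<dots> \<le> u * N1 (v - w) + (1 - u) * N1 (v - w)"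
          using u \<F>_ne[OF f(1) vw] \<F>_ne[OF g(1) vw] by (intro add_mono mult_left_mono) auto
        finally show ?thesis by (simp add: algebra_simps)
      qed
      have "(\<lambda>x\<in>K. h x) \<in> \<F>"
        using hK h_fix h_ne FK by (auto simp: \<F>_iff top_PT)
      then have "h a \<in> L" using a by (auto simp: L_def intro!: image_eqI[of _ _ "\<lambda>x\<in>K. h x"])
      then show "fscale (of_real u) y + fscale (of_real (1 - u)) z \<in> L"
        by (simp add: h_def f(2) g(2))
    qed
    ultimately obtain z where z: "z \<in> L" "\<And>s. act s z = z"
      by (rule fixed_point_in_invariant_subset) (assumption, rule that)
    then have zF: "z \<in> F" and zK: "z \<in> K" using LK by (auto simp: F_iff)
    obtain f where f: "f \<in> \<F>" "z = f a" using z(1) by (auto simp: L_def)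
    \<comment> \<open>Composition with \<open>f\<close> does not increase distances, so minimality
      forces equality. As \<open>f\<close> sends both \<open>r x\<close> and \<open>r z = z\<close>
      to \<open>z\<close>, the points \<open>r x\<close> and \<open>z\<close> coincide.\<close>
    have "(\<lambda>y\<in>K. f (r y)) \<in> down r"
      using \<F>_K[OF f(1) \<F>_K[OF r]] \<F>_fix[OF f(1)] \<F>_fix[OF r] FK \<F>_ne[OF f(1) \<F>_K[OF r] \<F>_K[OF r]]
      by (auto simp: down_def top_PT)
    then have "r \<in> down (\<lambda>y\<in>K. f (r y))" by (rule r_min)
    then have "N1 (r x - r z) \<le> N1 (f (r x) - f (r z))"
      using x zK by (simp add: down_def)
    moreover have "f (r x) = z" "f (r z) = z" "r z = z"
      using \<F>_fix[OF r zF] \<F>_fix[OF f(1) zF] f(2) by (simp_all add: a_def)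
    ultimately have "N1 (r x - z) \<le> 0" by (simp only: diff_self X1.N_zero)
    then have "r x - z = 0"
      using a zK K_dual unfolding a_def by (intro X0.dual_eq_zero X1.diff_mem) auto
    then show ?thesis using zF by simp
  qed
  show "\<exists>r. r ` K = fixed_points K act \<and> (\<forall>x\<in>K. r (r x) = r x) \<and> nonexpansive_on N1 K r"
  proof (intro exI[of _ r] conjI ballI)
    have "F \<subseteq> r ` K"
      using \<F>_fix[OF r] FK by (metis image_eqI subsetI subsetD)
    then show "r ` K = fixed_points K act" using r_F by (auto simp: F_def)
    show "r (r x) = r x" if "x \<in> K" for x using \<F>_fix[OF r r_F[OF that]] .
    show "nonexpansive_on N1 K r" using \<F>_ne[OF r] by (simp add: nonexpansive_on_def)
  qed
qed

end

section \<open>Orbit functions\<close>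

lemma continuous_map_euclidean_compose:
  "continuous_map T euclidean f \<Longrightarrow> continuous_on UNIV g \<Longrightarrow> continuous_map T euclidean (\<lambda>x. g (f x))"
  using continuous_map_compose[of T euclidean f euclidean g] by (simp add: comp_def)

lemma continuous_map_euclidean_compose2:
  fixes f :: "'p \<Rightarrow> 'a::topological_space" and g :: "'p \<Rightarrow> 'b::topological_space"
  assumes "continuous_map T euclidean f" "continuous_map T euclidean g"
    and "continuous_on UNIV (\<lambda>p. h (fst p) (snd p))"
  shows "continuous_map T euclidean (\<lambda>x. h (f x) (g x))"
proof -
  have "continuous_map T (prod_topology euclidean euclidean) (\<lambda>x. (f x, g x))"
    using assms(1,2) by (intro continuous_map_pairedI)
  then have "continuous_map T euclidean (\<lambda>x. (f x, g x))" by simp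
  from continuous_map_euclidean_compose[OF this assms(3)] show ?thesis by simp
qed

lemma closedin_Collect_mem: 
  assumes "continuous_map T euclidean f" "closed C"
  shows "closedin T {x \<in> topspace T. f x \<in> C}"
  using closedin_continuous_map_preimage[OF assms(1), of C] assms(2) by simp

lemma openin_Collect_mem: 
  assumes "continuous_map T euclidean f" "open C"
  shows "openin T {x \<in> topspace T. f x \<in> C}"
  using openin_continuous_map_preimage[OF assms(1), of C] assms(2) by simp

text \<open>Points are sorted by the integer parts of \<open>\<phi> i y / e\<close>. Finitely many
  bounded coordinates allow finitely many patterns, and one representative of each pattern
  suffices.\<close>

lemma finite_net:
  fixes \<phi> :: "'i \<Rightarrow> 'y \<Rightarrow> real"
  assumes I: "finite I" and bound: "\<And>i y. i \<in> I \<Longrightarrow> y \<in> Y \<Longrightarrow> \<bar>\<phi> i y\<bar> \<le> B i" and e: "0 < e"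
  obtains D where "finite D" "D \<subseteq> Y" "\<And>y. y \<in> Y \<Longrightarrow> \<exists>y'\<in>D. \<forall>i\<in>I. \<bar>\<phi> i y - \<phi> i y'\<bar> < e"
proof -
  define \<kappa> where "\<kappa> y = (\<lambda>i\<in>I. \<lfloor>\<phi> i y / e\<rfloor>)" for y
  have "\<kappa> ` Y \<subseteq> (\<Pi>\<^sub>E i\<in>I. {\<lfloor>- B i / e\<rfloor>..\<lfloor>B i / e\<rfloor>})"
  proof
    fix k assume "k \<in> \<kappa> ` Y"
    then obtain y where y: "y \<in> Y" "k = \<kappa> y" by blast
    have "\<lfloor>- B i / e\<rfloor> \<le> \<lfloor>\<phi> i y / e\<rfloor> \<and> \<lfloor>\<phi> i y / e\<rfloor> \<le> \<lfloor>B i / e\<rfloor>" if "i \<in> I" for i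
      using bound[OF that y(1)] e by (intro conjI floor_mono divide_right_mono) auto
    then show "k \<in> (\<Pi>\<^sub>E i\<in>I. {\<lfloor>- B i / e\<rfloor>..\<lfloor>B i / e\<rfloor>})" by (auto simp: y(2) \<kappa>_def)
  qed
  then have "finite (\<kappa> ` Y)" using I by (rule finite_subset[OF _ finite_PiE]) auto
  then obtain D where D: "D \<subseteq> Y" "finite D" "\<kappa> ` Y = \<kappa> ` D"
    by (metis finite_subset_image order_refl)
  show thesis
  proof (rule that[OF D(2,1)])
    fix y assume "y \<in> Y"
    then obtain y' where y': "y' \<in> D" "\<kappa> y = \<kappa> y'" using D(3) by blast
    have "\<bar>\<phi> i y - \<phi> i y'\<bar> < e" if "i \<in> I" for i
    proof -
      have "\<lfloor>\<phi> i y / e\<rfloor> = \<lfloor>\<phi> i y' / e\<rfloor>" using fun_cong[OF y'(2), of i] that by (simp add: \<kappa>_def)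
      then have "\<bar>\<phi> i y / e - \<phi> i y' / e\<bar> < 1" by linarith
      then have "\<bar>\<phi> i y - \<phi> i y'\<bar> / e < 1" using e by (simp add: diff_divide_distrib[symmetric])
      then show ?thesis using e by simp
    qed
    then show "\<exists>y'\<in>D. \<forall>i\<in>I. \<bar>\<phi> i y - \<phi> i y'\<bar> < e" using y'(1) by blast
  qed
qed

lemma complete_bcontfun: "complete (UNIV :: ('s::topological_space \<Rightarrow>\<^sub>C complex) set)"
  unfolding complete_def
proof (intro allI impI)
  fix f :: "nat \<Rightarrow> 's \<Rightarrow>\<^sub>C complex" assume "(\<forall>n. f n \<in> UNIV) \<and> Cauchy f"
  then have C: "Cauchy f" by simp
  have "uniformly_Cauchy_on UNIV (\<lambda>n. apply_bcontfun (f n))"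
    unfolding uniformly_Cauchy_on_def
  proof (intro allI impI)
    fix e :: real assume "0 < e"
    then obtain M where "\<forall>m\<ge>M. \<forall>n\<ge>M. dist (f m) (f n) < e" using C unfolding Cauchy_def by blast
    then show "\<exists>M. \<forall>x\<in>UNIV. \<forall>m\<ge>M. \<forall>n\<ge>M. dist (f m x) (f n x) < e"
      using dist_fun_lt_imp_dist_val_lt by blast
  qed
  then have "uniformly_convergent_on UNIV (\<lambda>n. apply_bcontfun (f n))"
    by (rule Cauchy_uniformly_convergent)
  then obtain g where "uniform_limit UNIV (\<lambda>n. apply_bcontfun (f n)) g sequentially"
    by (auto simp: uniformly_convergent_on_def)
  from uniform_limit_bcontfunE[OF this sequentially_bot] obtain l where "f \<longlonglongrightarrow> l" by metis
  then show "\<exists>l\<in>UNIV. f \<longlonglongrightarrow> l" by blast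
qed

lemma compact_closure_bcontfun:
  fixes A :: "('s::topological_space \<Rightarrow>\<^sub>C complex) set"
  assumes "\<And>e. 0 < e \<Longrightarrow> \<exists>k. finite k \<and> A \<subseteq> (\<Union>x\<in>k. cball x e)"
  shows "compact (closure A)"
  unfolding compact_eq_totally_bounded
proof (intro conjI allI impI)
  show "complete (closure A)"
    using complete_Int_closed[OF complete_bcontfun closed_closure[of A]] by simp
  fix e :: real assume "0 < e"
  then obtain k where k: "finite k" "A \<subseteq> (\<Union>x\<in>k. cball x (e / 2))" using assms[of "e / 2"] by auto
  have "closure A \<subseteq> (\<Union>x\<in>k. cball x (e / 2))"
    using k by (intro closure_minimal closed_UN) auto
  also have "\<dots> \<subseteq> (\<Union>x\<in>k. ball x e)" using \<open>0 < e\<close> by (intro UN_mono) auto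
  finally show "\<exists>k. finite k \<and> closure A \<subseteq> (\<Union>x\<in>k. ball x e)" using k(1) by blast
qed

lemma continuous_map_induced_topology:
  assumes "\<And>\<phi>. \<phi> \<in> \<Phi> \<Longrightarrow> continuous_map X euclidean (\<lambda>x. \<phi> (h x))"
  shows "continuous_map X (induced_topology \<Phi>) h"
  unfolding induced_topology_def
  by (rule continuous_map_pullback') (use assms in \<open>auto simp: comp_def continuous_map_componentwise\<close>)

lemma continuous_map_from_induced_topology:
  assumes "\<phi> \<in> \<Phi>"
  shows "continuous_map (induced_topology \<Phi>) euclidean \<phi>"
proof -
  have "continuous_map (pullback_topology UNIV (\<lambda>x. \<lambda>\<phi>\<in>\<Phi>. \<phi> x) (product_topology (\<lambda>_. euclidean) \<Phi>))
      euclidean ((\<lambda>p. p \<phi>) \<circ> (\<lambda>x. \<lambda>\<phi>\<in>\<Phi>. \<phi> x))"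
    by (intro continuous_map_pullback continuous_map_product_projection assms)
  then show ?thesis using assms by (simp add: comp_def induced_topology_def)
qed

definition orbit_fun :: "('s::topological_space \<Rightarrow> 'p \<Rightarrow> 'p) \<Rightarrow> ('p \<Rightarrow> complex) \<Rightarrow> 'p \<Rightarrow> ('s \<Rightarrow>\<^sub>C complex)"
  where "orbit_fun act f x = Bcontfun (\<lambda>s. f (act s x))"

section \<open>Transfer of the mean, and orbit functions in LUC, LMC and AP\<close>

locale compact_system =
  fixes T :: "'p topology" and act :: "'s::semitopological_semigroup \<Rightarrow> 'p \<Rightarrow> 'p"
  assumes compact_T: "compact_space T" and Hausdorff_T: "Hausdorff_space T"
    and system: "dynamical_system T act"
begin

lemma act_closed: "x \<in> topspace T \<Longrightarrow> act s x \<in> topspace T"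
  and act_mult: "x \<in> topspace T \<Longrightarrow> act s (act t x) = act (s * t) x"
  and continuous_orbit: "x \<in> topspace T \<Longrightarrow> continuous_map euclidean T (\<lambda>s. act s x)"
  and continuous_act: "continuous_map T T (act s)"
  using system by (auto simp: dynamical_system_def)

abbreviation "C f \<equiv> continuous_map T euclidean (f :: 'p \<Rightarrow> complex)"
abbreviation "orb f x \<equiv> orbit_fun act f x"

lemma C_act: "C f \<Longrightarrow> C (\<lambda>y. f (act s y))"
  using continuous_map_compose[OF continuous_act, of euclidean f] by (simp add: comp_def)

lemma C_const: "C (\<lambda>_. c)"
  by simp

lemma C_mult: "C f \<Longrightarrow> C g \<Longrightarrow> C (\<lambda>y. f y * g y)"
  by (erule continuous_map_euclidean_compose2) (auto intro!: continuous_intros)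

lemma C_of_real: "continuous_map T euclideanreal f \<Longrightarrow> C (\<lambda>y. of_real (f y))"
  by (erule continuous_map_euclidean_compose) (auto intro!: continuous_intros)

lemma C_bounded:
  assumes "continuous_map T euclidean (f :: 'p \<Rightarrow> 'b::real_normed_vector)"
  obtains B where "\<And>y. y \<in> topspace T \<Longrightarrow> norm (f y) \<le> B"
proof -
  have "compactin euclidean (f ` topspace T)"
    using compact_T assms by (intro image_compactin[of T]) (auto simp: compact_space_def)
  then have "bounded (f ` topspace T)" by (simp add: compact_imp_bounded)
  then show thesis using that by (auto simp: bounded_iff)
qed

lemma orb_apply:
  assumes "C f" "x \<in> topspace T"
  shows "apply_bcontfun (orb f x) = (\<lambda>s. f (act s x))"
proof -
  have "continuous_map euclidean euclidean (f \<circ> (\<lambda>s. act s x))"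
    using continuous_orbit[OF assms(2)] assms(1) by (rule continuous_map_compose)
  then have "continuous_on UNIV (\<lambda>s. f (act s x))" by (simp add: comp_def)
  moreover obtain B where "\<And>y. y \<in> topspace T \<Longrightarrow> norm (f y) \<le> B" by (rule C_bounded[OF assms(1)]) (rule that)
  then have "bounded (range (\<lambda>s. f (act s x)))"
    using act_closed[OF assms(2)] by (auto simp: bounded_iff)
  ultimately have "(\<lambda>s. f (act s x)) \<in> bcontfun" by (simp add: bcontfun_def)
  then show ?thesis by (simp add: orbit_fun_def Bcontfun_inverse)
qed

lemma orb_add: "C f \<Longrightarrow> C g \<Longrightarrow> x \<in> topspace T \<Longrightarrow> orb (\<lambda>y. f y + g y) x = orb f x + orb g x"
  by (rule bcontfun_eqI) (simp add: orb_apply continuous_map_add)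

lemma orb_scale: "C f \<Longrightarrow> x \<in> topspace T \<Longrightarrow> orb (\<lambda>y. c * f y) x = bc_scale c (orb f x)"
  by (rule bcontfun_eqI) (simp add: orb_apply C_mult bc_scale.rep_eq)

lemma orb_mult: "C f \<Longrightarrow> C g \<Longrightarrow> x \<in> topspace T \<Longrightarrow> orb (\<lambda>y. f y * g y) x = bc_mult (orb f x) (orb g x)"
  by (rule bcontfun_eqI) (simp add: orb_apply C_mult bc_mult.rep_eq)

lemma orb_const: "x \<in> topspace T \<Longrightarrow> orb (\<lambda>_. c) x = const_bcontfun c"
  by (rule bcontfun_eqI) (simp add: orb_apply const_bcontfun.rep_eq)

text \<open>Left translation changes the observed function and keeps the point \<open>x\<close>.
  Hence left invariance of a mean on \<open>S\<close> becomes invariance under the action.\<close>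

lemma left_translate_orb:
  "C f \<Longrightarrow> x \<in> topspace T \<Longrightarrow> left_translate s (orb f x) = orb (\<lambda>y. f (act s y)) x"
  by (rule bcontfun_eqI) (simp add: orb_apply left_translate.rep_eq C_act act_mult)

lemma norm_orb_le:
  assumes "C f" "x \<in> topspace T" "\<And>s. norm (f (act s x)) \<le> B"
  shows "norm (orb f x) \<le> B"
  by (rule norm_bound) (use assms in \<open>simp add: orb_apply\<close>)

text \<open>The rescaling by \<open>1 / B\<close> is done before passing to the orbit function,
  because orbit functions are the only elements \<open>Y\<close> is known to contain.\<close>

lemma mean_bound:
  assumes \<mu>: "\<mu> \<in> means Y" and Y: "\<And>f. C f \<Longrightarrow> orb f x \<in> Y" and x: "x \<in> topspace T"
    and f: "C f" "\<And>s. norm (f (act s x)) \<le> B" and B: "0 < B"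
  shows "norm (\<mu> (orb f x)) \<le> B"
proof -
  have dual: "\<mu> \<in> dual Y bc_scale norm" and norm1: "dual_norm Y norm \<mu> = 1"
    using \<mu> by (auto simp: means_def)
  obtain c where c: "\<forall>g\<in>Y. norm (\<mu> g) \<le> c * norm g" using dual unfolding dual_def by blast
  have bdd: "bdd_above ((\<lambda>g. norm (\<mu> g)) ` {g \<in> Y. norm g \<le> 1})"
  proof (rule bdd_aboveI2)
    fix g assume g: "g \<in> {g \<in> Y. norm g \<le> 1}"
    have "norm (\<mu> g) \<le> c * norm g" using c g by blast
    also have "\<dots> \<le> \<bar>c\<bar> * 1" using g by (intro mult_mono) auto
    finally show "norm (\<mu> g) \<le> \<bar>c\<bar>" by simp
  qed
  let ?h = "orb (\<lambda>y. of_real (1 / B) * f y) x"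
  have ch: "C (\<lambda>y. of_real (1 / B) * f y)" using f(1) by (intro C_mult) auto
  have "norm ?h \<le> 1"
    using f(2) B by (intro norm_orb_le[OF ch x]) (simp add: norm_mult norm_divide)
  then have "norm (\<mu> ?h) \<le> dual_norm Y norm \<mu>"
    unfolding dual_norm_def by (intro cSUP_upper[OF _ bdd]) (use Y[OF ch] in auto)
  moreover have "\<mu> ?h = of_real (1 / B) * \<mu> (orb f x)"
    unfolding orb_scale[OF f(1) x] using dual Y[OF f(1)] by (simp add: dual_def)
  ultimately show ?thesis using B norm1 by (simp add: norm_mult norm_divide)
qed

lemma invariant_mean_exists:
  assumes mean: "has_left_invariant_mean Y" and Y: "\<And>f. C f \<Longrightarrow> orb f x \<in> Y" and x: "x \<in> topspace T"
  shows "\<exists>M. invariant_mean T act x M"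
proof -
  obtain \<mu> where \<mu>: "\<mu> \<in> means Y" and inv: "\<And>s f. f \<in> Y \<Longrightarrow> \<mu> (left_translate s f) = \<mu> f"
    using mean unfolding has_left_invariant_mean_def by blast
  have dual: "\<mu> \<in> dual Y bc_scale norm" and one: "\<mu> (const_bcontfun 1) = 1"
    using \<mu> by (auto simp: means_def)
  define M where "M f = Re (\<mu> (orb (\<lambda>y. of_real (f y)) x))" for f :: "'p \<Rightarrow> real"
  have add: "\<mu> (orb (\<lambda>y. f y + g y) x) = \<mu> (orb f x) + \<mu> (orb g x)" if "C f" "C g" for f g
    unfolding orb_add[OF that x] using dual Y that by (simp add: dual_def)
  have scale: "\<mu> (orb (\<lambda>y. c * f y) x) = c * \<mu> (orb f x)" if "C f" for f c
    unfolding orb_scale[OF that x] using dual Y that by (simp add: dual_def)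
  have const: "\<mu> (orb (\<lambda>_. c) x) = c" for c
    using scale[of "\<lambda>_. 1" c] one by (simp add: orb_const x)
  have M_nonneg: "0 \<le> M f" if f: "continuous_map T euclideanreal f" "\<And>s. 0 \<le> f (act s x)" for f
  proof -
    obtain B0 where B0: "\<And>y. y \<in> topspace T \<Longrightarrow> norm (f y) \<le> B0"
      by (rule C_bounded[OF f(1)]) (rule that)
    define B where "B = max B0 1"
    have B: "0 < B" "\<And>s. f (act s x) \<le> B"
      using B0[OF act_closed[OF x]] by (auto simp: B_def abs_le_iff le_max_iff_disj)
    have cf: "C (\<lambda>y. of_real (f y))" using f(1) by (rule C_of_real)
    have cg: "C (\<lambda>y. (-1) * of_real (f y))" using cf by (intro C_mult) auto
    \<comment> \<open>Positivity comes from norm one: values in \<open>[0, B]\<close> put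
      \<open>B - f\<close> into the ball of radius \<open>B\<close>, so the mean of \<open>f\<close>
      lies within \<open>B\<close> of \<open>B\<close> and has nonnegative real part.\<close>
    have "norm (\<mu> (orb (\<lambda>y. of_real B + (-1) * of_real (f y)) x)) \<le> B"
    proof (rule mean_bound[OF \<mu> Y x _ _ B(1)])
      show "C (\<lambda>y. of_real B + (-1) * of_real (f y))" using cg by (intro continuous_map_add) auto
      show "norm (of_real B + (-1) * of_real (f (act s x)) :: complex) \<le> B" for s
        using f(2)[of s] B(2)[of s] by (simp flip: of_real_diff)
    qed
    also have "\<mu> (orb (\<lambda>y. of_real B + (-1) * of_real (f y)) x) = of_real B - \<mu> (orb (\<lambda>y. of_real (f y)) x)"
      using add[OF C_const cg] scale[OF cf, of "-1"] const[of "of_real B"] by simp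
    finally have "norm (of_real B - \<mu> (orb (\<lambda>y. of_real (f y)) x)) \<le> B" .
    then have "Re (of_real B - \<mu> (orb (\<lambda>y. of_real (f y)) x)) \<le> B"
      by (rule order_trans[OF complex_Re_le_cmod])
    then show ?thesis by (simp add: M_def)
  qed
  have "invariant_mean T act x M"
    unfolding invariant_mean_def
  proof (intro conjI allI impI)
    fix f g :: "'p \<Rightarrow> real" and c :: real and s
    assume f: "continuous_map T euclideanreal f"
    show "0 \<le> M f" if "\<forall>s. 0 \<le> f (act s x)" using M_nonneg[OF f] that by blast
    show "M (\<lambda>y. c * f y) = c * M f"
      using scale[OF C_of_real[OF f], of "of_real c"] by (simp add: M_def)
    show "M (\<lambda>y. f y + g y) = M f + M g" if "continuous_map T euclideanreal g"
      using add[OF C_of_real[OF f] C_of_real[OF that]] by (simp add: M_def)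
    show "M (\<lambda>y. f (act s y)) = M f"
      using inv[OF Y[OF C_of_real[OF f]], of s] by (simp add: M_def left_translate_orb C_of_real[OF f] x)
  next
    show "M (\<lambda>_. 1) = 1" using const[of 1] by (simp add: M_def)
  qed
  then show ?thesis by blast
qed

text \<open>The tube lemma on the compact phase space turns joint continuity at \<open>s0\<close>
  into an estimate uniform over all points, in particular over the orbit of
  \<open>x\<close>.\<close>

lemma orb_in_LUC:
  assumes joint: "jointly_continuous T act" and f: "C f" and x: "x \<in> topspace T"
  shows "orb f x \<in> LUC"
proof -
  have "((\<lambda>s. left_translate s (orb f x)) \<longlongrightarrow> left_translate s0 (orb f x)) (at s0)" for s0
  proof (rule tendstoI)
    fix e :: real assume e: "0 < e"
    have c1: "continuous_map (prod_topology euclidean T) euclidean (\<lambda>p. f (act (fst p) (snd p)))"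
      using continuous_map_compose[OF joint[unfolded jointly_continuous_def] f]
      by (simp add: comp_def case_prod_beta)
    have c2: "continuous_map (prod_topology euclidean T) euclidean (\<lambda>p. f (act s0 (snd p)))"
      using continuous_map_compose[OF continuous_map_snd C_act[OF f, of s0]] by (simp add: comp_def)
    have "continuous_map (prod_topology euclidean T) euclidean (\<lambda>p. dist (f (act (fst p) (snd p))) (f (act s0 (snd p))))"
      by (rule continuous_map_euclidean_compose2[OF c1 c2]) (intro continuous_intros)
    then have W: "openin (prod_topology euclidean T)
        {p \<in> topspace (prod_topology euclidean T). dist (f (act (fst p) (snd p))) (f (act s0 (snd p))) \<in> {..<e / 2}}"
        (is "openin _ ?W")
      by (rule openin_Collect_mem) simp
    have "compactin T (topspace T)" using compact_T by (simp add: compact_space_def)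
    moreover have "{s0} \<times> topspace T \<subseteq> ?W" using e by auto
    ultimately obtain U V where "openin euclidean U" and UV: "s0 \<in> U" "topspace T \<subseteq> V" "U \<times> V \<subseteq> ?W"
      using tube_lemma_right[OF W, of "topspace T" s0] by auto
    then have "open U" by simp
    have "dist (left_translate s (orb f x)) (left_translate s0 (orb f x)) < e" if "s \<in> U" for s
    proof -
      have "dist (left_translate s (orb f x)) (left_translate s0 (orb f x)) \<le> e / 2"
      proof (rule dist_bound)
        fix t
        have "(s, act t x) \<in> U \<times> V" using that UV(2) act_closed[OF x] by blast
        then show "dist (left_translate s (orb f x) t) (left_translate s0 (orb f x) t) \<le> e / 2"
          using UV(3) by (auto simp: left_translate_orb[OF f x] orb_apply C_act f x)
      qed
      then show ?thesis using e by simp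
    qed
    then show "\<forall>\<^sub>F s in at s0. dist (left_translate s (orb f x)) (left_translate s0 (orb f x)) < e"
      using \<open>open U\<close> UV(1) by (auto simp: eventually_at_topological)
  qed
  then show ?thesis by (simp add: LUC_def continuous_on_def)
qed

text \<open>A multiplicative mean composed with \<open>f \<mapsto> orb f x\<close> is a character of the algebra of continuous
  functions on a compact space, hence a point evaluation.\<close>

lemma multiplicative_mean_point:
  assumes m: "m \<in> multiplicative_means" and x: "x \<in> topspace T"
  shows "\<exists>y\<in>topspace T. \<forall>f. C f \<longrightarrow> m (orb f x) = f y"
proof (rule ccontr)
  assume neg: "\<not> ?thesis"
  have dual: "m \<in> dual UNIV bc_scale norm" and one: "m (const_bcontfun 1) = 1"
    and mult: "\<And>f g. m (bc_mult f g) = m f * m g"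
    using m by (auto simp: multiplicative_means_def means_def)
  have add: "m (f + g) = m f + m g" and scale: "m (bc_scale c f) = c * m f" for f g c
    using dual by (auto simp: dual_def)
  have const: "m (orb (\<lambda>_. c) x) = c" for c
    using scale[of c "orb (\<lambda>_. 1) x"] one orb_scale[OF C_const x, of c 1] by (simp add: orb_const x)
  have "\<exists>h. C h \<and> m (orb h x) = 0 \<and> h y \<noteq> 0" if y: "y \<in> topspace T" for y
  proof -
    obtain f where f: "C f" "m (orb f x) \<noteq> f y" using neg y by blast
    let ?c = "m (orb f x)"
    have "m (orb (\<lambda>z. f z + (- ?c)) x) = 0"
      using orb_add[OF f(1) C_const x, of "- ?c"] add const by simp
    moreover have "C (\<lambda>z. f z + (- ?c))" using f(1) by (intro continuous_map_add) auto
    ultimately show ?thesis using f(2) by (intro exI[of _ "\<lambda>z. f z + (- ?c)"]) auto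
  qed
  then obtain h where h: "\<And>y. y \<in> topspace T \<Longrightarrow> C (h y) \<and> m (orb (h y) x) = 0 \<and> h y y \<noteq> 0" by metis
  define \<U> where "\<U> = (\<lambda>y. {z \<in> topspace T. h y z \<in> - {0}}) ` topspace T"
  have "\<forall>U\<in>\<U>. openin T U" 
    unfolding \<U>_def using openin_Collect_mem[of T "h y" "- {0}" for y] h by auto
  moreover have "topspace T \<subseteq> \<Union>\<U>" using h by (auto simp: \<U>_def)
  ultimately obtain \<F> where \<F>: "finite \<F>" "\<F> \<subseteq> \<U>" "topspace T \<subseteq> \<Union>\<F>"
    using compact_T unfolding compact_space_alt by meson
  then obtain I where I: "finite I" "I \<subseteq> topspace T" "\<F> = (\<lambda>y. {z \<in> topspace T. h y z \<in> - {0}}) ` I"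
    unfolding \<U>_def by (meson finite_subset_image)
  \<comment> \<open>Multiplication by the conjugate keeps each term in the kernel of
    \<open>m\<close> and makes it nonnegative. The sum over the finite cover has no zero, so its
    inverse is continuous and \<open>m\<close> would vanish at the constant 1.\<close>
  define k where "k J z = (\<Sum>y\<in>J. h y z * cnj (h y z))" for J z
  have k_J: "C (k J) \<and> m (orb (k J) x) = 0" if "finite J" "J \<subseteq> topspace T" for J
    using that
  proof (induction rule: finite_induct)
    case empty
    then show ?case using const[of 0] by (simp add: k_def)
  next
    case (insert y J)
    have hy: "C (h y)" "m (orb (h y) x) = 0" using h insert.prems by auto
    then have cn: "C (\<lambda>z. cnj (h y z))"
      by (intro continuous_map_euclidean_compose[of T "h y" cnj]) (auto intro: continuous_intros)
    have kJ: "C (k J)" "m (orb (k J) x) = 0" using insert by auto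
    have eq: "k (insert y J) = (\<lambda>z. h y z * cnj (h y z) + k J z)"
      using insert by (simp add: k_def fun_eq_iff)
    have "C (k (insert y J))"
      unfolding eq by (intro continuous_map_add C_mult hy cn kJ)
    moreover have "m (orb (k (insert y J)) x) = 0"
      unfolding eq orb_add[OF C_mult[OF hy(1) cn] kJ(1) x] orb_mult[OF hy(1) cn x] add mult hy(2) kJ(2) by simp
    ultimately show ?case by blast
  qed
  have k_real: "k I z = of_real (\<Sum>y\<in>I. (norm (h y z))\<^sup>2)" for z
    unfolding k_def of_real_sum complex_norm_square ..
  have k_nz: "k I z \<noteq> 0" if z: "z \<in> topspace T" for z
  proof -
    obtain y where "y \<in> I" "h y z \<noteq> 0" using \<F>(3) I(3) z by blast
    then have "0 < (\<Sum>y\<in>I. (norm (h y z))\<^sup>2)" using I(1) by (intro sum_pos2[of I y]) auto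
    then show ?thesis unfolding k_real by (metis of_real_eq_0_iff order_less_irrefl)
  qed
  have ck: "C (k I)" and mk: "m (orb (k I) x) = 0" using k_J[OF I(1,2)] by auto
  have c1: "continuous_map T (top_of_set (- {0})) (k I)"
    using ck k_nz by (auto simp: continuous_map_in_subtopology)
  have c2: "continuous_map (top_of_set (- {0})) euclidean (inverse :: complex \<Rightarrow> complex)"
    by (auto intro!: continuous_intros)
  have ci: "C (\<lambda>z. inverse (k I z))"
    using continuous_map_compose[OF c1 c2] by (simp add: comp_def)
  have "orb (\<lambda>z. k I z * inverse (k I z)) x = const_bcontfun 1"
    by (rule bcontfun_eqI) (simp add: orb_apply C_mult ck ci x const_bcontfun.rep_eq k_nz act_closed)
  then have "1 = m (orb (\<lambda>z. k I z * inverse (k I z)) x)" using one by simp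
  also have "\<dots> = 0" unfolding orb_mult[OF ck ci x] mult mk by simp
  finally show False by simp
qed

text \<open>Each multiplicative mean is evaluation at some \<open>y\<close>, so its values on the
  left translates are \<open>f (act s y)\<close>. Separate continuity of the action makes these
  continuous in \<open>s\<close>.\<close>

lemma orb_in_LMC:
  assumes f: "C f" and x: "x \<in> topspace T"
  shows "orb f x \<in> LMC"
  unfolding LMC_def
proof (intro CollectI continuous_map_induced_topology)
  fix m :: "('s \<Rightarrow>\<^sub>C complex) \<Rightarrow> complex" assume "m \<in> multiplicative_means"
  then obtain y where y: "y \<in> topspace T" "\<And>f. C f \<Longrightarrow> m (orb f x) = f y"
    using multiplicative_mean_point[OF _ x] by blast
  have "(\<lambda>s. m (left_translate s (orb f x))) = (\<lambda>s. f (act s y))"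
    using y(2)[OF C_act[OF f]] by (simp add: left_translate_orb f x)
  then show "continuous_map euclidean euclidean (\<lambda>s. m (left_translate s (orb f x)))"
    using continuous_map_compose[OF continuous_orbit[OF y(1)] f] by (simp add: comp_def)
qed

text \<open>Equicontinuity and compactness reduce the translates to their values at a finite set
  \<open>Z\<close>, where \<open>finite_net\<close> applies. Real and imaginary parts contribute
  \<open>e / 4\<close> each, and moving from \<open>y\<close> to a point of \<open>Z\<close> costs
  \<open>e / 4\<close> for each of two translates.\<close>

lemma orb_in_AP:
  assumes equi: "\<And>z e. z \<in> topspace T \<Longrightarrow> 0 < e \<Longrightarrow>
      \<exists>G. openin T G \<and> z \<in> G \<and> (\<forall>s. \<forall>y\<in>G. norm (f (act s y) - f (act s z)) < e)"
    and f: "C f" and x: "x \<in> topspace T"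
  shows "orb f x \<in> AP"
  unfolding AP_def
proof (intro CollectI compact_closure_bcontfun)
  fix e :: real assume e: "0 < e"
  then have e4: "0 < e / 4" by simp
  obtain G where G: "\<And>z. z \<in> topspace T \<Longrightarrow>
      openin T (G z) \<and> z \<in> G z \<and> (\<forall>s. \<forall>y\<in>G z. norm (f (act s y) - f (act s z)) < e / 4)"
    using equi[OF _ e4] by metis
  have "\<forall>U\<in>G ` topspace T. openin T U" using G by blast
  moreover have "topspace T \<subseteq> \<Union>(G ` topspace T)" using G by blast
  ultimately obtain \<F> where \<F>: "finite \<F>" "\<F> \<subseteq> G ` topspace T" "topspace T \<subseteq> \<Union>\<F>"
    using compact_T unfolding compact_space_alt by meson
  then obtain Z where Z: "finite Z" "Z \<subseteq> topspace T" "\<F> = G ` Z"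
    by (meson finite_subset_image)
  obtain B where B: "\<And>y. y \<in> topspace T \<Longrightarrow> norm (f y) \<le> B" by (rule C_bounded[OF f]) (rule that)
  define \<phi> where "\<phi> i s = (if snd i then Re (f (act s (fst i))) else Im (f (act s (fst i))))" for i :: "'p \<times> bool" and s
  have "\<bar>\<phi> i s\<bar> \<le> B" if "i \<in> Z \<times> UNIV" for i s
    using abs_Re_le_cmod[of "f (act s (fst i))"] abs_Im_le_cmod[of "f (act s (fst i))"]
      B[OF act_closed, of "fst i" s] that Z(2) by (fastforce simp: \<phi>_def)
  moreover have "finite (Z \<times> (UNIV :: bool set))" using Z(1) by simp
  ultimately obtain D where D: "finite D"
    "\<And>s. \<exists>t\<in>D. \<forall>i\<in>Z \<times> UNIV. \<bar>\<phi> i s - \<phi> i t\<bar> < e / 4"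
    using finite_net[of "Z \<times> UNIV" UNIV \<phi> "\<lambda>_. B" "e / 4"] e4 by (metis UNIV_I)
  have "\<exists>t\<in>D. dist (left_translate t (orb f x)) (left_translate s (orb f x)) \<le> e" for s
  proof -
    obtain t where t: "t \<in> D" "\<forall>i\<in>Z \<times> UNIV. \<bar>\<phi> i s - \<phi> i t\<bar> < e / 4" using D(2) by blast
    have "norm (f (act t y) - f (act s y)) \<le> e" if y: "y \<in> topspace T" for y
    proof -
      obtain z where z: "z \<in> Z" "y \<in> G z" using \<F>(3) Z(3) y by blast
      have zT: "z \<in> topspace T" using z(1) Z(2) by blast
      have "\<bar>Re (f (act t z) - f (act s z))\<bar> < e / 4" "\<bar>Im (f (act t z) - f (act s z))\<bar> < e / 4"
        using bspec[OF t(2), of "(z, True)"] bspec[OF t(2), of "(z, False)"] z(1)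
        by (simp_all add: \<phi>_def abs_minus_commute)
      then have 1: "norm (f (act t z) - f (act s z)) < e / 2"
        using cmod_le[of "f (act t z) - f (act s z)"] by linarith
      have 2: "norm (f (act t y) - f (act t z)) < e / 4" "norm (f (act s y) - f (act s z)) < e / 4"
        using G[OF zT] z(2) by auto
      have eq: "f (act t y) - f (act s y) =
          (f (act t y) - f (act t z)) + (f (act t z) - f (act s z)) - (f (act s y) - f (act s z))" by simp
      show ?thesis
        unfolding eq using 1 2 norm_triangle_ineq4[of "(f (act t y) - f (act t z)) + (f (act t z) - f (act s z))" "f (act s y) - f (act s z)"]
          norm_triangle_ineq[of "f (act t y) - f (act t z)" "f (act t z) - f (act s z)"] by linarith
    qed
    then have "dist (left_translate t (orb f x)) (left_translate s (orb f x)) \<le> e"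
      by (intro dist_bound) (simp add: left_translate_orb f x orb_apply C_act dist_norm act_closed)
    then show ?thesis using t(1) by blast
  qed
  then show "\<exists>k. finite k \<and> range (\<lambda>s. left_translate s (orb f x)) \<subseteq> (\<Union>h\<in>k. cball h e)"
    using D(1) by (intro exI[of _ "(\<lambda>t. left_translate t (orb f x)) ` D"]) auto
qed

end

section \<open>Weakly almost periodic orbit functions\<close>

locale bounded_functional =
  fixes T :: "'p topology" and \<Lambda> :: "('p \<Rightarrow> real) \<Rightarrow> real" and C :: real
  assumes compact_T: "compact_space T" and C_nonneg: "0 \<le> C"
    and add: "continuous_map T euclideanreal u \<Longrightarrow> continuous_map T euclideanreal v \<Longrightarrow>
      \<Lambda> (\<lambda>x. u x + v x) = \<Lambda> u + \<Lambda> v"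
    and scale: "continuous_map T euclideanreal u \<Longrightarrow> \<Lambda> (\<lambda>x. c * u x) = c * \<Lambda> u"
    and bound: "continuous_map T euclideanreal u \<Longrightarrow> (\<And>x. x \<in> topspace T \<Longrightarrow> \<bar>u x\<bar> \<le> B) \<Longrightarrow> 0 \<le> B \<Longrightarrow>
      \<bar>\<Lambda> u\<bar> \<le> C * B"
begin

abbreviation "cont u \<equiv> continuous_map T euclideanreal u"

text \<open>For nonnegative continuous \<open>u\<close> this is the total variation of
  \<open>\<Lambda>\<close> evaluated at \<open>u\<close>, the absolute value of
  \<open>\<Lambda>\<close> in the Riesz order.\<close>

definition variation :: "('p \<Rightarrow> real) \<Rightarrow> real" where
  "variation u = (SUP v\<in>{v. cont v \<and> (\<forall>x\<in>topspace T. \<bar>v x\<bar> \<le> u x)}. \<Lambda> v)"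

lemma cont_bounded:
  assumes "cont u"
  obtains B where "0 \<le> B" "\<And>x. x \<in> topspace T \<Longrightarrow> \<bar>u x\<bar> \<le> B"
proof -
  have "compactin euclidean (u ` topspace T)"
    using compact_T assms by (intro image_compactin[of T]) (auto simp: compact_space_def)
  then have "bounded (u ` topspace T)" by (simp add: compact_imp_bounded)
  then obtain B where B: "\<And>x. x \<in> topspace T \<Longrightarrow> \<bar>u x\<bar> \<le> B" by (auto simp: bounded_iff)
  show thesis by (rule that[of "max B 0"]) (use B in \<open>auto simp: le_max_iff_disj\<close>)
qed

lemma variation_upper:
  assumes "cont u" "cont v" "\<And>x. x \<in> topspace T \<Longrightarrow> \<bar>v x\<bar> \<le> u x"
  shows "\<Lambda> v \<le> variation u"
  unfolding variation_def
proof (rule cSUP_upper)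
  show "v \<in> {v. cont v \<and> (\<forall>x\<in>topspace T. \<bar>v x\<bar> \<le> u x)}" using assms by blast
  obtain B where B: "0 \<le> B" "\<And>x. x \<in> topspace T \<Longrightarrow> \<bar>u x\<bar> \<le> B" by (rule cont_bounded[OF assms(1)]) (rule that)
  show "bdd_above (\<Lambda> ` {v. cont v \<and> (\<forall>x\<in>topspace T. \<bar>v x\<bar> \<le> u x)})"
  proof (rule bdd_aboveI2)
    fix v assume v: "v \<in> {v. cont v \<and> (\<forall>x\<in>topspace T. \<bar>v x\<bar> \<le> u x)}"
    have "\<bar>v x\<bar> \<le> B" if "x \<in> topspace T" for x using v B(2)[OF that] that by force
    then have "\<bar>\<Lambda> v\<bar> \<le> C * B" using v B(1) by (intro bound) auto
    then show "\<Lambda> v \<le> C * B" by simp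
  qed
qed

lemma variation_least:
  assumes "\<And>x. x \<in> topspace T \<Longrightarrow> 0 \<le> u x"
    and "\<And>v. cont v \<Longrightarrow> (\<And>x. x \<in> topspace T \<Longrightarrow> \<bar>v x\<bar> \<le> u x) \<Longrightarrow> \<Lambda> v \<le> b"
  shows "variation u \<le> b"
  unfolding variation_def
proof (rule cSUP_least)
  have "(\<lambda>_. 0) \<in> {v. cont v \<and> (\<forall>x\<in>topspace T. \<bar>v x\<bar> \<le> u x)}" using assms(1) by simp
  then show "{v. cont v \<and> (\<forall>x\<in>topspace T. \<bar>v x\<bar> \<le> u x)} \<noteq> {}" by blast
qed (use assms(2) in blast)

lemma abs_le_variation:
  assumes "cont v"
  shows "\<bar>\<Lambda> v\<bar> \<le> variation (\<lambda>x. \<bar>v x\<bar>)"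
proof -
  have a: "cont (\<lambda>x. \<bar>v x\<bar>)" using assms by (rule continuous_map_real_abs)
  have "\<Lambda> v \<le> variation (\<lambda>x. \<bar>v x\<bar>)" by (rule variation_upper[OF a assms]) simp
  moreover have "cont (\<lambda>x. (-1) * v x)" using assms by (intro continuous_map_real_mult) auto
  then have "\<Lambda> (\<lambda>x. (-1) * v x) \<le> variation (\<lambda>x. \<bar>v x\<bar>)" by (rule variation_upper[OF a]) simp
  then have "- \<Lambda> v \<le> variation (\<lambda>x. \<bar>v x\<bar>)" using scale[OF assms, of "-1"] by simp
  ultimately show ?thesis by simp
qed

lemma variation_le_bound:
  assumes "cont u" "\<And>x. x \<in> topspace T \<Longrightarrow> 0 \<le> u x \<and> u x \<le> B" "0 \<le> B"
  shows "variation u \<le> C * B"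
proof (rule variation_least)
  fix v assume v: "cont v" "\<And>x. x \<in> topspace T \<Longrightarrow> \<bar>v x\<bar> \<le> u x"
  have "\<bar>\<Lambda> v\<bar> \<le> C * B"
    by (rule bound[OF v(1) _ assms(3)]) (use v(2) assms(2) order_trans in blast)
  then show "\<Lambda> v \<le> C * B" by simp
qed (use assms(2) in blast)

text \<open>Riesz decomposition: truncating \<open>v\<close> to the band between \<open>- u\<close>
  and \<open>u\<close> leaves a remainder dominated by \<open>w\<close>, and both pieces are
  continuous.\<close>

lemma variation_subadd:
  assumes u: "cont u" "\<And>x. x \<in> topspace T \<Longrightarrow> 0 \<le> u x" and w: "cont w" "\<And>x. x \<in> topspace T \<Longrightarrow> 0 \<le> w x"
  shows "variation (\<lambda>x. u x + w x) \<le> variation u + variation w"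
proof (rule variation_least)
  fix v assume v: "cont v" "\<And>x. x \<in> topspace T \<Longrightarrow> \<bar>v x\<bar> \<le> u x + w x"
  define a where "a x = max (- u x) (min (v x) (u x))" for x
  have ca: "cont a" unfolding a_def
    using u(1) v(1) by (intro continuous_map_real_max continuous_map_real_min continuous_map_minus)
  have cb: "cont (\<lambda>x. v x - a x)" using v(1) ca by (rule continuous_map_diff)
  have "\<Lambda> v = \<Lambda> a + \<Lambda> (\<lambda>x. v x - a x)" using add[OF ca cb] by simp
  also have "\<dots> \<le> variation u + variation w"
  proof (intro add_mono variation_upper u(1) w(1) ca cb)
    fix x assume x: "x \<in> topspace T"
    show "\<bar>a x\<bar> \<le> u x" using u(2)[OF x] by (auto simp: a_def)
    show "\<bar>v x - a x\<bar> \<le> w x" using u(2)[OF x] w(2)[OF x] v(2)[OF x] by (auto simp: a_def max_def min_def)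
  qed
  finally show "\<Lambda> v \<le> variation u + variation w" .
qed (use u(2) w(2) in simp)

lemma variation_superadd:
  assumes u: "cont u" "\<And>x. x \<in> topspace T \<Longrightarrow> 0 \<le> u x" and w: "cont w" "\<And>x. x \<in> topspace T \<Longrightarrow> 0 \<le> w x"
  shows "variation u + variation w \<le> variation (\<lambda>x. u x + w x)"
proof -
  have c: "cont (\<lambda>x. u x + w x)" using u(1) w(1) by (rule continuous_map_add)
  have *: "variation u \<le> variation (\<lambda>x. u x + w x) - \<Lambda> b"
    if b: "cont b" "\<And>x. x \<in> topspace T \<Longrightarrow> \<bar>b x\<bar> \<le> w x" for b
  proof (rule variation_least[OF u(2)])
    fix a assume a: "cont a" "\<And>x. x \<in> topspace T \<Longrightarrow> \<bar>a x\<bar> \<le> u x"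
    have "\<Lambda> (\<lambda>x. a x + b x) \<le> variation (\<lambda>x. u x + w x)"
    proof (rule variation_upper[OF c continuous_map_add[OF a(1) b(1)]])
      fix x assume "x \<in> topspace T"
      then show "\<bar>a x + b x\<bar> \<le> u x + w x" using a(2)[of x] b(2)[of x] abs_triangle_ineq[of "a x" "b x"] by simp
    qed
    then show "\<Lambda> a \<le> variation (\<lambda>x. u x + w x) - \<Lambda> b" using add[OF a(1) b(1)] by simp
  qed
  have "variation w \<le> variation (\<lambda>x. u x + w x) - variation u"
  proof (rule variation_least[OF w(2)])
    fix b assume "cont b" "\<And>x. x \<in> topspace T \<Longrightarrow> \<bar>b x\<bar> \<le> w x"
    from *[OF this] show "\<Lambda> b \<le> variation (\<lambda>x. u x + w x) - variation u" by simp
  qed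
  then show ?thesis by simp
qed

lemma Dini_decreasing:
  assumes f: "\<And>n. cont (f n)" and dec: "\<And>n x. x \<in> topspace T \<Longrightarrow> f (Suc n) x \<le> f n x"
    and lim: "\<And>x. x \<in> topspace T \<Longrightarrow> \<exists>n. f n x < e"
  shows "\<exists>n. \<forall>x\<in>topspace T. f n x < e"
proof (rule ccontr)
  assume neg: "\<not> ?thesis"
  define A where "A n = {x \<in> topspace T. f n x \<in> {e..}}" for n
  have "\<Inter>(range A) \<noteq> {}"
  proof (rule compact_space_chain_Inter[OF compact_T])
    show "\<forall>B\<in>range A. closedin T B \<and> B \<noteq> {}"
    proof
      fix B assume "B \<in> range A"
      then obtain n where n: "B = A n" by blast
      obtain x where "x \<in> topspace T" "e \<le> f n x" using neg by (meson not_le)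
      then have "A n \<noteq> {}" by (auto simp: A_def)
      then show "closedin T B \<and> B \<noteq> {}"
        unfolding n A_def using closedin_Collect_mem[OF f closed_atLeast] by blast
    qed
    have "A (Suc n) \<subseteq> A n" for n by (auto simp: A_def intro: order_trans[OF _ dec])
    then have "A n \<subseteq> A m" if "m \<le> n" for m n using lift_Suc_antimono_le[of A, OF _ that] by blast
    then have "A m \<subseteq> A n \<or> A n \<subseteq> A m" for m n using nat_le_linear by blast
    then show "\<forall>B\<in>range A. \<forall>D\<in>range A. B \<subseteq> D \<or> D \<subseteq> B" by blast
  qed
  then obtain x where "\<And>n. x \<in> A n" by blast
  then have "x \<in> topspace T" "\<And>n. e \<le> f n x" by (auto simp: A_def)
  then show False using lim by (meson not_le)
qed

text \<open>Luxemburg's argument: near-maximal elements \<open>g n\<close> of the decreasing classes \<open>\<G> n\<close> have minima that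
  decrease to zero, so that Dini's theorem applies.\<close>

lemma bounded_convergence:
  assumes h: "\<And>n. cont (h n)" and B: "\<And>n x. x \<in> topspace T \<Longrightarrow> \<bar>h n x\<bar> \<le> B"
    and lim: "\<And>x. x \<in> topspace T \<Longrightarrow> (\<lambda>n. h n x) \<longlonglongrightarrow> 0"
  shows "(\<lambda>n. \<Lambda> (h n)) \<longlonglongrightarrow> 0"
proof (cases "topspace T = {}")
  case True
  have "\<bar>\<Lambda> (h n)\<bar> \<le> C * 0" for n by (rule bound[OF h]) (use True in auto)
  then show ?thesis by simp
next
  case False
  then have B0: "0 \<le> B" using B by (meson abs_ge_zero ex_in_conv order_trans)
  \<comment> \<open>The tail supremum decreases to 0 but need not be continuous, so Dini's theorem
    cannot be applied to it. The classes \<open>\<G> n\<close> consist of its continuous nonnegative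
    minorants.\<close>
  define s where "s n x = (SUP i\<in>{n..}. \<bar>h i x\<bar>)" for n x
  have bdd: "bdd_above ((\<lambda>i. \<bar>h i x\<bar>) ` {n..})" if "x \<in> topspace T" for x n
    using B[OF that] by (intro bdd_aboveI2) auto
  have s_upper: "\<bar>h i x\<bar> \<le> s n x" if "x \<in> topspace T" "n \<le> i" for x n i
    unfolding s_def by (rule cSUP_upper[OF _ bdd[OF that(1)]]) (use that in simp)
  have s_least: "s n x \<le> b" if "\<And>i. n \<le> i \<Longrightarrow> \<bar>h i x\<bar> \<le> b" for n x b
    unfolding s_def by (rule cSUP_least) (use that in auto)
  have s_Suc: "s (Suc n) x \<le> s n x" if "x \<in> topspace T" for n x
    by (rule s_least) (use s_upper[OF that] in simp)
  have s_B: "s n x \<le> B" if "x \<in> topspace T" for n x using B[OF that] by (rule s_least)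
  define \<G> where "\<G> n = {g. cont g \<and> (\<forall>x\<in>topspace T. 0 \<le> g x \<and> g x \<le> s n x)}" for n
  have h_G: "(\<lambda>x. \<bar>h n x\<bar>) \<in> \<G> n" for n
    using s_upper h by (auto simp: \<G>_def intro: continuous_map_real_abs)
  have G_Suc: "\<G> (Suc n) \<subseteq> \<G> n" for n
    by (auto simp: \<G>_def intro: order_trans[OF _ s_Suc])
  define a where "a n = (SUP g\<in>\<G> n. variation g)" for n
  have a_upper: "variation g \<le> a n" if "g \<in> \<G> n" for g n
    unfolding a_def
  proof (rule cSUP_upper[OF that])
    show "bdd_above (variation ` \<G> n)"
    proof (rule bdd_aboveI2)
      fix g assume "g \<in> \<G> n"
      then show "variation g \<le> C * B"
        using s_B B0 by (intro variation_le_bound) (auto simp: \<G>_def intro: order_trans)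
    qed
  qed
  show ?thesis
  proof (rule LIMSEQ_I)
    fix e :: real assume e: "0 < e"
    \<comment> \<open>The tolerances form a geometric series whose partial sums stay below
      \<open>e / 4\<close>.\<close>
    have "\<exists>g\<in>\<G> n. a n - e / 4 / 2 ^ Suc n < variation g" for n
    proof -
      have "a n - e / 4 / 2 ^ Suc n < (SUP g\<in>\<G> n. variation g)" using e by (simp add: a_def)
      moreover have "variation ` \<G> n \<noteq> {}" using h_G by blast
      ultimately show ?thesis using less_cSupD[of "variation ` \<G> n"] by simp
    qed
    then obtain g where g: "\<And>n. g n \<in> \<G> n" "\<And>n. a n - e / 4 / 2 ^ Suc n < variation (g n)" by metis
    have cg: "cont (g n)" and g0: "\<And>x. x \<in> topspace T \<Longrightarrow> 0 \<le> g n x" and gs: "\<And>x. x \<in> topspace T \<Longrightarrow> g n x \<le> s n x" for n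
      using g(1)[of n] by (auto simp: \<G>_def)
    define f where "f = rec_nat (g 0) (\<lambda>n fn x. min (fn x) (g (Suc n) x))"
    have f_0: "f 0 = g 0" and f_Suc: "f (Suc n) = (\<lambda>x. min (f n x) (g (Suc n) x))" for n
      by (simp_all add: f_def)
    have cf: "cont (f n)" for n
      by (induction n) (auto simp: f_0 f_Suc intro: continuous_map_real_min cg)
    have f0: "0 \<le> f n x" if "x \<in> topspace T" for n x
      by (induction n) (auto simp: f_0 f_Suc g0 that)
    have fg: "f n x \<le> g n x" if "x \<in> topspace T" for n x
      by (cases n) (auto simp: f_0 f_Suc)
    have main: "a n - (\<Sum>i\<le>n. e / 4 / 2 ^ Suc i) \<le> variation (f n)" for n
    proof (induction n)
      case 0
      then show ?case using g(2)[of 0] by (simp add: f_0)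
    next
      case (Suc n)
      \<comment> \<open>The maximum still lies in \<open>\<G> n\<close>, so its variation is at most
        \<open>a n\<close>. As maximum plus minimum equals \<open>f n + g (Suc n)\<close>,
        additivity of the variation shows that passing to the minimum adds only the tolerance of
        \<open>g (Suc n)\<close> to the deficit.\<close>
      define m where "m x = max (f n x) (g (Suc n) x)" for x
      have cm: "cont m" unfolding m_def by (intro continuous_map_real_max cf cg)
      have "m \<in> \<G> n"
      proof -
        have "g (Suc n) x \<le> s n x" if "x \<in> topspace T" for x
          using gs[OF that, of "Suc n"] s_Suc[OF that, of n] by simp
        moreover have "f n x \<le> s n x" if "x \<in> topspace T" for x
          using fg[OF that, of n] gs[OF that, of n] by simp
        ultimately show ?thesis using cm f0 by (auto simp: \<G>_def m_def le_max_iff_disj)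
      qed
      then have am: "variation m \<le> a n" by (rule a_upper)
      have cd: "cont (\<lambda>x. m x - f n x)" using cm cf by (rule continuous_map_diff)
      have d0: "0 \<le> m x - f n x" for x by (simp add: m_def)
      have "variation (\<lambda>x. m x - f n x) + variation (f n) \<le> variation (\<lambda>x. (m x - f n x) + f n x)"
        by (rule variation_superadd[OF cd d0 cf f0])
      then have 1: "variation (\<lambda>x. m x - f n x) \<le> a n - variation (f n)" using am by simp
      have "variation (\<lambda>x. f (Suc n) x + (m x - f n x)) \<le> variation (f (Suc n)) + variation (\<lambda>x. m x - f n x)"
        by (rule variation_subadd[OF cf f0 cd d0])
      moreover have "(\<lambda>x. f (Suc n) x + (m x - f n x)) = g (Suc n)"
        by (auto simp: f_Suc m_def fun_eq_iff min_def max_def)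
      ultimately have "variation (g (Suc n)) \<le> variation (f (Suc n)) + variation (\<lambda>x. m x - f n x)" by simp
      then show ?case using 1 Suc g(2)[of "Suc n"] by simp
    qed
    have geometric: "(\<Sum>i\<le>n. e / 4 / 2 ^ Suc i) \<le> e / 4" for n
    proof -
      have "(\<Sum>i\<le>n. e / 4 / 2 ^ Suc i) = e / 4 - e / 4 / 2 ^ Suc n"
        by (induction n) (simp_all add: field_simps)
      then show ?thesis using e by simp
    qed
    define \<delta> where "\<delta> = e / (4 * (C + 1))"
    have \<delta>: "0 < \<delta>" using e C_nonneg by (simp add: \<delta>_def)
    have C\<delta>: "C * \<delta> \<le> e / 4"
    proof -
      have "C * \<delta> \<le> (C + 1) * \<delta>" using \<delta> by (intro mult_right_mono) auto
      also have "\<dots> = e / 4" using C_nonneg by (simp add: \<delta>_def field_simps)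
      finally show ?thesis .
    qed
    have "\<exists>N. \<forall>x\<in>topspace T. f N x < \<delta>"
    proof (rule Dini_decreasing[OF cf])
      show "f (Suc n) x \<le> f n x" for n x by (simp add: f_Suc)
      fix x assume x: "x \<in> topspace T"
      obtain N where N: "\<And>i. N \<le> i \<Longrightarrow> \<bar>h i x\<bar> < \<delta> / 2"
        using LIMSEQ_D[OF lim[OF x], of "\<delta> / 2"] \<delta> by auto
      have "s N x \<le> \<delta> / 2" by (rule s_least) (use N in force)
      then have "f N x < \<delta>" using fg[OF x, of N] gs[OF x, of N] \<delta> by simp
      then show "\<exists>n. f n x < \<delta>" by blast
    qed
    then obtain N where N: "\<And>x. x \<in> topspace T \<Longrightarrow> f N x < \<delta>" by blast
    have f_mono: "f n x \<le> f N x" if "N \<le> n" for n x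
      using that by (induction n rule: dec_induct) (auto simp: f_Suc)
    have "norm (\<Lambda> (h n) - 0) < e" if n: "N \<le> n" for n
    proof -
      have "variation (f n) \<le> C * \<delta>"
      proof (rule variation_le_bound[OF cf])
        show "0 \<le> f n x \<and> f n x \<le> \<delta>" if x: "x \<in> topspace T" for x
          using f0[OF x, of n] N[OF x] f_mono[OF n, of x] by linarith
      qed (use \<delta> in simp)
      then have "a n \<le> e / 4 + e / 4" using main[of n] geometric[of n] C\<delta> by simp
      moreover have "\<bar>\<Lambda> (h n)\<bar> \<le> a n" using abs_le_variation[OF h] a_upper[OF h_G] by (rule order_trans)
      ultimately show ?thesis using e by simp
    qed
    then show "\<exists>N. \<forall>n\<ge>N. norm (\<Lambda> (h n) - 0) < e" by blast
  qed
qed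

end

text \<open>Bounds that hold eventually pass to cluster points, which takes the place of taking
  limits along subsequences.\<close>

lemma cluster_point_le:
  fixes a :: "nat \<Rightarrow> 'x"
  assumes c: "\<And>m. c \<in> X closure_of (a ` {m..})" and F: "continuous_map X euclideanreal F"
    and le: "\<And>n. m \<le> n \<Longrightarrow> F (a n) \<le> b"
  shows "F c \<le> b"
proof -
  have "F ` (X closure_of (a ` {m..})) \<subseteq> euclidean closure_of (F ` a ` {m..})"
    using F by (rule continuous_map_image_closure_subset)
  then have "F c \<in> closure (F ` a ` {m..})" using c[of m] by auto
  also have "\<dots> \<subseteq> {..b}" using le by (intro closure_minimal) auto
  finally show ?thesis by simp
qed

section \<open>Grothendieck's theorem on pointwise compact sets of maps\<close>

context bounded_functional
begin

text \<open>Grothendieck: a functional on continuous functions is continuous for the pointwise topology on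
  pointwise compact sets.  The points \<open>D n\<close> are chosen so that the sequence \<open>g n\<close> taken from \<open>A\<close>
  can only cluster at \<open>g0\<close>.\<close>

lemma continuous_on_pointwise_compact:
  assumes E: "compactin (product_topology (\<lambda>_. T) (topspace T)) E"
    and cont_E: "\<And>g. g \<in> E \<Longrightarrow> continuous_map T T g" and u: "cont u"
  shows "continuous_map (subtopology (product_topology (\<lambda>_. T) (topspace T)) E) euclideanreal
    (\<lambda>g. \<Lambda> (\<lambda>y. u (g y)))"
proof (rule continuous_map_subset_aux2, intro allI impI funcsetI)
  define PT where "PT = product_topology (\<lambda>_. T) (topspace T)"
  define X where "X = subtopology PT E"
  have EP: "E \<subseteq> topspace PT" using E unfolding PT_def by (rule compactin_subset_topspace)
  have topX: "topspace X = E" using EP by (auto simp: X_def)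
  have compactX: "compact_space X" using E by (simp add: X_def PT_def compact_space_subtopology)
  have EK: "g y \<in> topspace T" if "g \<in> E" "y \<in> topspace T" for g y
    using EP that by (auto simp: PT_def)
  have cont_eval: "continuous_map X euclideanreal (\<lambda>g. u (g y))" if y: "y \<in> topspace T" for y
  proof -
    have "continuous_map X T (\<lambda>g. g y)"
      unfolding X_def PT_def using y by (intro continuous_map_from_subtopology continuous_map_product_projection)
    from continuous_map_compose[OF this u] show ?thesis by (simp add: comp_def)
  qed
  have cont_u: "cont (\<lambda>y. u (g y))" if "g \<in> E" for g
    using continuous_map_compose[OF cont_E[OF that] u] by (simp add: comp_def)
  obtain B where B: "0 \<le> B" "\<And>x. x \<in> topspace T \<Longrightarrow> \<bar>u x\<bar> \<le> B" by (rule cont_bounded[OF u]) (rule that)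
  \<comment> \<open>Continuity is checked through closures: the value at each closure point
    \<open>g0\<close> of an arbitrary \<open>A\<close> must lie in the closure of the values on
    \<open>A\<close>. It suffices to find a sequence in \<open>A\<close> along which the functional
    converges to its value at \<open>g0\<close>.\<close>
  fix A g0
  assume "A \<subseteq> topspace (subtopology (product_topology (\<lambda>_. T) (topspace T)) E)"
    and "g0 \<in> subtopology (product_topology (\<lambda>_. T) (topspace T)) E closure_of A"
  then have AE: "A \<subseteq> E" and g0_cl: "g0 \<in> X closure_of A" using topX by (auto simp: X_def PT_def)
  have g0: "g0 \<in> E" using g0_cl closure_of_subset_topspace topX by fast
  define net where "net n L D \<longleftrightarrow> (\<forall>y\<in>topspace T. \<exists>z\<in>D. \<forall>g\<in>L. \<bar>u (g y) - u (g z)\<bar> < 1 / real (Suc n))"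
    for n :: nat and L :: "('p \<Rightarrow> 'p) set" and D :: "'p set"
  have net_exists: "\<exists>D. finite D \<and> D \<subseteq> topspace T \<and> net n L D" if L: "finite L" "L \<subseteq> E" for n L
  proof -
    have bd: "\<bar>u (g y)\<bar> \<le> B" if "g \<in> L" "y \<in> topspace T" for g y
      using B(2)[OF EK, of g y] that L(2) by blast
    obtain D where "finite D" "D \<subseteq> topspace T"
      "\<And>y. y \<in> topspace T \<Longrightarrow> \<exists>z\<in>D. \<forall>g\<in>L. \<bar>u (g y) - u (g z)\<bar> < 1 / real (Suc n)"
      by (rule finite_net[OF L(1), of "topspace T" "\<lambda>g y. u (g y)" "\<lambda>_. B" "1 / real (Suc n)"])
        (use bd in \<open>auto intro: that\<close>)
    then show ?thesis unfolding net_def by blast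
  qed
  have near: "\<exists>g\<in>A. \<forall>z\<in>D. \<bar>u (g z) - u (g0 z)\<bar> < e" if D: "finite D" "D \<subseteq> topspace T" and e: "0 < e" for D e
  proof -
    define N where "N = E \<inter> (\<Inter>z\<in>D. {g \<in> topspace X. u (g z) \<in> ball (u (g0 z)) e})"
    have "openin X N"
    proof (cases "D = {}")
      case True
      then show ?thesis using openin_topspace[of X] topX by (simp add: N_def)
    next
      case False
      have "openin X (\<Inter>z\<in>D. {g \<in> topspace X. u (g z) \<in> ball (u (g0 z)) e})"
        using D False by (intro openin_INT2 openin_Collect_mem cont_eval) auto
      then show ?thesis using openin_topspace[of X] unfolding N_def topX by (rule openin_Int[rotated])
    qed
    moreover have "g0 \<in> N" using g0 e topX by (auto simp: N_def)
    ultimately obtain g where "g \<in> A" "g \<in> N" using g0_cl unfolding in_closure_of by blast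
    then show ?thesis by (intro bexI[of _ g]) (auto simp: N_def dist_real_def abs_minus_commute)
  qed
  \<comment> \<open>A state holds the current map \<open>g\<close> from \<open>A\<close>, the finite
    set \<open>L\<close> of maps met so far including \<open>g0\<close>, and a finite set
    \<open>D\<close> imitating every point of the space for all of \<open>L\<close>. The next map is
    chosen close to \<open>g0\<close> on \<open>D\<close>.\<close>
  define P where "P n st \<longleftrightarrow> (case st of (g, L, D) \<Rightarrow>
      g \<in> A \<and> g \<in> L \<and> g0 \<in> L \<and> finite L \<and> L \<subseteq> E \<and> finite D \<and> D \<subseteq> topspace T \<and> net n L D)"
    for n :: nat and st :: "('p \<Rightarrow> 'p) \<times> ('p \<Rightarrow> 'p) set \<times> 'p set"
  define R where "R n st st' \<longleftrightarrow> (case (st, st') of ((g, L, D), (g', L', D')) \<Rightarrow>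
      L \<subseteq> L' \<and> D \<subseteq> D' \<and> (\<forall>z\<in>D. \<bar>u (g' z) - u (g0 z)\<bar> < 1 / real (Suc n)))"
    for n :: nat and st st' :: "('p \<Rightarrow> 'p) \<times> ('p \<Rightarrow> 'p) set \<times> 'p set"
  have "\<exists>f. \<forall>n. P n (f n) \<and> R n (f n) (f (Suc n))"
  proof (rule dependent_nat_choice)
    obtain g where g: "g \<in> A" using near[of "{}" 1] by auto
    then have L: "finite {g, g0}" "{g, g0} \<subseteq> E" using AE g0 by auto
    then obtain D where "finite D" "D \<subseteq> topspace T" "net 0 {g, g0} D"
      using net_exists[OF L, of 0] by blast
    then have "P 0 (g, {g, g0}, D)" using g L by (simp add: P_def)
    then show "\<exists>st. P 0 st" by blast
    fix st n assume "P n st"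
    then obtain g L D where st: "st = (g, L, D)" and L: "g0 \<in> L" "finite L" "L \<subseteq> E"
      and D: "finite D" "D \<subseteq> topspace T" by (cases st) (auto simp: P_def)
    obtain g' where g': "g' \<in> A" "\<forall>z\<in>D. \<bar>u (g' z) - u (g0 z)\<bar> < 1 / real (Suc n)"
      using near[OF D, of "1 / real (Suc n)"] by auto
    have L': "finite (insert g' L)" "insert g' L \<subseteq> E" using L g' AE by auto
    then obtain D' where D': "finite D'" "D' \<subseteq> topspace T" "net (Suc n) (insert g' L) D'"
      using net_exists[OF L', of "Suc n"] by blast
    then have "net (Suc n) (insert g' L) (D \<union> D')" unfolding net_def by blast
    then have "P (Suc n) (g', insert g' L, D \<union> D')" using g' L L' D D' by (simp add: P_def)
    moreover have "R n st (g', insert g' L, D \<union> D')" using g' by (auto simp: R_def st)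
    ultimately show "\<exists>st'. P (Suc n) st' \<and> R n st st'" by blast
  qed
  then obtain f where f: "\<And>n. P n (f n)" "\<And>n. R n (f n) (f (Suc n))" by blast
  define g where "g n = fst (f n)" for n
  define L where "L n = fst (snd (f n))" for n
  define D where "D n = snd (snd (f n))" for n
  have fn: "f n = (g n, L n, D n)" for n by (simp add: g_def L_def D_def)
  have gA: "g n \<in> A" and gL: "g n \<in> L n" and g0L: "g0 \<in> L n" and LE: "L n \<subseteq> E"
    and DT: "D n \<subseteq> topspace T" and netD: "net n (L n) (D n)" for n
    using f(1)[of n] by (auto simp: P_def fn)
  have L_Suc: "L n \<subseteq> L (Suc n)" and D_Suc: "D n \<subseteq> D (Suc n)"
    and close: "z \<in> D n \<Longrightarrow> \<bar>u (g (Suc n) z) - u (g0 z)\<bar> < 1 / real (Suc n)" for n z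
    using f(2)[of n] by (auto simp: R_def fn)
  have L_mono: "L m \<subseteq> L n" if "m \<le> n" for m n using lift_Suc_mono_le[of L, OF L_Suc that] .
  have D_mono: "D m \<subseteq> D n" if "m \<le> n" for m n using lift_Suc_mono_le[of D, OF D_Suc that] .
  have gE: "g n \<in> E" for n using gA AE by blast
  have inverse_small: "\<exists>m. 1 / real (Suc m) < e" if "0 < e" for e :: real
    using reals_Archimedean[OF that] by (simp add: inverse_eq_divide)
  \<comment> \<open>Otherwise some cluster point \<open>h\<close> of the sequence differs from
    \<open>g0\<close> at \<open>y\<close>. Points of \<open>D n\<close> that imitate
    \<open>y\<close> cluster at some \<open>z\<close>, and limits give
    \<open>u (h y) = u (h z) = u (g0 z) = u (g0 y)\<close>, a contradiction.\<close>
  have pointwise: "(\<lambda>n. u (g n y)) \<longlonglongrightarrow> u (g0 y)" if y: "y \<in> topspace T" for y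
  proof (rule ccontr)
    assume "\<not> ?thesis"
    then obtain e where e: "0 < e" "\<forall>N. \<exists>n\<ge>N. e \<le> \<bar>u (g n y) - u (g0 y)\<bar>"
      unfolding lim_sequentially dist_real_def by (meson not_le)
    then obtain \<sigma> where \<sigma>: "\<And>N. N \<le> \<sigma> N" "\<And>N. e \<le> \<bar>u (g (\<sigma> N) y) - u (g0 y)\<bar>" by metis
    have "g (\<sigma> n) \<in> topspace X" for n using gE topX by simp
    then obtain h where h: "h \<in> topspace X" "\<And>m. h \<in> X closure_of ((\<lambda>n. g (\<sigma> n)) ` {m..})"
      using compact_space_sequence_cluster[OF compactX, of "\<lambda>n. g (\<sigma> n)"] by metis
    have hE: "h \<in> E" using h(1) topX by simp
    have "- \<bar>u (h y) - u (g0 y)\<bar> \<le> - e"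
    proof (rule cluster_point_le[OF h(2), of _ 0])
      show "continuous_map X euclideanreal (\<lambda>g. - \<bar>u (g y) - u (g0 y)\<bar>)"
        using cont_eval[OF y] by (intro continuous_intros) auto
    qed (use \<sigma>(2) in simp)
    then have far: "e \<le> \<bar>u (h y) - u (g0 y)\<bar>" by simp
    have h_D: "u (h z) = u (g0 z)" if z: "z \<in> D k" for z k
    proof -
      have zT: "z \<in> topspace T" using z DT by blast
      have "\<bar>u (h z) - u (g0 z)\<bar> \<le> 0"
      proof (rule field_le_epsilon)
        fix d :: real assume "0 < d"
        then obtain m where m: "1 / real (Suc m) < d" using inverse_small by blast
        have "\<bar>u (h z) - u (g0 z)\<bar> \<le> d"
        proof (rule cluster_point_le[OF h(2), of _ "Suc (max m k)"])
          show "continuous_map X euclideanreal (\<lambda>g. \<bar>u (g z) - u (g0 z)\<bar>)"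
            using cont_eval[OF zT] by (intro continuous_intros) auto
          fix n assume n: "Suc (max m k) \<le> n"
          \<comment> \<open>The map with index \<open>Suc j\<close> was chosen close to
            \<open>g0\<close> on \<open>D j\<close>, hence the shift by one.\<close>
          define j where "j = \<sigma> n - 1"
          have j: "\<sigma> n = Suc j" "max m k \<le> j" using n \<sigma>(1)[of n] by (auto simp: j_def)
          then have "z \<in> D j" using z D_mono[of k j] by auto
          then have "\<bar>u (g (\<sigma> n) z) - u (g0 z)\<bar> < 1 / real (Suc j)" using close j(1) by simp
          also have "\<dots> \<le> 1 / real (Suc m)" using j(2) by (intro divide_left_mono) auto
          finally show "\<bar>u (g (\<sigma> n) z) - u (g0 z)\<bar> \<le> d" using m by simp
        qed
        then show "\<bar>u (h z) - u (g0 z)\<bar> \<le> 0 + d" by simp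
      qed
      then show ?thesis by simp
    qed
    have "\<forall>n. \<exists>z\<in>D n. \<forall>g\<in>L n. \<bar>u (g y) - u (g z)\<bar> < 1 / real (Suc n)"
      using netD y unfolding net_def by blast
    then obtain \<zeta> where \<zeta>: "\<And>n. \<zeta> n \<in> D n"
      "\<And>n g. g \<in> L n \<Longrightarrow> \<bar>u (g y) - u (g (\<zeta> n))\<bar> < 1 / real (Suc n)" by metis
    have "\<zeta> n \<in> topspace T" for n using \<zeta>(1) DT by blast
    then obtain z where z: "z \<in> topspace T" "\<And>m. z \<in> T closure_of (\<zeta> ` {m..})"
      using compact_space_sequence_cluster[OF compact_T, of \<zeta>] by metis
    have same: "u (k y) = u (k z)" if k: "k \<in> L m" for k m
    proof -
      have kE: "k \<in> E" using k LE by blast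
      have "\<bar>u (k y) - u (k z)\<bar> \<le> 0"
      proof (rule field_le_epsilon)
        fix d :: real assume "0 < d"
        then obtain j where j: "1 / real (Suc j) < d" using inverse_small by blast
        have "\<bar>u (k y) - u (k z)\<bar> \<le> d"
        proof (rule cluster_point_le[OF z(2), of _ "max j m"])
          show "continuous_map T euclideanreal (\<lambda>z. \<bar>u (k y) - u (k z)\<bar>)"
            using cont_u[OF kE] by (intro continuous_intros) auto
          fix n assume n: "max j m \<le> n"
          then have "k \<in> L n" using k L_mono[of m n] by auto
          then have "\<bar>u (k y) - u (k (\<zeta> n))\<bar> < 1 / real (Suc n)" by (rule \<zeta>(2))
          also have "\<dots> \<le> 1 / real (Suc j)" using n by (intro divide_left_mono) auto
          finally show "\<bar>u (k y) - u (k (\<zeta> n))\<bar> \<le> d" using j by simp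
        qed
        then show "\<bar>u (k y) - u (k z)\<bar> \<le> 0 + d" by simp
      qed
      then show ?thesis by simp
    qed
    \<comment> \<open>Here continuity of the cluster map \<open>h\<close> enters: agreement with
      \<open>g0\<close> on the sets \<open>D n\<close> extends to the cluster point \<open>z\<close>
      of the \<open>\<zeta> n\<close>.\<close>
    have "\<bar>u (h z) - u (g0 z)\<bar> \<le> 0"
    proof (rule cluster_point_le[OF z(2), of _ 0])
      show "continuous_map T euclideanreal (\<lambda>z. \<bar>u (h z) - u (g0 z)\<bar>)"
        using cont_u[OF hE] cont_u[OF g0] by (intro continuous_intros) auto
    qed (use h_D[OF \<zeta>(1)] in simp)
    moreover have "\<bar>u (h y) - u (h z)\<bar> \<le> 0"
    proof (rule cluster_point_le[OF h(2), of _ 0])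
      show "continuous_map X euclideanreal (\<lambda>g. \<bar>u (g y) - u (g z)\<bar>)"
        using cont_eval[OF y] cont_eval[OF z(1)] by (intro continuous_intros) auto
    qed (use same[OF gL] in simp)
    ultimately show False using far e(1) same[OF g0L] by simp
  qed
  have c: "cont (\<lambda>y. (-1) * u (g0 y))" using cont_u[OF g0] by (intro continuous_map_real_mult) auto
  have "(\<lambda>n. \<Lambda> (\<lambda>y. u (g n y) + (-1) * u (g0 y))) \<longlonglongrightarrow> 0"
  proof (rule bounded_convergence)
    show "cont (\<lambda>y. u (g n y) + (-1) * u (g0 y))" for n
      using cont_u[OF gE] c by (rule continuous_map_add)
    show "\<bar>u (g n y) + (-1) * u (g0 y)\<bar> \<le> B + B" if y: "y \<in> topspace T" for n y
      using B(2)[OF EK[OF gE y], of n] B(2)[OF EK[OF g0 y]] by linarith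
    show "(\<lambda>n. u (g n y) + (-1) * u (g0 y)) \<longlonglongrightarrow> 0" if "y \<in> topspace T" for y
      using tendsto_add[OF pointwise[OF that] tendsto_const[of "(-1) * u (g0 y)"]] by simp
  qed
  moreover have "\<Lambda> (\<lambda>y. u (g n y) + (-1) * u (g0 y)) = \<Lambda> (\<lambda>y. u (g n y)) - \<Lambda> (\<lambda>y. u (g0 y))" for n
    using add[OF cont_u[OF gE] c] scale[OF cont_u[OF g0], of "-1"] by simp
  ultimately have "(\<lambda>n. \<Lambda> (\<lambda>y. u (g n y))) \<longlonglongrightarrow> \<Lambda> (\<lambda>y. u (g0 y))"
    by (simp add: LIM_zero_iff)
  then have "\<Lambda> (\<lambda>y. u (g0 y)) \<in> closure ((\<lambda>g. \<Lambda> (\<lambda>y. u (g y))) ` A)"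
    unfolding closure_sequential using gA by (intro exI[of _ "\<lambda>n. \<Lambda> (\<lambda>y. u (g n y))"]) auto
  then show "\<Lambda> (\<lambda>y. u (g0 y)) \<in> euclideanreal closure_of (\<lambda>g. \<Lambda> (\<lambda>y. u (g y))) ` A" by simp
qed

end

section \<open>Weak almost periodicity from the enveloping semigroup\<close>

context compact_system
begin

lemma orbit_functional_parts:
  assumes \<phi>: "\<phi> \<in> dual UNIV bc_scale norm" and x: "x \<in> topspace T" and P: "P = Re \<or> P = Im"
  obtains c where "bounded_functional T (\<lambda>u. P (\<phi> (orb (\<lambda>y. of_real (u y)) x))) c"
proof -
  obtain c where c: "\<And>h. norm (\<phi> h) \<le> c * norm h" using \<phi> unfolding dual_def by blast
  have add: "\<phi> (h + k) = \<phi> h + \<phi> k" and scale: "\<phi> (bc_scale z h) = z * \<phi> h" for h k z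
    using \<phi> by (auto simp: dual_def)
  have "bounded_functional T (\<lambda>u. P (\<phi> (orb (\<lambda>y. of_real (u y)) x))) \<bar>c\<bar>"
  proof
    fix u v :: "'p \<Rightarrow> real" and r :: real
    assume u: "continuous_map T euclideanreal u"
    show "P (\<phi> (orb (\<lambda>y. of_real (r * u y)) x)) = r * P (\<phi> (orb (\<lambda>y. of_real (u y)) x))"
      using orb_scale[OF C_of_real[OF u] x, of "of_real r"] P by (auto simp: scale)
    show "P (\<phi> (orb (\<lambda>y. of_real (u y + v y)) x)) =
        P (\<phi> (orb (\<lambda>y. of_real (u y)) x)) + P (\<phi> (orb (\<lambda>y. of_real (v y)) x))"
      if v: "continuous_map T euclideanreal v"
      using orb_add[OF C_of_real[OF u] C_of_real[OF v] x] P by (auto simp: add)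
    show "\<bar>P (\<phi> (orb (\<lambda>y. of_real (u y)) x))\<bar> \<le> \<bar>c\<bar> * B"
      if "\<And>y. y \<in> topspace T \<Longrightarrow> \<bar>u y\<bar> \<le> B" "0 \<le> B" for B
    proof -
      have "\<bar>P (\<phi> (orb (\<lambda>y. of_real (u y)) x))\<bar> \<le> norm (\<phi> (orb (\<lambda>y. of_real (u y)) x))"
        using P abs_Re_le_cmod abs_Im_le_cmod by auto
      also have "\<dots> \<le> c * norm (orb (\<lambda>y. of_real (u y)) x)" by (rule c)
      also have "\<dots> \<le> \<bar>c\<bar> * B"
        using that(1)[OF act_closed[OF x]]
        by (intro mult_mono norm_orb_le[OF C_of_real[OF u] x]) auto
      finally show ?thesis .
    qed
  qed (use compact_T in auto)
  then show thesis by (rule that)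
qed

text \<open>Grothendieck's argument is real, so both \<open>f\<close> and the values of
  \<open>\<phi>\<close> are split into real and imaginary parts and reassembled by complex
  linearity.\<close>

lemma continuous_functional_on_enveloping_semigroup:
  assumes \<phi>: "\<phi> \<in> dual UNIV bc_scale norm" and x: "x \<in> topspace T" and f: "C f"
    and E: "compactin (product_topology (\<lambda>_. T) (topspace T)) E" "\<And>g. g \<in> E \<Longrightarrow> continuous_map T T g"
  shows "continuous_map (subtopology (product_topology (\<lambda>_. T) (topspace T)) E) euclidean
    (\<lambda>g. \<phi> (orb (\<lambda>y. f (g y)) x))"
proof -
  let ?X = "subtopology (product_topology (\<lambda>_. T) (topspace T)) E"
  have part: "continuous_map ?X euclideanreal (\<lambda>g. P (\<phi> (orb (\<lambda>y. of_real (u (g y))) x)))"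
    if P: "P = Re \<or> P = Im" and u: "continuous_map T euclideanreal u" for P u
  proof -
    obtain c where "bounded_functional T (\<lambda>u. P (\<phi> (orb (\<lambda>y. of_real (u y)) x))) c"
      by (rule orbit_functional_parts[OF \<phi> x P]) (rule that)
    then show ?thesis using E u by (rule bounded_functional.continuous_on_pointwise_compact)
  qed
  have real: "continuous_map ?X euclidean (\<lambda>g. \<phi> (orb (\<lambda>y. of_real (u (g y))) x))"
    if u: "continuous_map T euclideanreal u" for u
  proof -
    have "continuous_on UNIV (\<lambda>p. Complex (fst p) (snd p))"
      unfolding Complex_eq by (intro continuous_intros)
    then have "continuous_map ?X euclidean (\<lambda>g. Complex (Re (\<phi> (orb (\<lambda>y. of_real (u (g y))) x)))
        (Im (\<phi> (orb (\<lambda>y. of_real (u (g y))) x))))"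
      by (intro continuous_map_euclidean_compose2[OF part[OF _ u] part[OF _ u]]) auto
    then show ?thesis by (simp only: complex.collapse)
  qed
  have re: "continuous_map T euclideanreal (\<lambda>y. Re (f y))" and im: "continuous_map T euclideanreal (\<lambda>y. Im (f y))"
    using f by (auto intro!: continuous_map_euclidean_compose[OF f] continuous_intros)
  have "continuous_map ?X euclidean (\<lambda>g. \<phi> (orb (\<lambda>y. of_real (Re (f (g y)))) x) +
      \<i> * \<phi> (orb (\<lambda>y. of_real (Im (f (g y)))) x))"
    by (intro continuous_map_euclidean_compose2[OF real[OF re] real[OF im], of "\<lambda>a b. a + \<i> * b"] continuous_intros)
  moreover have "\<phi> (orb (\<lambda>y. of_real (Re (f (g y)))) x) + \<i> * \<phi> (orb (\<lambda>y. of_real (Im (f (g y)))) x) =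
      \<phi> (orb (\<lambda>y. f (g y)) x)" if "g \<in> topspace ?X" for g
  proof -
    have g: "continuous_map T T g" using that E(2) by simp
    have cr: "C (\<lambda>y. of_real (Re (f (g y))))"
      using continuous_map_compose[OF g re] by (intro C_of_real) (simp add: comp_def)
    have ci: "C (\<lambda>y. of_real (Im (f (g y))))"
      using continuous_map_compose[OF g im] by (intro C_of_real) (simp add: comp_def)
    have ci': "C (\<lambda>y. \<i> * of_real (Im (f (g y))))" using ci by (intro C_mult) auto
    have "(\<lambda>y. f (g y)) = (\<lambda>y. of_real (Re (f (g y))) + \<i> * of_real (Im (f (g y))))"
      by (simp add: fun_eq_iff complex_eq_iff)
    then show ?thesis
      using orb_add[OF cr ci' x] orb_scale[OF ci x, of \<i>] \<phi> by (simp add: dual_def)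
  qed
  ultimately show ?thesis by (rule continuous_map_eq)
qed

text \<open>The enveloping semigroup is compact and maps continuously into the weak topology by
  sending \<open>g\<close> to the orbit function of \<open>f\<close> composed with \<open>g\<close>.
  The image is weakly compact, hence closed, and it contains all left translates.\<close>

lemma orb_in_WAP:
  assumes cont: "\<And>g. g \<in> enveloping_semigroup T act \<Longrightarrow> continuous_map T T g"
    and f: "C f" and x: "x \<in> topspace T"
  shows "orb f x \<in> WAP"
proof -
  define PT where "PT = product_topology (\<lambda>_. T) (topspace T)"
  define E where "E = enveloping_semigroup T act"
  define w where "w = induced_topology (dual (UNIV :: ('s \<Rightarrow>\<^sub>C complex) set) bc_scale norm)"
  have topw: "topspace w = UNIV" 
    by (auto simp: w_def induced_topology_def topspace_pullback_topology)
  have "compact_space PT" using compact_T by (simp add: PT_def compact_space_product_topology)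
  then have E: "compactin PT E"
    unfolding E_def enveloping_semigroup_def PT_def[symmetric] by (intro closedin_compact_space) auto
  have cont_w: "continuous_map (subtopology PT E) w (\<lambda>g. orb (\<lambda>y. f (g y)) x)"
    unfolding w_def
  proof (rule continuous_map_induced_topology)
    fix \<phi> :: "('s \<Rightarrow>\<^sub>C complex) \<Rightarrow> complex" assume "\<phi> \<in> dual UNIV bc_scale norm"
    then show "continuous_map (subtopology PT E) euclidean (\<lambda>g. \<phi> (orb (\<lambda>y. f (g y)) x))"
      using E cont unfolding PT_def E_def
      by (intro continuous_functional_on_enveloping_semigroup[OF _ x f]) auto
  qed
  define H where "H = (\<lambda>g. orb (\<lambda>y. f (g y)) x) ` E"
  have H: "compactin w H"
    unfolding H_def using E by (intro image_compactin[OF _ cont_w]) (simp add: compactin_subtopology)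
  have "Hausdorff_space w"
    unfolding Hausdorff_space_def
  proof (intro allI impI)
    fix h k :: "'s \<Rightarrow>\<^sub>C complex" assume "h \<in> topspace w \<and> k \<in> topspace w \<and> h \<noteq> k"
    then obtain t where t: "h t \<noteq> k t" using bcontfun_eqI by blast
    have "(\<lambda>h :: 's \<Rightarrow>\<^sub>C complex. h t) \<in> dual UNIV bc_scale norm"
      unfolding dual_def using norm_bounded
      by (auto simp: plus_bcontfun.rep_eq bc_scale.rep_eq intro!: exI[of _ 1])
    then have ev: "continuous_map w euclidean (\<lambda>h. apply_bcontfun h t)"
      unfolding w_def by (rule continuous_map_from_induced_topology)
    obtain U V where UV: "open U" "open V" "h t \<in> U" "k t \<in> V" "U \<inter> V = {}" using hausdorff[OF t] by blast
    have "openin w {h. apply_bcontfun h t \<in> U}" "openin w {h. apply_bcontfun h t \<in> V}"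
      using openin_Collect_mem[OF ev UV(1)] openin_Collect_mem[OF ev UV(2)] by (simp_all add: topw)
    then show "\<exists>U V. openin w U \<and> openin w V \<and> h \<in> U \<and> k \<in> V \<and> disjnt U V"
      using UV by (intro exI[of _ "{h. apply_bcontfun h t \<in> U}"] exI[of _ "{h. apply_bcontfun h t \<in> V}"]) (auto simp: disjnt_def)
  qed
  then have "closedin w H" using H by (rule compactin_imp_closedin)
  moreover have "range (\<lambda>s. left_translate s (orb f x)) \<subseteq> H"
  proof
    fix h assume "h \<in> range (\<lambda>s. left_translate s (orb f x))"
    then obtain s where s: "h = left_translate s (orb f x)" by blast
    have "range (\<lambda>s. restrict (act s) (topspace T)) \<subseteq> topspace PT"
      using act_closed by (auto simp: PT_def)
    then have r: "restrict (act s) (topspace T) \<in> E"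
      unfolding E_def enveloping_semigroup_def PT_def[symmetric] using closure_of_subset by blast
    have g: "C (\<lambda>y. f (restrict (act s) (topspace T) y))"
      using continuous_map_compose[OF cont[OF r[unfolded E_def]] f] by (simp add: comp_def)
    have "left_translate s (orb f x) = orb (\<lambda>y. f (restrict (act s) (topspace T) y)) x"
      by (rule bcontfun_eqI) (simp only: left_translate_orb[OF f x] orb_apply[OF C_act[OF f] x] orb_apply[OF g x],
        simp add: act_closed x)
    then show "h \<in> H" unfolding H_def s using r by (rule image_eqI)
  qed
  ultimately have "w closure_of range (\<lambda>s. left_translate s (orb f x)) \<subseteq> H" by (intro closure_of_minimal)
  then have "compactin w (w closure_of range (\<lambda>s. left_translate s (orb f x)))"
    using closed_compactin[OF H] by simp
  then show ?thesis by (simp add: WAP_def w_def)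
qed

end

section \<open>The fixed point theorem\<close>

text \<open>Pairs whose images under \<open>f\<close> are at least \<open>e\<close> apart form a
  compact set, and their differences form a compact set omitting 0. Its complement is the
  neighbourhood sought; it links additive equicontinuity of the action to \<open>f\<close>.\<close>

lemma uniformly_continuous_on_compact_fun:
  fixes f :: "('a \<Rightarrow> 'k::real_or_complex) \<Rightarrow> complex"
  assumes K: "compact K" and f: "continuous_on K f" and e: "0 < e"
  obtains U where "open U" "0 \<in> U" "\<And>x y. x \<in> K \<Longrightarrow> y \<in> K \<Longrightarrow> x - y \<in> U \<Longrightarrow> norm (f x - f y) < e"
proof -
  define P where "P = K \<times> K \<inter> (\<lambda>p. norm (f (fst p) - f (snd p))) -` {e..}"
  have "continuous_on (K \<times> K) (\<lambda>p. norm (f (fst p) - f (snd p)))"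
    by (intro continuous_intros continuous_on_compose2[OF f]) auto
  then have "closedin (top_of_set (K \<times> K)) P"
    unfolding P_def using closed_atLeast by (rule continuous_closedin_preimage)
  then have "compact P" using compact_Times[OF K K] closedin_compact by blast
  moreover have "continuous_on P (\<lambda>p. fst p - snd p)"
  proof (rule continuous_on_coordinatewise_then_product)
    fix i
    have "continuous_on P (\<lambda>p. fst p i)" "continuous_on P (\<lambda>p. snd p i)"
      by (rule continuous_on_product_then_coordinatewise, intro continuous_intros)+
    then show "continuous_on P (\<lambda>p. (fst p - snd p) i)"
      unfolding fun_diff_def by (rule continuous_on_diff)
  qed
  ultimately have "compact ((\<lambda>p. fst p - snd p) ` P)" by (intro compact_continuous_image)
  then have cl: "closed ((\<lambda>p. fst p - snd p) ` P)" by (rule compact_imp_closed_fun)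
  show thesis
  proof (rule that[of "- (\<lambda>p. fst p - snd p) ` P"])
    show "open (- (\<lambda>p. fst p - snd p) ` P)" using cl by (rule open_Compl)
    have "x \<noteq> y" if "(x, y) \<in> P" for x y using that e by (auto simp: P_def)
    then show "0 \<in> - (\<lambda>p. fst p - snd p) ` P" by force
    show "norm (f x - f y) < e" if "x \<in> K" "y \<in> K" "x - y \<in> - (\<lambda>p. fst p - snd p) ` P" for x y
    proof (rule ccontr)
      assume "\<not> ?thesis"
      then have "(x, y) \<in> P" using that by (simp add: P_def)
      then show False using that(3) by force
    qed
  qed
qed

theorem theorem4p8:
  fixes smul :: "'k::real_or_complex \<Rightarrow> 'a::banach \<Rightarrow> 'a"
    and K :: "('a \<Rightarrow> 'k) set"
    and act :: "'s::semitopological_semigroup \<Rightarrow> ('a \<Rightarrow> 'k) \<Rightarrow> ('a \<Rightarrow> 'k)"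
  assumes "banach_space_over smul"
    and "M_embedded smul"
    and "K \<noteq> {}"
    and "compactin (weak_star UNIV smul norm) K"
    and "convex_functionals K"
    and "dynamical_system (subtopology (weak_star UNIV smul norm) K) act"
    and "\<forall>s. nonexpansive_on (dual_norm UNIV norm) K (act s)"
    and "(has_left_invariant_mean (AP :: ('s \<Rightarrow>\<^sub>C complex) set) \<and>
            equicontinuous_on (weak_star UNIV smul norm) K act)
       \<or> (has_left_invariant_mean (WAP :: ('s \<Rightarrow>\<^sub>C complex) set) \<and>
            (\<forall>g \<in> enveloping_semigroup (subtopology (weak_star UNIV smul norm) K) act.
               continuous_map (subtopology (weak_star UNIV smul norm) K)
                              (subtopology (weak_star UNIV smul norm) K) g))
       \<or> has_left_invariant_mean (LMC :: ('s \<Rightarrow>\<^sub>C complex) set)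
       \<or> (has_left_invariant_mean (WAP \<inter> LUC :: ('s \<Rightarrow>\<^sub>C complex) set) \<and>
            (\<forall>g \<in> enveloping_semigroup (subtopology (weak_star UNIV smul norm) K) act.
               continuous_map (subtopology (weak_star UNIV smul norm) K)
                              (subtopology (weak_star UNIV smul norm) K) g) \<and>
            jointly_continuous (subtopology (weak_star UNIV smul norm) K) act)
       \<or> (has_left_invariant_mean (LUC :: ('s \<Rightarrow>\<^sub>C complex) set) \<and>
            jointly_continuous (subtopology (weak_star UNIV smul norm) K) act)"
  shows "fixed_points K act \<noteq> {} \<and>
    (\<exists>r. r ` K = fixed_points K act \<and>
         (\<forall>x\<in>K. r (r x) = r x) \<and>
         nonexpansive_on (dual_norm UNIV norm) K r)"
proof -
  interpret M_embedded_space smul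
    using assms(1,2) by (simp add: M_embedded_space_def M_embedded_space_axioms_def)
  have compact: "compact K" and K_dual: "K \<subseteq> X1"
    using assms(4) by (auto simp: weak_star_def compactin_subtopology)
  have top: "subtopology (weak_star UNIV smul norm) K = top_of_set K"
    using K_dual by (simp add: weak_star_def subtopology_subtopology inf_absorb2)
  note hyps = assms(6-8)[unfolded top]
  interpret S: compact_system "top_of_set K" act
  proof
    show "compact_space (top_of_set K)" using compact by (simp add: compact_space_subtopology)
    show "Hausdorff_space (top_of_set K)"
      by (rule Hausdorff_space_subtopology[OF Hausdorff_space_euclidean_fun])
  qed (rule hyps(1))
  have equi: "\<exists>G. openin (top_of_set K) G \<and> z \<in> G \<and> (\<forall>s. \<forall>y\<in>G. norm (f (act s y) - f (act s z)) < e)"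
    if eq: "equicontinuous_on (weak_star UNIV smul norm) K act" and f: "S.C f"
      and z: "z \<in> topspace (top_of_set K)" and e: "0 < e" for f z e
  proof -
    have cf: "continuous_on K f" using f by simp
    obtain U where U: "open U" "0 \<in> U" "\<And>x y. x \<in> K \<Longrightarrow> y \<in> K \<Longrightarrow> x - y \<in> U \<Longrightarrow> norm (f x - f y) < e"
      by (rule uniformly_continuous_on_compact_fun[OF compact cf e]) (rule that)
    have "openin (weak_star UNIV smul norm) (X1 \<inter> U)" "0 \<in> X1 \<inter> U"
      unfolding weak_star_def using U(1,2) X1.zero_mem by (auto simp: openin_open)
    moreover have "z \<in> K" using z by simp
    ultimately obtain G where G: "openin (top_of_set K) G" "z \<in> G" "\<And>s y. y \<in> G \<Longrightarrow> act s y - act s z \<in> X1 \<inter> U"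
      using eq unfolding equicontinuous_on_def top by metis
    have "G \<subseteq> K" using openin_subset[OF G(1)] by simp
    then show ?thesis using G U(3) S.act_closed z by (intro exI[of _ G]) auto
  qed
  \<comment> \<open>All five alternatives reduce to one statement: some space with a left invariant
    mean contains every orbit function.\<close>
  have "\<exists>Y. has_left_invariant_mean Y \<and> (\<forall>f x. S.C f \<longrightarrow> x \<in> topspace (top_of_set K) \<longrightarrow> S.orb f x \<in> Y)"
    using hyps(3)
  proof (elim disjE conjE)
    assume "has_left_invariant_mean (AP :: ('s \<Rightarrow>\<^sub>C complex) set)"
      and "equicontinuous_on (weak_star UNIV smul norm) K act"
    then show ?thesis by (intro exI[of _ AP] conjI allI impI S.orb_in_AP equi)
  next
    assume "has_left_invariant_mean (WAP :: ('s \<Rightarrow>\<^sub>C complex) set)"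
      "\<forall>g\<in>enveloping_semigroup (top_of_set K) act. continuous_map (top_of_set K) (top_of_set K) g"
    then show ?thesis by (intro exI[of _ WAP] conjI allI impI S.orb_in_WAP) blast+
  next
    assume "has_left_invariant_mean (LMC :: ('s \<Rightarrow>\<^sub>C complex) set)"
    then show ?thesis by (intro exI[of _ LMC] conjI allI impI S.orb_in_LMC)
  next
    assume "has_left_invariant_mean (WAP \<inter> LUC :: ('s \<Rightarrow>\<^sub>C complex) set)"
      "\<forall>g\<in>enveloping_semigroup (top_of_set K) act. continuous_map (top_of_set K) (top_of_set K) g"
      "jointly_continuous (top_of_set K) act"
    then show ?thesis
      by (intro exI[of _ "WAP \<inter> LUC"] conjI allI impI IntI S.orb_in_WAP S.orb_in_LUC) blast+
  next
    assume "has_left_invariant_mean (LUC :: ('s \<Rightarrow>\<^sub>C complex) set)"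
      "jointly_continuous (top_of_set K) act"
    then show ?thesis by (intro exI[of _ LUC] conjI allI impI S.orb_in_LUC)
  qed
  then obtain Y where Y: "has_left_invariant_mean Y"
    "\<And>f x. S.C f \<Longrightarrow> x \<in> topspace (top_of_set K) \<Longrightarrow> S.orb f x \<in> Y" by blast
  interpret N: nonexpansive_system smul K act
  proof
    show "compact K" "K \<subseteq> X1" by (fact compact K_dual)+
    show "\<And>x s. x \<in> K \<Longrightarrow> act s x \<in> K" using S.act_closed by simp
    show "\<And>s. continuous_map (top_of_set K) (top_of_set K) (act s)" by (rule S.continuous_act)
    show "\<And>x s t. x \<in> K \<Longrightarrow> act s (act t x) = act (s * t) x" using S.act_mult by simp
    show "\<And>x y s. x \<in> K \<Longrightarrow> y \<in> K \<Longrightarrow> N1 (act s x - act s y) \<le> N1 (x - y)"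
      using hyps(2) by (simp add: nonexpansive_on_def)
    show "\<And>x. x \<in> K \<Longrightarrow> \<exists>M. invariant_mean (top_of_set K) act x M"
      using S.invariant_mean_exists[OF Y(1)] Y(2) by simp
  qed
  show ?thesis using assms(5,3) by (rule N.fixed_points_nonexpansive_retract)
qed

end
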